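(* Let $n\ge 8$ be a multiple of $4$, let $\mathbb{H}$ be a separable Hilbert space, and let $X_1,\dots,X_n$ be independent random compact self-adjoint operators on $\mathbb{H}$ such that, for constants $c,B>0$ and all $i$, $\|X_i\|\le c$ and $\operatorname{tr}(X_i^2)\le B$ almost surely, and such that for all $i$ (with operators $\mu,\Sigma,\Sigma'$ not depending on $i$) $\mathbb{E}X_i=\mu$, $\mathbb{V}X_i=\Sigma$, $\mathbb{V}[(X_i-\mu)^2-\Sigma]=\Sigma'$, with $\Sigma\ne0$. Let $V_n:=\sum_{i\le n}\mathbb{V}X_i=n\Sigma$. With $\tau_l,\tau_u,\sigma_l^2,\sigma_u^2$ the empirical quantities defined in the context, for all $\delta_2,\delta_3\in(0,1)$, $$\mathbb{P}\left(\frac{\operatorname{tr}(V_n)}{\|V_n\|}\ge\frac{\tau_u(\delta_2)}{\sigma_l^2(\delta_3)}\right)\le\delta_2+\delta_3,\qquad \mathbb{P}\left(\frac{\operatorname{tr}(V_n)}{\|V_n\|}\le\frac{\tau_l(\delta_2)}{\sigma_u^2(\delta_3)}\right)\le\delta_2+\delta_3,$$ where $\tau_u(\delta_2)/\sigma_l^2(\delta_3)$ is read as $+\infty$ when $\sigma_l^2(\delta_3)=0$.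
   Context: $\|\cdot\|$ is the operator norm, $\operatorname{tr}$ the trace, and $\mathbb{V}X:=\mathbb{E}(X-\mathbb{E}X)^2$ for a random self-adjoint operator $X$. Auxiliary operators: for $i=1,\dots,n/2$, $X_i':=\tfrac12(X_{2i-1}-X_{2i})^2$; for $i=1,\dots,n/4$, $X_i'':=\tfrac12(X_{2i-1}'-X_{2i}')^2$. Put $\Sigma_n:=\frac2n\sum_{i=1}^{n/2}X_i'$ and $\Sigma_n':=\frac4n\sum_{i=1}^{n/4}X_i''$. Scalar sample variance: for real $\mathbf{Z}=(Z_1,\dots,Z_m)$, $\varsigma_m^2(\mathbf{Z}):=\frac{1}{m(m-1)}\sum_{1\le i<j\le m}(Z_i-Z_j)^2$. With $Z_i=\operatorname{tr}(X_i')$ ($i\le n/2$) and $Z_i'=\operatorname{tr}(X_i'')$ ($i\le n/4$), $$\tau_u(\delta):=\operatorname{tr}(\Sigma_n)+\varsigma_{n/2}(\mathbf{Z})\sqrt{\frac{2\log(2/\delta)}{n/2}}+\frac{7(2B)\log(2/\delta)}{3(n/2-1)},$$ $$\tau_l(\delta):=\operatorname{tr}(\Sigma_n)-\varsigma_{n/2}(\mathbf{Z})\sqrt{\frac{2\log(2/\delta)}{n/2}}-\frac{7(2B)\log(2/\delta)}{3(n/2-1)},$$ $$\tau_u'(\delta):=\operatorname{tr}(\Sigma_n')+\varsigma_{n/4}(\mathbf{Z}')\sqrt{\frac{2\log(2/\delta)}{n/4}}+\frac{7(4Bc^2)\log(2/\delta)}{3(n/4-1)}.$$ Further, for $\tau\ge0$,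 $$\Gamma_{c,\delta}(\tau):=\sqrt{\frac{2\tau}{n/2}\log(2/\delta)}+\frac{2c^2}{3(n/2)}\log(2/\delta),$$ $$\sigma_u^2(\tau;\delta):=\|\Sigma_n\|+\Gamma_{c,\delta}(\tau),\qquad \sigma_l^2(\tau;\delta):=\max\left(0,\|\Sigma_n\|-\Gamma_{c,\delta}(\tau)\right),$$ and $$\sigma_u^2(\delta_3):=\sigma_u^2\!\left(\tau_u'(\delta_3/2);\delta_3/2\right),\qquad \sigma_l^2(\delta_3):=\sigma_l^2\!\left(\tau_u'(\delta_3/2);\delta_3/2\right).$$ *)

theory Defs
  imports "HOL-Probability.Probability"
begin

section \<open>Hilbert spaces over the real or the complex numbers\<close>

text \<open>
  Both scalar fields are treated at once: \<open>K\<close> is \<open>\<real>\<close> or the whole complex plane, \<open>smult\<close> is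
  scalar multiplication (relevant only for scalars in \<open>K\<close>) and \<open>ip\<close> is the \<open>K\<close>-valued inner
  product, linear in its first argument.  The type classes supply the underlying real Hilbert space
  with its norm, completeness and separability; the class inner product is the real part of \<open>ip\<close>,
  so \<open>ip x x = norm x ^ 2\<close>.
\<close>

locale hilbert_space =
  fixes K :: "complex set"
    and smult :: "complex \<Rightarrow> 'h::{real_inner,banach,second_countable_topology} \<Rightarrow> 'h"
    and ip :: "'h \<Rightarrow> 'h \<Rightarrow> complex"
  assumes field: "K = \<real> \<or> K = UNIV"
    and smult_add_right: "a \<in> K \<Longrightarrow> smult a (x + y) = smult a x + smult a y"
    and smult_add_left: "a \<in> K \<Longrightarrow> b \<in> K \<Longrightarrow> smult (a + b) x = smult a x + smult b x"
    and smult_smult: "a \<in> K \<Longrightarrow> b \<in> K \<Longrightarrow> smult a (smult b x) = smult (a * b) x"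
    and smult_of_real: "smult (of_real r) x = r *\<^sub>R x"
    and ip_in: "ip x y \<in> K"
    and ip_add_left: "ip (x + y) z = ip x z + ip y z"
    and ip_smult_left: "a \<in> K \<Longrightarrow> ip (smult a x) y = a * ip x y"
    and ip_commute: "ip y x = cnj (ip x y)"
    and Re_ip: "Re (ip x y) = x \<bullet> y"

lemma hilbert_space_real:
  "hilbert_space \<real> (\<lambda>a x. Re a *\<^sub>R x)
     (\<lambda>x y::'h::{real_inner,banach,second_countable_topology}. complex_of_real (x \<bullet> y))"
  by unfold_locales
    (auto simp: algebra_simps inner_commute complex_eq_iff complex_is_Real_iff)

lemma hilbert_space_complex:
  "hilbert_space UNIV (*) (\<lambda>x y::complex. x * cnj y)"
  by unfold_locales (auto simp: algebra_simps scaleR_conv_of_real inner_complex_def)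

definition orthonormal :: "('h \<Rightarrow> 'h \<Rightarrow> complex) \<Rightarrow> 'h set \<Rightarrow> bool" where
  "orthonormal ip E \<longleftrightarrow> (\<forall>e\<in>E. \<forall>f\<in>E. ip e f = (if e = f then 1 else 0))"

definition orthonormal_basis :: "('h::zero \<Rightarrow> 'h \<Rightarrow> complex) \<Rightarrow> 'h set \<Rightarrow> bool" where
  "orthonormal_basis ip E \<longleftrightarrow>
     orthonormal ip E \<and> (\<forall>x. (\<forall>e\<in>E. ip x e = 0) \<longrightarrow> x = 0)"

text \<open>Such a basis exists, so the choice in \<open>basis\<close> below is meaningful.\<close>

lemma (in hilbert_space) orthonormal_basis_exists: "\<exists>E. orthonormal_basis ip E"
proof -
  have rK: "complex_of_real r \<in> K" for r
    using field by auto
  have ipr: "ip (r *\<^sub>R x) y = of_real r * ip x y" for r x y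
    using ip_smult_left[OF rK] by (simp add: smult_of_real)
  have ipr': "ip x (r *\<^sub>R y) = of_real r * ip x y" for r x y
    by (metis ip_commute ipr complex_cnj_complex_of_real complex_cnj_mult)
  have "\<exists>E\<in>Collect (orthonormal ip). \<forall>F\<in>Collect (orthonormal ip). E \<subseteq> F \<longrightarrow> F = E"
  proof (rule subset_Zorn')
    fix C assume C: "subset.chain (Collect (orthonormal ip)) C"
    show "\<Union>C \<in> Collect (orthonormal ip)"
      unfolding mem_Collect_eq orthonormal_def
    proof (intro ballI)
      fix e f assume "e \<in> \<Union>C" "f \<in> \<Union>C"
      then obtain A B where AB: "A \<in> C" "B \<in> C" "e \<in> A" "f \<in> B" by blast
      then have "A \<subseteq> B \<or> B \<subseteq> A" and "orthonormal ip A" "orthonormal ip B"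
        using C by (auto simp: subset_chain_def)
      with AB show "ip e f = (if e = f then 1 else 0)"
        unfolding orthonormal_def by blast
    qed
  qed
  then obtain E where E: "orthonormal ip E"
    and max: "\<And>F. orthonormal ip F \<Longrightarrow> E \<subseteq> F \<Longrightarrow> F = E" by auto
  have "x = 0" if x: "\<forall>e\<in>E. ip x e = 0" for x
  proof (rule ccontr)
    assume "x \<noteq> 0"
    define u where "u = (1 / norm x) *\<^sub>R x"
    have "ip u u = 1"
    proof -
      have "Im (ip u u) = 0"
        using ip_commute[of u u] by (metis cnj.simps(2) equal_neg_zero)
      moreover have "Re (ip u u) = 1"
        using \<open>x \<noteq> 0\<close> by (simp add: Re_ip u_def dot_square_norm power2_eq_square)
      ultimately show ?thesis by (simp add: complex_eq_iff)
    qed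
    moreover have ue: "ip u e = 0" "ip e u = 0" if "e \<in> E" for e
      using x that ip_commute[of u e] by (auto simp: u_def ipr)
    ultimately have "orthonormal ip (insert u E)"
      using E unfolding orthonormal_def by auto
    then have "u \<in> E" using max[of "insert u E"] by blast
    with ue \<open>ip u u = 1\<close> show False by fastforce
  qed
  with E show ?thesis unfolding orthonormal_basis_def by blast
qed

definition basis :: "('h::zero \<Rightarrow> 'h \<Rightarrow> complex) \<Rightarrow> 'h set" where
  "basis ip = (SOME E. orthonormal_basis ip E)"


section \<open>Operators\<close>

type_synonym 'h operator = "'h \<Rightarrow>\<^sub>L 'h"

text \<open>A self-adjoint operator is automatically \<open>K\<close>-linear.\<close>

definition self_adjoint ::
    "('h \<Rightarrow> 'h \<Rightarrow> complex) \<Rightarrow> 'h::real_normed_vector operator \<Rightarrow> bool" where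
  "self_adjoint ip T \<longleftrightarrow> (\<forall>x y. ip (T x) y = ip x (T y))"

definition compact_operator :: "'h::real_normed_vector operator \<Rightarrow> bool" where
  "compact_operator T \<longleftrightarrow> compact (closure (blinfun_apply T ` cball 0 1))"

definition opsq :: "'h::real_normed_vector operator \<Rightarrow> 'h operator" where
  "opsq T = T o\<^sub>L T"

text \<open>
  The diagonal sum is real for self-adjoint \<open>T\<close>, hence the \<open>Re\<close>.  For positive \<open>T\<close>,
  \<open>finite_trace\<close> says that \<open>T\<close> is trace class; \<open>infsum\<close> is 0 on families that are not summable,
  so a bound on a trace has to be accompanied by \<open>finite_trace\<close>.
\<close>

definition tr :: "('h \<Rightarrow> 'h \<Rightarrow> complex) \<Rightarrow> 'h::real_normed_vector operator \<Rightarrow> real" where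
  "tr ip T = Re (\<Sum>\<^sub>\<infinity>e\<in>basis ip. ip (T e) e)"

definition finite_trace ::
    "('h \<Rightarrow> 'h \<Rightarrow> complex) \<Rightarrow> 'h::real_normed_vector operator \<Rightarrow> bool" where
  "finite_trace ip T \<longleftrightarrow> (\<lambda>e. ip (T e) e) summable_on basis ip"

text \<open>
  The space of operators is not separable, so the expectation is taken pointwise, as a Bochner
  integral in the Hilbert space.  For random compact operators that are almost surely bounded by a
  constant, and for polynomials in them, this agrees with the Bochner integral in operator norm.
\<close>

definition expect ::
    "'w measure \<Rightarrow> ('w \<Rightarrow> 'h::{banach,second_countable_topology} operator) \<Rightarrow> 'h operator" where
  "expect M X = Blinfun (\<lambda>h. \<integral>\<omega>. X \<omega> h \<partial>M)"

definition var ::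
    "'w measure \<Rightarrow> ('w \<Rightarrow> 'h::{banach,second_countable_topology} operator) \<Rightarrow> 'h operator" where
  "var M X = expect M (\<lambda>\<omega>. opsq (X \<omega> - expect M X))"


section \<open>Empirical quantities\<close>

text \<open>
  Here \<open>X\<close> is one realisation of the sample, indexed from 1.  The operators \<open>X'\<close> are
  \<open>pairsq X\<close> and the operators \<open>X''\<close> are \<open>pairsq (pairsq X)\<close>.
\<close>

definition pairsq ::
    "(nat \<Rightarrow> 'h::real_normed_vector operator) \<Rightarrow> nat \<Rightarrow> 'h operator" where
  "pairsq X i = (1/2) *\<^sub>R opsq (X (2*i - 1) - X (2*i))"

definition Sigma_n ::
    "nat \<Rightarrow> (nat \<Rightarrow> 'h::real_normed_vector operator) \<Rightarrow> 'h operator" where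
  "Sigma_n n X = (2 / real n) *\<^sub>R (\<Sum>i=1..n div 2. pairsq X i)"

definition Sigma_n' ::
    "nat \<Rightarrow> (nat \<Rightarrow> 'h::real_normed_vector operator) \<Rightarrow> 'h operator" where
  "Sigma_n' n X = (4 / real n) *\<^sub>R (\<Sum>i=1..n div 4. pairsq (pairsq X) i)"

definition sample_var :: "nat \<Rightarrow> (nat \<Rightarrow> real) \<Rightarrow> real" where
  "sample_var m Z =
     1 / (real m * (real m - 1)) * (\<Sum>j=1..m. \<Sum>i\<in>{1..<j}. (Z i - Z j)\<^sup>2)"

definition sample_sd :: "nat \<Rightarrow> (nat \<Rightarrow> real) \<Rightarrow> real" where
  "sample_sd m Z = sqrt (sample_var m Z)"

definition tau_u ::
    "('h \<Rightarrow> 'h \<Rightarrow> complex) \<Rightarrow> real \<Rightarrow> nat \<Rightarrow> (nat \<Rightarrow> 'h::real_normed_vector operator) \<Rightarrow> real \<Rightarrow> real"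
  where
  "tau_u ip B n X \<delta> =
     tr ip (Sigma_n n X)
     + sample_sd (n div 2) (\<lambda>i. tr ip (pairsq X i)) * sqrt (2 * ln (2/\<delta>) / (real n / 2))
     + 7 * (2 * B) * ln (2/\<delta>) / (3 * (real n / 2 - 1))"

definition tau_l ::
    "('h \<Rightarrow> 'h \<Rightarrow> complex) \<Rightarrow> real \<Rightarrow> nat \<Rightarrow> (nat \<Rightarrow> 'h::real_normed_vector operator) \<Rightarrow> real \<Rightarrow> real"
  where
  "tau_l ip B n X \<delta> =
     tr ip (Sigma_n n X)
     - sample_sd (n div 2) (\<lambda>i. tr ip (pairsq X i)) * sqrt (2 * ln (2/\<delta>) / (real n / 2))
     - 7 * (2 * B) * ln (2/\<delta>) / (3 * (real n / 2 - 1))"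

definition tau_u' ::
    "('h \<Rightarrow> 'h \<Rightarrow> complex) \<Rightarrow> real \<Rightarrow> real \<Rightarrow> nat \<Rightarrow> (nat \<Rightarrow> 'h::real_normed_vector operator)
      \<Rightarrow> real \<Rightarrow> real"
  where
  "tau_u' ip B c n X \<delta> =
     tr ip (Sigma_n' n X)
     + sample_sd (n div 4) (\<lambda>i. tr ip (pairsq (pairsq X) i)) * sqrt (2 * ln (2/\<delta>) / (real n / 4))
     + 7 * (4 * B * c\<^sup>2) * ln (2/\<delta>) / (3 * (real n / 4 - 1))"

definition Gamma_dev :: "real \<Rightarrow> nat \<Rightarrow> real \<Rightarrow> real \<Rightarrow> real" where
  "Gamma_dev c n \<delta> \<tau> =
     sqrt (2 * \<tau> / (real n / 2) * ln (2/\<delta>)) + 2 * c\<^sup>2 / (3 * (real n / 2)) * ln (2/\<delta>)"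

definition sigma2_u_at ::
    "real \<Rightarrow> nat \<Rightarrow> (nat \<Rightarrow> 'h::real_normed_vector operator) \<Rightarrow> real \<Rightarrow> real \<Rightarrow> real" where
  "sigma2_u_at c n X \<tau> \<delta> = norm (Sigma_n n X) + Gamma_dev c n \<delta> \<tau>"

definition sigma2_l_at ::
    "real \<Rightarrow> nat \<Rightarrow> (nat \<Rightarrow> 'h::real_normed_vector operator) \<Rightarrow> real \<Rightarrow> real \<Rightarrow> real" where
  "sigma2_l_at c n X \<tau> \<delta> = max 0 (norm (Sigma_n n X) - Gamma_dev c n \<delta> \<tau>)"

definition sigma2_u ::
    "('h \<Rightarrow> 'h \<Rightarrow> complex) \<Rightarrow> real \<Rightarrow> real \<Rightarrow> nat \<Rightarrow> (nat \<Rightarrow> 'h::real_normed_vector operator)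
      \<Rightarrow> real \<Rightarrow> real"
  where
  "sigma2_u ip B c n X \<delta> = sigma2_u_at c n X (tau_u' ip B c n X (\<delta>/2)) (\<delta>/2)"

definition sigma2_l ::
    "('h \<Rightarrow> 'h \<Rightarrow> complex) \<Rightarrow> real \<Rightarrow> real \<Rightarrow> nat \<Rightarrow> (nat \<Rightarrow> 'h::real_normed_vector operator)
      \<Rightarrow> real \<Rightarrow> real"
  where
  "sigma2_l ip B c n X \<delta> = sigma2_l_at c n X (tau_u' ip B c n X (\<delta>/2)) (\<delta>/2)"

end

theory Submission
  imports Defs
begin

text \<open>
  Since \<open>X'\<close> has expectation \<open>\<Sigma>\<close>, the number \<open>tr \<Sigma>\<close> is the mean of bounded independent variables
  \<open>tr X'\<close> and is estimated by an empirical Bernstein inequality.  For \<open>\<parallel>\<Sigma>\<parallel>\<close> one bounds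
  \<open>\<parallel>\<Sigma>\<^sub>n - \<Sigma>\<parallel>\<close> by an argument in the style of Pinelis.  The functional
  \<open>\<Phi>(S) = 1 + tr (cosh S - 1)\<close> dominates \<open>cosh \<parallel>S\<parallel>\<close>, and expanding the powers of \<open>S + Y\<close> into words
  gives \<open>\<Phi>(S + Y) \<le> \<Phi>(S) + (linear in Y) + \<parallel>Y\<parallel>\<^sub>H\<^sub>S\<^sup>2 (e\<^sup>L - 1 - L) / L\<^sup>2 cosh \<parallel>S\<parallel>\<close> for
  \<open>\<parallel>Y\<parallel> \<le> L\<close>.  So an independent centered summand increases the expectation of \<open>\<Phi>\<close> at most by
  the factor \<open>1 + E \<parallel>Y\<parallel>\<^sub>H\<^sub>S\<^sup>2 (e\<^sup>L - 1 - L) / L\<^sup>2\<close>: the variance proxy is a trace, whereas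
  the range \<open>L\<close> is measured in operator norm.  The trace in question is the average of the means
  of the variables \<open>tr X''\<close>, and is estimated by the empirical Bernstein inequality again.  These
  variables need not have equal means.

  The empirical Bernstein inequality combines two Chernoff bounds, one for the mean and one for the
  lower tail of the second moment about a suitably shifted center.
\<close>

section \<open>The orthonormal basis as a sequence\<close>

text \<open>The trace of cosh S itself is infinite in infinite dimension, hence the subtraction of 1
  before the trace is taken. The resulting functional is 1 at the zero operator, so no dimension
  enters the tail bound. Cosh rather than exp: even powers of a self-adjoint operator are positive,
  whereas negative spectrum would let 1 + tr (exp S - 1) drop below exp \<parallel>S\<parallel>. In
  a word with at least two letters Y, two of them are paired by Cauchy-Schwarz for the
  Hilbert-Schmidt inner product and all other letters are measured in operator norm; this is why the
  proxy is a trace while the range is a norm. Words are handled for operators compressed to the span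
  of finitely many basis vectors, where every trace is a finite sum; bounds that do not depend on
  the span then pass to the limit. A second obstacle is that divergent traces are recorded as 0.
  Traces of positive operators are therefore added and integrated with values in
  [0,\<infinity>].\<close>

context hilbert_space
begin

lemma of_real_in_field [simp]: "complex_of_real r \<in> K"
  using field by auto

lemma cnj_in_field: "a \<in> K \<Longrightarrow> cnj a \<in> K"
  using field by (auto simp: complex_is_Real_iff)

lemma ip_zero_left [simp]: "ip 0 y = 0"
  using ip_add_left[of 0 0 y] by simp

lemma ip_zero_right [simp]: "ip x 0 = 0"
  using ip_commute[of 0 x] by simp

lemma ip_add_right: "ip x (y + z) = ip x y + ip x z"
  by (metis ip_commute ip_add_left complex_cnj_add)

lemma ip_scaleR_left: "ip (r *\<^sub>R x) y = of_real r * ip x y"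
  using ip_smult_left[of "of_real r" x y] by (simp add: smult_of_real)

lemma ip_smult_right: "a \<in> K \<Longrightarrow> ip x (smult a y) = cnj a * ip x y"
  by (metis ip_commute ip_smult_left complex_cnj_mult)

lemma ip_scaleR_right: "ip x (r *\<^sub>R y) = of_real r * ip x y"
  using ip_smult_right[of "of_real r" x y] by (simp add: smult_of_real)

lemma ip_minus_left: "ip (- x) y = - ip x y"
  using ip_scaleR_left[of "-1" x y] by simp

lemma ip_minus_right: "ip x (- y) = - ip x y"
  using ip_scaleR_right[of x "-1" y] by simp

lemma ip_diff_left: "ip (x - y) z = ip x z - ip y z"
  using ip_add_left[of x "-y" z] by (simp add: ip_minus_left)

lemma ip_diff_right: "ip x (y - z) = ip x y - ip x z"
  using ip_add_right[of x y "-z"] by (simp add: ip_minus_right)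

lemma ip_sum_left: "ip (sum f A) y = (\<Sum>i\<in>A. ip (f i) y)"
  by (induction A rule: infinite_finite_induct) (auto simp: ip_add_left)

lemma ip_sum_right: "ip x (sum f A) = (\<Sum>i\<in>A. ip x (f i))"
  by (induction A rule: infinite_finite_induct) (auto simp: ip_add_right)

lemma ip_self: "ip x x = of_real ((norm x)\<^sup>2)"
proof -
  have "Im (ip x x) = 0"
    using ip_commute[of x x] by (metis cnj.simps(2) equal_neg_zero)
  then show ?thesis
    by (simp add: complex_eq_iff Re_ip dot_square_norm)
qed

lemma norm_smult: "a \<in> K \<Longrightarrow> norm (smult a x) = cmod a * norm x"
proof -
  assume a: "a \<in> K"
  have "complex_of_real ((norm (smult a x))\<^sup>2) = a * cnj a * ip x x"
    using a unfolding ip_self[symmetric] by (simp add: ip_smult_left ip_smult_right)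
  also have "\<dots> = of_real ((cmod a * norm x)\<^sup>2)"
    by (simp add: ip_self complex_norm_square[symmetric] power_mult_distrib)
  finally have "(norm (smult a x))\<^sup>2 = (cmod a * norm x)\<^sup>2"
    using of_real_eq_iff by blast
  then show ?thesis by (simp add: power2_eq_iff_nonneg)
qed

lemma norm_ip_le: "cmod (ip x y) \<le> norm x * norm y"
proof (cases "ip x y = 0")
  case False
  \<comment> \<open>A phase that makes \<open>ip (smult a x) y\<close> equal to its modulus, since
    the class inner product sees only real parts. For real scalars the phase is 1 or -1, so it stays
    in \<open>K\<close>.\<close>
  define a where "a = cnj (ip x y) / of_real (cmod (ip x y))"
  have a: "a \<in> K"
    using cnj_in_field[OF ip_in, of x y] field
    by (auto simp: a_def complex_is_Real_iff Im_divide)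
  have na: "cmod a = 1" using False by (simp add: a_def norm_divide)
  have "ip (smult a x) y = of_real (cmod (ip x y))"
    using False a
    by (simp add: ip_smult_left a_def mult.commute[of "cnj _"] complex_norm_square[symmetric]
        power2_eq_square)
  then have "cmod (ip x y) = smult a x \<bullet> y"
    by (metis Re_ip Re_complex_of_real)
  also have "\<dots> \<le> norm (smult a x) * norm y" by (rule norm_cauchy_schwarz)
  finally show ?thesis by (simp add: norm_smult a na)
qed auto

lemma bounded_linear_ip_left: "bounded_linear (\<lambda>x. ip x y)"
  by (rule bounded_linear_intro[where K = "norm y"])
    (auto simp: ip_add_left ip_scaleR_left scaleR_conv_of_real norm_ip_le)

lemma bounded_linear_ip_right: "bounded_linear (\<lambda>y. ip x y)"
  by (rule bounded_linear_intro[where K = "norm x"])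
    (auto simp: ip_add_right ip_scaleR_right scaleR_conv_of_real norm_ip_le mult.commute[of "norm x"]
      intro: order_trans[OF norm_ip_le])

lemma bounded_linear_smult_left: "bounded_linear (\<lambda>x. smult (ip x y) z)"
proof (rule bounded_linear_intro[where K = "norm y * norm z"])
  fix x x' show "smult (ip (x + x') y) z = smult (ip x y) z + smult (ip x' y) z"
    by (simp add: ip_add_left smult_add_left ip_in)
next
  fix r x show "smult (ip (r *\<^sub>R x) y) z = r *\<^sub>R smult (ip x y) z"
    by (simp add: ip_scaleR_left smult_smult[symmetric] ip_in smult_of_real)
next
  fix x show "norm (smult (ip x y) z) \<le> norm x * (norm y * norm z)"
    using mult_right_mono[OF norm_ip_le[of x y], of "norm z"] by (simp add: norm_smult ip_in mult.assoc)
qed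

lemma orthonormal_basis_basis: "orthonormal_basis ip (basis ip)"
  unfolding basis_def using orthonormal_basis_exists by (rule someI_ex)

lemma basis_ip: "e \<in> basis ip \<Longrightarrow> f \<in> basis ip \<Longrightarrow> ip e f = (if e = f then 1 else 0)"
  using orthonormal_basis_basis by (auto simp: orthonormal_basis_def orthonormal_def)

lemma norm_basis: "e \<in> basis ip \<Longrightarrow> norm e = 1"
  using basis_ip[of e e] by (metis ip_self norm_ge_zero of_real_eq_1_iff power2_eq_1_iff zero_le_square neg_equal_iff_equal
      abs_of_nonneg abs_neg_one)

text \<open>Distinct basis vectors have distance sqrt 2, so the balls of radius 1/2 around them are
  disjoint open sets, and a second countable space has only countably many of these.\<close>

lemma countable_basis: "countable (basis ip)"
proof -
  have far: "dist e f > 1" if "e \<in> basis ip" "f \<in> basis ip" "e \<noteq> f" for e f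
  proof -
    have "e \<bullet> f = 0" using that by (metis basis_ip Re_ip zero_complex.sel(1))
    then have "(dist e f)\<^sup>2 = 2"
      using that by (simp add: dist_norm power2_norm_eq_inner inner_diff inner_commute
          norm_eq_1[THEN iffD1, OF norm_basis])
    then show ?thesis
      using power2_le_imp_le[of "dist e f" 1] by (intro not_le_imp_less notI) (auto dest: power_mono[of _ 1 2])
  qed
  have "countable ((\<lambda>e. ball e (1/2)) ` basis ip)"
  proof (rule countable_disjoint_open_subsets)
    show "disjoint ((\<lambda>e. ball e (1/2)) ` basis ip)"
    proof (rule pairwise_imageI)
      fix e f assume ef: "e \<in> basis ip" "f \<in> basis ip" "e \<noteq> f"
      have "x \<notin> ball f (1/2)" if "x \<in> ball e (1/2)" for x
        using far[OF ef] that dist_triangle[of e f x] by (auto simp: dist_commute)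
      then show "disjnt (ball e (1/2)) (ball f (1/2))" by (auto simp: disjnt_def)
    qed
  qed auto
  moreover have "inj_on (\<lambda>e. ball e (1/2)) (basis ip)"
    proof (rule inj_onI, rule ccontr)
    fix e f assume ef: "e \<in> basis ip" "f \<in> basis ip" "ball e (1/2) = ball f (1/2)" "e \<noteq> f"
    have "f \<in> ball e (1/2)" by (simp add: ef(3))
    with far[OF ef(1,2,4)] show False by simp
  qed
  ultimately show ?thesis by (rule countable_image_inj_on)
qed

text \<open>The sequence is 0 at the indices that the enumeration does not use.\<close>

definition bseq :: "nat \<Rightarrow> 'h" where
  "bseq k = (if k \<in> to_nat_on (basis ip) ` basis ip then from_nat_into (basis ip) k else 0)"

lemma bseq_to_nat_on [simp]: "e \<in> basis ip \<Longrightarrow> bseq (to_nat_on (basis ip) e) = e"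
  by (simp add: bseq_def countable_basis)

lemma bseq_cases: "bseq k \<in> basis ip \<or> bseq k = 0"
  by (auto simp: bseq_def countable_basis)

lemma ip_bseq: "ip (bseq j) (bseq k) = (if j = k \<and> bseq k \<noteq> 0 then 1 else 0)"
proof (cases "bseq j \<in> basis ip \<and> bseq k \<in> basis ip")
  case True
  then obtain e f where ef: "e \<in> basis ip" "f \<in> basis ip" "j = to_nat_on (basis ip) e" "k = to_nat_on (basis ip) f"
    unfolding bseq_def using norm_basis[of 0] by (auto split: if_splits)
  then show ?thesis using norm_basis[of f]
    by (auto simp: basis_ip countable_basis inj_on_to_nat_on[THEN inj_on_eq_iff])
next
  case False
  then have "bseq j = 0 \<or> bseq k = 0" using bseq_cases by blast
  then show ?thesis by auto
qed

definition proj :: "nat \<Rightarrow> 'h \<Rightarrow> 'h" where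
  "proj N x = (\<Sum>k<N. smult (ip x (bseq k)) (bseq k))"

lemma bounded_linear_proj: "bounded_linear (proj N)"
  unfolding proj_def by (intro bounded_linear_sum bounded_linear_smult_left)

lemmas linear_proj = bounded_linear.linear[OF bounded_linear_proj]

lemma ip_proj_left: "ip (proj N x) y = (\<Sum>k<N. ip x (bseq k) * ip (bseq k) y)"
  by (simp add: proj_def ip_sum_left ip_smult_left ip_in)

lemma ip_proj_right: "ip x (proj N y) = (\<Sum>k<N. ip x (bseq k) * ip (bseq k) y)"
  by (simp add: proj_def ip_sum_right ip_smult_right ip_in ip_commute[symmetric] mult.commute)

lemma proj_selfadjoint: "ip (proj N x) y = ip x (proj N y)"
  by (simp add: ip_proj_left ip_proj_right)

lemma ip_proj_bseq: "ip (proj N x) (bseq j) = (if j < N then ip x (bseq j) else 0)"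
proof -
  have "ip (proj N x) (bseq j) = (\<Sum>k<N. if k = j then ip x (bseq j) else 0)"
    unfolding ip_proj_left by (rule sum.cong) (auto simp: ip_bseq)
  then show ?thesis by simp
qed

lemma smult_zero_left [simp]: "smult 0 x = 0"
  using smult_of_real[of 0 x] by simp

lemma proj_proj_le:
  assumes "M \<le> N"
  shows "proj N (proj M x) = proj M x"
proof -
  have "proj N (proj M x) = (\<Sum>k<M. smult (ip x (bseq k)) (bseq k))"
    unfolding proj_def[of N] by (rule sum.mono_neutral_cong_right) (use assms in \<open>auto simp: ip_proj_bseq\<close>)
  then show ?thesis by (simp add: proj_def)
qed

lemma proj_proj: "proj N (proj N x) = proj N x"
  by (rule proj_proj_le) simp

lemma norm_proj: "(norm (proj N x))\<^sup>2 = (\<Sum>k<N. (cmod (ip x (bseq k)))\<^sup>2)"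
proof -
  have "complex_of_real ((norm (proj N x))\<^sup>2) = ip x (proj N x)"
    by (metis ip_self proj_selfadjoint proj_proj)
  also have "\<dots> = of_real (\<Sum>k<N. (cmod (ip x (bseq k)))\<^sup>2)"
    unfolding ip_proj_right of_real_sum
    by (rule sum.cong[OF refl]) (metis complex_norm_square ip_commute)
  finally show ?thesis using of_real_eq_iff by blast
qed

lemma norm_proj_le: "norm (proj N x) \<le> norm x"
proof -
  have "complex_of_real ((norm (proj N x))\<^sup>2) = ip x (proj N x)"
    by (metis ip_self proj_selfadjoint proj_proj)
  then have "(norm (proj N x))\<^sup>2 \<le> norm x * norm (proj N x)"
    using norm_ip_le[of x "proj N x"] by (metis norm_of_real abs_of_nonneg zero_le_power2)
  then show ?thesis by (cases "norm (proj N x) = 0") (auto simp: power2_eq_square)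
qed

lemma summable_ip_bseq: "summable (\<lambda>k. (cmod (ip x (bseq k)))\<^sup>2)"
  by (rule summableI_nonneg_bounded[where x = "(norm x)\<^sup>2"])
    (auto simp: norm_proj[symmetric] intro!: power_mono norm_proj_le)

lemma norm_proj_diff:
  assumes "M \<le> N"
  shows "(norm (proj N x - proj M x))\<^sup>2 = (\<Sum>k=M..<N. (cmod (ip x (bseq k)))\<^sup>2)"
proof -
  have "proj N x - proj M x = proj N (x - proj M x)"
    using proj_proj_le[OF assms] by (simp add: linear_diff[OF linear_proj])
  then have "(norm (proj N x - proj M x))\<^sup>2 = (\<Sum>k<N. (cmod (ip (x - proj M x) (bseq k)))\<^sup>2)"
    by (simp add: norm_proj)
  also have "\<dots> = (\<Sum>k=M..<N. (cmod (ip x (bseq k)))\<^sup>2)"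
    by (rule sum.mono_neutral_cong_right) (auto simp: ip_diff_left ip_proj_bseq)
  finally show ?thesis .
qed

lemma eq_zero_if_ip_bseq: "(\<And>k. ip x (bseq k) = 0) \<Longrightarrow> x = 0"
  using orthonormal_basis_basis bseq_to_nat_on unfolding orthonormal_basis_def by metis

text \<open>Summability of the squared coefficients makes the partial expansions Cauchy; their limit
  has the same coefficients as \<open>x\<close>, and an orthonormal basis separates points.\<close>

lemma proj_tendsto: "(\<lambda>N. proj N x) \<longlonglongrightarrow> x"
proof -
  have "Cauchy (\<lambda>N. proj N x)"
  proof (rule metric_CauchyI)
    fix e :: real assume "e > 0"
    then have "e\<^sup>2 > 0" by simp
    with summable_ip_bseq[of x] obtain M where M: "\<And>m n. m \<ge> M \<Longrightarrow> norm (\<Sum>k=m..<n. (cmod (ip x (bseq k)))\<^sup>2) < e\<^sup>2"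
      unfolding summable_Cauchy by blast
    have *: "dist (proj n x) (proj m x) < e" if "M \<le> m" "m \<le> n" for m n
    proof -
      have "(dist (proj n x) (proj m x))\<^sup>2 < e\<^sup>2"
        using M[OF that(1), of n] norm_proj_diff[OF that(2), of x] by (simp add: dist_norm sum_nonneg)
      then show ?thesis using \<open>e > 0\<close> by (auto intro: power_less_imp_less_base)
    qed
    show "\<exists>M. \<forall>m\<ge>M. \<forall>n\<ge>M. dist (proj m x) (proj n x) < e"
      by (rule exI[of _ M]) (metis * dist_commute nle_le)
  qed
  then obtain y where y: "(\<lambda>N. proj N x) \<longlonglongrightarrow> y"
    by (auto simp: Cauchy_convergent_iff convergent_def)
  have "ip (x - y) (bseq k) = 0" for k
  proof -
    have "(\<lambda>N. ip (proj N x) (bseq k)) \<longlonglongrightarrow> ip y (bseq k)"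
      by (rule bounded_linear.tendsto[OF bounded_linear_ip_left y])
    moreover have "(\<lambda>N. ip (proj N x) (bseq k)) \<longlonglongrightarrow> ip x (bseq k)"
      by (rule tendsto_eventually) (use eventually_gt_at_top[of k] in eventually_elim, simp add: ip_proj_bseq)
    ultimately show ?thesis using LIMSEQ_unique by (fastforce simp: ip_diff_left)
  qed
  then have "x - y = 0" by (rule eq_zero_if_ip_bseq)
  with y show ?thesis by simp
qed

lemma parseval: "(\<lambda>k. (cmod (ip x (bseq k)))\<^sup>2) sums (norm x)\<^sup>2"
proof -
  have "(\<lambda>N. (norm (proj N x))\<^sup>2) \<longlonglongrightarrow> (norm x)\<^sup>2"
    by (intro tendsto_intros proj_tendsto)
  then show ?thesis by (simp add: sums_def norm_proj)
qed

end

section \<open>Traces of powers of a sum\<close>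

lemma exp_tail_nonneg: "0 \<le> exp x - 1 - (x::real)"
  using exp_ge_add_one_self[of x] by linarith

lemma le_sinh_real:
  assumes "0 \<le> (x::real)"
  shows "x \<le> sinh x"
proof -
  have "sinh 0 - 0 \<le> sinh x - x"
  proof (rule DERIV_nonneg_imp_nondecreasing[OF assms])
    fix y :: real
    have "((\<lambda>x. sinh x - x) has_real_derivative (cosh y - 1)) (at y)"
      by (auto intro!: derivative_eq_intros)
    then show "\<exists>d. ((\<lambda>x. sinh x - x) has_real_derivative d) (at y) \<and> 0 \<le> d"
      using cosh_real_ge_1[of y] by (intro exI[of _ "cosh y - 1"]) auto
  qed
  then show ?thesis by simp
qed

text \<open>Replacing sinh s by cosh s leaves a single multiple of cosh s. As that is at most the
  functional, the increment turns into a factor and the bound can be iterated.\<close>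

lemma cosh_add_tail_le:
  fixes s l :: real
  assumes "s \<ge> 0" "l \<ge> 0"
  shows "cosh (s + l) - cosh s - l * sinh s \<le> (exp l - 1 - l) * cosh s"
proof -
  have "cosh (s + l) - cosh s - l * sinh s = cosh s * (cosh l - 1) + sinh s * (sinh l - l)"
    by (simp add: cosh_add algebra_simps)
  also have "\<dots> \<le> cosh s * (cosh l - 1) + cosh s * (sinh l - l)"
  proof -
    have "sinh l \<ge> l" using assms(2) le_sinh_real by simp
    then show ?thesis using sinh_less_cosh_real[of s] by (intro add_left_mono mult_right_mono) auto
  qed
  also have "\<dots> = (exp l - 1 - l) * cosh s"
    by (simp add: cosh_plus_sinh[symmetric] algebra_simps)
  finally show ?thesis .
qed

lemma cosh_ge_half_exp: "exp (x::real) / 2 \<le> cosh x"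
  by (simp add: cosh_field_def)

section \<open>Truncated Hilbert-Schmidt norms and traces\<close>

context hilbert_space
begin

text \<open>Self-adjointness for plain functions, so that it applies to the iterates
  \<open>f ^^ n\<close> and to words, which are not bundled as operators.\<close>

definition selfadj :: "('h \<Rightarrow> 'h) \<Rightarrow> bool" where
  "selfadj f \<longleftrightarrow> (\<forall>x y. ip (f x) y = ip x (f y))"

lemma selfadj_funpow: "selfadj f \<Longrightarrow> selfadj (f ^^ n)"
  by (induction n) (auto simp: selfadj_def funpow_swap1)

lemma selfadj_inner: "selfadj f \<Longrightarrow> f x \<bullet> y = x \<bullet> f y"
  by (metis selfadj_def Re_ip)

text \<open>The Hilbert-Schmidt norm, cut off at the first \<open>N\<close> indices. Nothing is lost
  for a self-adjoint operator with range in the span of these vectors, because it vanishes on the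
  orthogonal complement.\<close>

definition hsn :: "nat \<Rightarrow> ('h \<Rightarrow> 'h) \<Rightarrow> real" where
  "hsn N f = L2_set (\<lambda>k. norm (f (bseq k))) {..<N}"

definition trn :: "nat \<Rightarrow> ('h \<Rightarrow> 'h) \<Rightarrow> real" where
  "trn N f = (\<Sum>k<N. f (bseq k) \<bullet> bseq k)"

lemma hsn_nonneg [simp]: "0 \<le> hsn N f"
  by (simp add: hsn_def L2_set_nonneg)

lemma hsn_sq: "(hsn N f)\<^sup>2 = (\<Sum>k<N. (norm (f (bseq k)))\<^sup>2)"
  by (simp add: hsn_def L2_set_def sum_nonneg)

lemma hsn_add_le: "hsn N (\<lambda>x. f x + g x) \<le> hsn N f + hsn N g"
proof -
  have "hsn N (\<lambda>x. f x + g x) \<le> L2_set (\<lambda>k. norm (f (bseq k)) + norm (g (bseq k))) {..<N}"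
    unfolding hsn_def by (rule L2_set_mono) (auto intro: norm_triangle_ineq)
  also have "\<dots> \<le> hsn N f + hsn N g" unfolding hsn_def by (rule L2_set_triangle_ineq)
  finally show ?thesis .
qed

lemma abs_sum_inner_le_hsn: "\<bar>\<Sum>k<N. f (bseq k) \<bullet> g (bseq k)\<bar> \<le> hsn N f * hsn N g"
proof -
  have "\<bar>\<Sum>k<N. f (bseq k) \<bullet> g (bseq k)\<bar> \<le> (\<Sum>k<N. \<bar>norm (f (bseq k))\<bar> * \<bar>norm (g (bseq k))\<bar>)"
    by (rule order_trans[OF sum_abs]) (auto intro!: sum_mono Cauchy_Schwarz_ineq2)
  also have "\<dots> \<le> hsn N f * hsn N g" unfolding hsn_def by (rule L2_set_mult_ineq)
  finally show ?thesis .
qed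

lemma hsn_comp_left_le:
  assumes "\<And>x. norm (f x) \<le> a * norm x" "0 \<le> a"
  shows "hsn N (\<lambda>x. f (g x)) \<le> a * hsn N g"
proof -
  have "hsn N (\<lambda>x. f (g x)) \<le> L2_set (\<lambda>k. a * norm (g (bseq k))) {..<N}"
    unfolding hsn_def by (rule L2_set_mono) (auto intro: assms)
  also have "\<dots> = a * hsn N g" using assms(2) by (simp add: hsn_def L2_set_right_distrib)
  finally show ?thesis .
qed

text \<open>A factor on the right is moved to the left by taking adjoints, which preserves the sum
  of squared matrix entries. As \<open>f\<close> may leave the span, the truncated sum drops
  coordinates after the swap, and this only decreases it.\<close>

lemma hsn_comp_right_le:
  assumes Y: "selfadj Y" "\<And>x. proj N (Y x) = Y x" and f: "selfadj f"
    and a: "\<And>x. norm (f x) \<le> a * norm x" "0 \<le> a"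
  shows "hsn N (\<lambda>x. Y (f x)) \<le> a * hsn N Y"
proof -
  have "(hsn N (\<lambda>x. Y (f x)))\<^sup>2 = (\<Sum>k<N. \<Sum>j<N. (cmod (ip (Y (f (bseq k))) (bseq j)))\<^sup>2)"
    unfolding hsn_sq by (rule sum.cong) (auto simp: norm_proj[symmetric] Y(2))
  also have "\<dots> = (\<Sum>j<N. \<Sum>k<N. (cmod (ip (f (Y (bseq j))) (bseq k)))\<^sup>2)"
  proof (subst sum.swap, intro sum.cong refl arg_cong[where f = "\<lambda>x. x\<^sup>2"])
    fix j k
    show "cmod (ip (Y (f (bseq k))) (bseq j)) = cmod (ip (f (Y (bseq j))) (bseq k))"
      using Y(1) f by (metis selfadj_def ip_commute complex_mod_cnj)
  qed
  also have "\<dots> = (\<Sum>j<N. (norm (proj N (f (Y (bseq j)))))\<^sup>2)"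
    by (simp add: norm_proj)
  also have "\<dots> \<le> (hsn N (\<lambda>x. f (Y x)))\<^sup>2"
    unfolding hsn_sq by (intro sum_mono power_mono norm_proj_le) auto
  also have "\<dots> \<le> (a * hsn N Y)\<^sup>2"
    by (intro power_mono hsn_comp_left_le a hsn_nonneg)
  finally show ?thesis
    by (rule power2_le_imp_le) (simp add: a)
qed

lemma proj_bseq:
  assumes "j < N"
  shows "proj N (bseq j) = bseq j"
proof -
  have "proj N (bseq j) = (\<Sum>k<N. if k = j then bseq j else 0)"
    unfolding proj_def using smult_of_real[of 1] smult_of_real[of 0] by (intro sum.cong) (auto simp: ip_bseq)
  then show ?thesis using assms by simp
qed

text \<open>Cyclicity of the trace, written with inner products: tr (B Y A) = tr (B A Y) up to
  taking adjoints. \<open>Y\<close> maps into the span, so inserting the projection gives a finite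
  double sum whose order can be exchanged; \<open>A\<close> may leave the span.\<close>

lemma trace_commute:
  assumes Y: "selfadj Y" "\<And>x. proj N (Y x) = Y x" and A: "selfadj A"
    and B: "selfadj B" "\<And>x. proj N x = x \<Longrightarrow> proj N (B x) = B x"
  shows "(\<Sum>k<N. Y (A (bseq k)) \<bullet> B (bseq k)) = (\<Sum>k<N. Y (bseq k) \<bullet> A (B (bseq k)))"
proof -
  have PB: "proj N (B (bseq j)) = B (bseq j)" if "j < N" for j using that by (intro B(2) proj_bseq)
  have "(\<Sum>k<N. ip (Y (A (bseq k))) (B (bseq k)))
      = (\<Sum>k<N. \<Sum>j<N. ip (bseq k) (A (Y (bseq j))) * ip (B (bseq j)) (bseq k))"
    using Y(1) A B(1) unfolding selfadj_def
    by (intro sum.cong refl, subst Y(2)[symmetric], subst ip_proj_left) (metis (no_types, lifting))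
  also have "\<dots> = (\<Sum>j<N. \<Sum>k<N. ip (B (bseq j)) (bseq k) * ip (bseq k) (A (Y (bseq j))))"
    by (subst sum.swap) (simp add: mult.commute)
  also have "\<dots> = (\<Sum>j<N. ip (A (B (bseq j))) (Y (bseq j)))"
    unfolding ip_proj_left[symmetric] using A PB by (auto simp: selfadj_def)
  finally have "Re (\<Sum>k<N. ip (Y (A (bseq k))) (B (bseq k))) = Re (\<Sum>j<N. ip (A (B (bseq j))) (Y (bseq j)))"
    by simp
  then show ?thesis by (simp add: Re_ip inner_commute)
qed

end

text \<open>
  The first-order part \<open>pow1 S Y q\<close> of \<open>(S + Y)\<^sup>q\<close> collects the words with exactly one \<open>Y\<close>,
  \<open>pow2 S Y q\<close> those with at least two.
\<close>

primrec pow1 :: "('a \<Rightarrow> 'a::real_vector) \<Rightarrow> ('a \<Rightarrow> 'a) \<Rightarrow> nat \<Rightarrow> 'a \<Rightarrow> 'a" where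
  "pow1 S Y 0 x = 0"
| "pow1 S Y (Suc q) x = S (pow1 S Y q x) + Y ((S ^^ q) x)"

primrec pow2 :: "('a \<Rightarrow> 'a::real_vector) \<Rightarrow> ('a \<Rightarrow> 'a) \<Rightarrow> nat \<Rightarrow> 'a \<Rightarrow> 'a" where
  "pow2 S Y 0 x = 0"
| "pow2 S Y (Suc q) x = (S (pow2 S Y q x) + Y (pow2 S Y q x)) + Y (pow1 S Y q x)"

lemma funpow_add_expand:
  assumes "linear S" "linear Y"
  shows "((\<lambda>x. S x + Y x) ^^ q) x = (S ^^ q) x + pow1 S Y q x + pow2 S Y q x"
  by (induction q) (auto simp: linear_add[OF assms(1)] linear_add[OF assms(2)])

lemma norm_funpow_le:
  fixes f :: "'a::real_normed_vector \<Rightarrow> 'a"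
  assumes "\<And>x. norm (f x) \<le> a * norm x" "0 \<le> a"
  shows "norm ((f ^^ n) x) \<le> a ^ n * norm x"
proof (induction n)
  case (Suc n)
  have "norm ((f ^^ Suc n) x) \<le> a * norm ((f ^^ n) x)" using assms(1) by simp
  also have "\<dots> \<le> a * (a ^ n * norm x)" using Suc assms(2) by (rule mult_left_mono)
  finally show ?case by (simp add: mult.assoc)
qed auto

text \<open>The scalar analogue of \<open>pow2\<close>, with \<open>s\<close> for
  \<parallel>S\<parallel> and \<open>l\<close> for \<parallel>Y\<parallel>, divided by l^2 because
  two letters Y are measured by the Hilbert-Schmidt norm instead. By \<open>rem2_closed\<close> it
  is the second-order Taylor remainder of x^q at \<open>s\<close>, over l^2.\<close>

primrec rem2 :: "real \<Rightarrow> real \<Rightarrow> nat \<Rightarrow> real" where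
  "rem2 s l 0 = 0"
| "rem2 s l (Suc q) = (s + l) * rem2 s l q + q * s ^ (q - 1)"

lemma rem2_closed: "l\<^sup>2 * rem2 s l q = (s + l) ^ q - s ^ q - q * s ^ (q - 1) * l"
proof (induction q)
  case (Suc q)
  have "l\<^sup>2 * rem2 s l (Suc q) = (s + l) * (l\<^sup>2 * rem2 s l q) + l\<^sup>2 * (q * s ^ (q - 1))"
    by (simp add: algebra_simps)
  also have "\<dots> = (s + l) * ((s + l) ^ q - s ^ q - q * s ^ (q - 1) * l) + l\<^sup>2 * (q * s ^ (q - 1))"
    by (simp add: Suc)
  also have "\<dots> = (s + l) ^ Suc q - s ^ Suc q - Suc q * s ^ (Suc q - 1) * l"
    by (cases q) (simp_all add: algebra_simps power2_eq_square)
  finally show ?case .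
qed auto

context hilbert_space
begin

lemma hsn_pow1_le:
  assumes Y: "selfadj Y" "\<And>x. proj N (Y x) = Y x"
    and S: "selfadj S" "\<And>x. norm (S x) \<le> s * norm x" "0 \<le> s"
  shows "hsn N (pow1 S Y q) \<le> q * s ^ (q - 1) * hsn N Y"
proof (induction q)
  case (Suc q)
  have "hsn N (pow1 S Y (Suc q)) \<le> hsn N (\<lambda>x. S (pow1 S Y q x)) + hsn N (\<lambda>x. Y ((S ^^ q) x))"
    using hsn_add_le[of N "\<lambda>x. S (pow1 S Y q x)"] by (simp add: hsn_def)
  also have "\<dots> \<le> s * hsn N (pow1 S Y q) + s ^ q * hsn N Y"
    by (intro add_mono hsn_comp_left_le hsn_comp_right_le Y S selfadj_funpow norm_funpow_le) (auto simp: S)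
  also have "\<dots> \<le> s * (q * s ^ (q - 1) * hsn N Y) + s ^ q * hsn N Y"
    using Suc S(3) by (intro add_right_mono mult_left_mono)
  also have "\<dots> = Suc q * s ^ (Suc q - 1) * hsn N Y"
    by (cases q) (auto simp: algebra_simps)
  finally show ?case .
qed (simp add: hsn_def L2_set_def)

text \<open>The induction strips the leftmost letter S + Y of a word; being self-adjoint, it moves
  to the other side of the inner product and is collected in the power \<open>r\<close>. The new
  words, where a second Y precedes a word with exactly one, are bounded by Cauchy-Schwarz with one Y
  in each Hilbert-Schmidt factor.\<close>

lemma abs_pow2_le:
  assumes Y: "linear Y" "selfadj Y" "\<And>x. proj N (Y x) = Y x" "\<And>x. norm (Y x) \<le> l * norm x" "0 \<le> l"
    and S: "linear S" "selfadj S" "\<And>x. norm (S x) \<le> s * norm x" "0 \<le> s"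
  shows "\<bar>\<Sum>k<N. pow2 S Y q (bseq k) \<bullet> ((\<lambda>x. S x + Y x) ^^ r) (bseq k)\<bar>
    \<le> (hsn N Y)\<^sup>2 * rem2 s l q * (s + l) ^ r"
proof (induction q arbitrary: r)
  case (Suc q)
  define W where "W = (\<lambda>x. S x + Y x)"
  have W: "selfadj W" using Y(2) S(2) by (auto simp: W_def selfadj_def ip_add_left ip_add_right)
  have nW: "norm (W x) \<le> (s + l) * norm x" for x
    unfolding W_def using norm_triangle_ineq[of "S x" "Y x"] Y(4)[of x] S(3)[of x]
    by (simp add: algebra_simps)
  have "pow2 S Y (Suc q) x \<bullet> (W ^^ r) x = pow2 S Y q x \<bullet> (W ^^ Suc r) x + pow1 S Y q x \<bullet> Y ((W ^^ r) x)" for x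
    using selfadj_inner[OF W, of "pow2 S Y q x"] selfadj_inner[OF Y(2), of "pow1 S Y q x"]
    by (simp add: inner_add_left W_def)
  then have "\<bar>\<Sum>k<N. pow2 S Y (Suc q) (bseq k) \<bullet> (W ^^ r) (bseq k)\<bar>
     \<le> \<bar>\<Sum>k<N. pow2 S Y q (bseq k) \<bullet> (W ^^ Suc r) (bseq k)\<bar> + \<bar>\<Sum>k<N. pow1 S Y q (bseq k) \<bullet> Y ((W ^^ r) (bseq k))\<bar>"
    by (simp add: sum.distrib abs_triangle_ineq)
  also have "\<dots> \<le> (hsn N Y)\<^sup>2 * rem2 s l q * (s + l) ^ Suc r + hsn N (pow1 S Y q) * hsn N (\<lambda>x. Y ((W ^^ r) x))"
    by (intro add_mono Suc[folded W_def] abs_sum_inner_le_hsn)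
  also have "\<dots> \<le> (hsn N Y)\<^sup>2 * rem2 s l q * (s + l) ^ Suc r + (q * s ^ (q - 1) * hsn N Y) * ((s + l) ^ r * hsn N Y)"
    by (intro add_left_mono mult_mono hsn_pow1_le hsn_comp_right_le Y S selfadj_funpow norm_funpow_le W nW)
      (use S(4) Y(5) in auto)
  also have "\<dots> = (hsn N Y)\<^sup>2 * rem2 s l (Suc q) * (s + l) ^ r"
    by (simp add: algebra_simps power2_eq_square)
  finally show ?case by (simp add: W_def)
qed auto

text \<open>By cyclicity all \<open>q\<close> words with one Y have the same trace. The power
  \<open>r\<close> collects the stripped letters, as in \<open>abs_pow2_le\<close>.\<close>

lemma trace_pow1:
  assumes Y: "linear Y" "selfadj Y" "\<And>x. proj N (Y x) = Y x"
    and S: "linear S" "selfadj S" "\<And>x. proj N (S x) = S x"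
  shows "(\<Sum>k<N. pow1 S Y q (bseq k) \<bullet> (S ^^ r) (bseq k)) = q * (\<Sum>k<N. Y (bseq k) \<bullet> (S ^^ (q - 1 + r)) (bseq k))"
proof (induction q arbitrary: r)
  case (Suc q)
  have "pow1 S Y (Suc q) x \<bullet> (S ^^ r) x = pow1 S Y q x \<bullet> (S ^^ Suc r) x + Y ((S ^^ q) x) \<bullet> (S ^^ r) x" for x
    using selfadj_inner[OF S(2), of "pow1 S Y q x"] by (simp add: inner_add_left)
  then have "(\<Sum>k<N. pow1 S Y (Suc q) (bseq k) \<bullet> (S ^^ r) (bseq k)) =
      q * (\<Sum>k<N. Y (bseq k) \<bullet> (S ^^ (q - 1 + Suc r)) (bseq k)) + (\<Sum>k<N. Y ((S ^^ q) (bseq k)) \<bullet> (S ^^ r) (bseq k))"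
    using Suc[of "Suc r"] by (simp only: sum.distrib)
  also have "(\<Sum>k<N. Y ((S ^^ q) (bseq k)) \<bullet> (S ^^ r) (bseq k)) = (\<Sum>k<N. Y (bseq k) \<bullet> (S ^^ q) ((S ^^ r) (bseq k)))"
  proof (rule trace_commute[OF Y(2,3) selfadj_funpow[OF S(2)] selfadj_funpow[OF S(2)]])
    fix x assume "proj N x = x" then show "proj N ((S ^^ r) x) = (S ^^ r) x"
      by (cases r) (auto simp: S(3))
  qed
  also have "\<dots> = (\<Sum>k<N. Y (bseq k) \<bullet> (S ^^ (q + r)) (bseq k))"
    by (simp add: funpow_add)
  finally show ?case by (cases q) (simp_all add: algebra_simps)
qed auto

lemma trn_funpow_add_le:
  assumes Y: "linear Y" "selfadj Y" "\<And>x. proj N (Y x) = Y x" "\<And>x. norm (Y x) \<le> l * norm x" "0 \<le> l"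
    and S: "linear S" "selfadj S" "\<And>x. proj N (S x) = S x" "\<And>x. norm (S x) \<le> s * norm x" "0 \<le> s"
  shows "trn N ((\<lambda>x. S x + Y x) ^^ q)
    \<le> trn N (S ^^ q) + q * (\<Sum>k<N. Y (bseq k) \<bullet> (S ^^ (q - 1)) (bseq k)) + (hsn N Y)\<^sup>2 * rem2 s l q"
proof -
  have "trn N ((\<lambda>x. S x + Y x) ^^ q) = trn N (S ^^ q) + (\<Sum>k<N. pow1 S Y q (bseq k) \<bullet> bseq k)
      + (\<Sum>k<N. pow2 S Y q (bseq k) \<bullet> bseq k)"
    unfolding trn_def funpow_add_expand[OF S(1) Y(1)] by (simp add: inner_add_left sum.distrib)
  moreover have "(\<Sum>k<N. pow2 S Y q (bseq k) \<bullet> bseq k) \<le> (hsn N Y)\<^sup>2 * rem2 s l q"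
    using abs_pow2_le[OF Y S(1,2,4,5), of q 0] by simp
  ultimately show ?thesis using trace_pow1[OF Y(1-3) S(1-3), of q 0] by simp
qed

text \<open>The operator norm of S^p is at most its Hilbert-Schmidt norm, whose square is tr S^(2p).
  The way back from S^p to S uses that k \<mapsto> \<parallel>S^k x\<parallel> is
  log-convex.\<close>

lemma power_norm_le_trn:
  assumes S: "selfadj S" "\<And>x. proj N (S x) = S x" and p: "p > 0"
  shows "norm (S x) ^ (2 * p) \<le> trn N (S ^^ (2 * p)) * norm x ^ (2 * p)"
proof -
  define h where "h = hsn N (S ^^ p)"
  have h2: "trn N (S ^^ (2 * p)) = h\<^sup>2"
    unfolding h_def hsn_sq trn_def
  proof (rule sum.cong)
    fix k
    have "(S ^^ (2 * p)) (bseq k) = (S ^^ p) ((S ^^ p) (bseq k))" by (simp add: mult_2 funpow_add)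
    then show "(S ^^ (2 * p)) (bseq k) \<bullet> bseq k = (norm ((S ^^ p) (bseq k)))\<^sup>2"
      using selfadj_inner[OF selfadj_funpow[OF S(1)]] by (simp add: power2_norm_eq_inner)
  qed simp
  have 1: "norm ((S ^^ p) x) \<le> h * norm x" for x
  proof -
    have "proj N ((S ^^ p) x) = (S ^^ p) x" using p S(2) by (cases p) auto
    then have "(norm ((S ^^ p) x))\<^sup>2 = (\<Sum>k<N. (cmod (ip ((S ^^ p) x) (bseq k)))\<^sup>2)"
      by (simp add: norm_proj[symmetric])
    also have "\<dots> \<le> (\<Sum>k<N. (norm x * norm ((S ^^ p) (bseq k)))\<^sup>2)"
      using selfadj_funpow[OF S(1), of p] norm_ip_le by (intro sum_mono power_mono) (auto simp: selfadj_def)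
    also have "\<dots> = (h * norm x)\<^sup>2"
      by (simp add: power_mult_distrib h_def hsn_sq sum_distrib_left mult.commute)
    finally show ?thesis by (rule power2_le_imp_le) (simp add: h_def)
  qed
  \<comment> \<open>Log-convexity says that the ratios a (k+1) / a k do not decrease, so each is at
    least a 1 / a 0. The inequalities are kept in product form because a k may be 0.\<close>
  define a where "a k = norm ((S ^^ k) x)" for k
  have a: "a k \<ge> 0" for k by (simp add: a_def)
  have lc: "(a (Suc k))\<^sup>2 \<le> a k * a (Suc (Suc k))" for k
  proof -
    have "(a (Suc k))\<^sup>2 = (S ^^ k) x \<bullet> (S ^^ Suc (Suc k)) x"
      using selfadj_inner[OF S(1)] by (simp add: a_def power2_norm_eq_inner)
    also have "\<dots> \<le> a k * a (Suc (Suc k))" unfolding a_def by (rule norm_cauchy_schwarz)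
    finally show ?thesis .
  qed
  have ratio: "a k * a 1 \<le> a (Suc k) * a 0" for k
  proof (induction k)
    case (Suc k)
    show ?case
    proof (cases "a k = 0")
      case True
      then have "a (Suc k) = 0" using lc[of k] by simp
      then show ?thesis using a by simp
    next
      case False
      have "a k * (a (Suc k) * a 1) = a (Suc k) * (a k * a 1)" by simp
      also have "\<dots> \<le> a (Suc k) * (a (Suc k) * a 0)" using Suc a by (intro mult_left_mono)
      also have "\<dots> = (a (Suc k))\<^sup>2 * a 0" by (simp add: power2_eq_square)
      also have "\<dots> \<le> (a k * a (Suc (Suc k))) * a 0" using lc a by (intro mult_right_mono)
      finally show ?thesis using False a[of k] by (simp add: mult.assoc)
    qed
  qed simp
  have "a 1 ^ Suc q \<le> a (Suc q) * a 0 ^ q" for q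
  proof (induction q)
    case (Suc q)
    have "a 1 ^ Suc (Suc q) \<le> a 1 * (a (Suc q) * a 0 ^ q)"
      using Suc a by (simp add: mult_left_mono)
    also have "\<dots> = (a (Suc q) * a 1) * a 0 ^ q" by simp
    also have "\<dots> \<le> (a (Suc (Suc q)) * a 0) * a 0 ^ q" using a by (intro mult_right_mono ratio zero_le_power)
    finally show ?case by (simp add: mult.assoc)
  qed simp
  from this[of "p - 1"] have "norm (S x) ^ p \<le> a p * norm x ^ (p - 1)"
    using p by (simp add: a_def)
  also have "\<dots> \<le> (h * norm x) * norm x ^ (p - 1)"
    unfolding a_def by (intro mult_right_mono 1) auto
  also have "\<dots> = h * norm x ^ p" using p by (cases p) auto
  finally have "(norm (S x) ^ p)\<^sup>2 \<le> (h * norm x ^ p)\<^sup>2" by (rule power_mono) auto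
  then show ?thesis unfolding h2 by (simp add: power_mult_distrib power_mult[symmetric] mult.commute)
qed

end

section \<open>The trace of the hyperbolic cosine\<close>

context hilbert_space
begin

lemma Suc_div_fact: "real (Suc q) / fact (Suc q) = 1 / fact q"
  by (simp del: of_nat_Suc)

text \<open>The term of index 0 would be the trace of the identity on the span; it is replaced by 1,
  so that the bounds do not grow with \<open>N\<close>.\<close>

abbreviation phi_term :: "nat \<Rightarrow> ('h \<Rightarrow> 'h) \<Rightarrow> nat \<Rightarrow> real" where
  "phi_term N S q \<equiv> (if q = 0 then 1 else if even q then trn N (S ^^ q) / fact q else 0)"

text \<open>\<open>phi N S\<close> is \<open>1 + tr (cosh S - 1)\<close>, with the trace over the first \<open>N\<close> basis vectors.\<close>

definition phi :: "nat \<Rightarrow> ('h \<Rightarrow> 'h) \<Rightarrow> real" where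
  "phi N S = (\<Sum>q. phi_term N S q)"

text \<open>The vector sinh S x. The summand of index q comes from the derivative of x^q / q!, which
  keeps the even indices of the cosh series and allows a comparison term by term in
  \<open>phi_add_le\<close>.\<close>

definition sinh_vec :: "('h \<Rightarrow> 'h) \<Rightarrow> 'h \<Rightarrow> 'h" where
  "sinh_vec S x = (\<Sum>q. if even q then (real q / fact q) *\<^sub>R (S ^^ (q - 1)) x else 0)"

lemma norm_bseq_le: "norm (bseq k) \<le> 1"
  using bseq_cases[of k] norm_basis by auto

lemma abs_trn_funpow_le:
  assumes "\<And>x. norm (S x) \<le> s * norm x" "0 \<le> s"
  shows "\<bar>trn N (S ^^ q)\<bar> \<le> N * s ^ q"
proof -
  have "\<bar>trn N (S ^^ q)\<bar> \<le> (\<Sum>k<N. s ^ q)"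
    unfolding trn_def
  proof (intro order_trans[OF sum_abs] sum_mono)
    fix k
    have "\<bar>(S ^^ q) (bseq k) \<bullet> bseq k\<bar> \<le> norm ((S ^^ q) (bseq k)) * norm (bseq k)"
      by (rule Cauchy_Schwarz_ineq2)
    also have "\<dots> \<le> (s ^ q * 1) * 1"
      using norm_bseq_le assms(2)
      by (intro mult_mono order_trans[OF norm_funpow_le[OF assms]] mult_left_mono) auto
    finally show "\<bar>(S ^^ q) (bseq k) \<bullet> bseq k\<bar> \<le> s ^ q" by simp
  qed
  then show ?thesis by simp
qed

lemma summable_phi:
  assumes "\<And>x. norm (S x) \<le> s * norm x" "0 \<le> s"
  shows "summable (phi_term N S)"
proof (rule summable_comparison_test')
  show "summable (\<lambda>q. (1 + N) * (s ^ q /\<^sub>R fact q))"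
    by (intro summable_mult sums_summable[OF exp_converges])
  fix q :: nat
  show "norm (phi_term N S q)
      \<le> (1 + N) * (s ^ q /\<^sub>R fact q)"
    using abs_trn_funpow_le[OF assms, of N q] assms(2)
    by (auto simp: field_simps intro: order_trans)
qed

lemma sinh_vec_sums:
  assumes "\<And>x. norm (S x) \<le> s * norm x" "0 \<le> s"
  shows "(\<lambda>q. if even q then (real q / fact q) *\<^sub>R (S ^^ (q - 1)) x else 0) sums sinh_vec S x"
  unfolding sinh_vec_def
proof (rule summable_sums, rule summable_comparison_test')
  have "(\<lambda>q. s ^ q /\<^sub>R fact q * norm x) = (\<lambda>q. real (Suc q) / fact (Suc q) * (s ^ (Suc q - 1) * norm x))"
    unfolding Suc_div_fact by (auto simp: field_simps)
  moreover have "summable (\<lambda>q. s ^ q /\<^sub>R fact q * norm x)"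
    by (intro summable_mult2 sums_summable[OF exp_converges])
  ultimately show "summable (\<lambda>q. real q / fact q * (s ^ (q - 1) * norm x))"
    by (subst summable_Suc_iff[symmetric]) simp
  fix q :: nat
  show "norm (if even q then (real q / fact q) *\<^sub>R (S ^^ (q - 1)) x else 0) \<le> real q / fact q * (s ^ (q - 1) * norm x)"
    using norm_funpow_le[OF assms, of "q - 1" x] assms(2) by (auto intro!: divide_right_mono mult_left_mono)
qed

lemma cosh_norm_le_phi:
  fixes S :: "'h operator"
  assumes S: "selfadj S" "\<And>x. proj N (S x) = S x"
  shows "cosh (norm S) \<le> phi N S"
proof -
  have nS: "norm (S x) \<le> norm S * norm x" for x by (rule norm_blinfun)
  have le: "norm S ^ (2 * p) \<le> trn N (blinfun_apply S ^^ (2 * p))" if p: "p > 0" for p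
  proof -
    define t where "t = trn N (blinfun_apply S ^^ (2 * p))"
    have *: "norm (S x) ^ (2 * p) \<le> t * norm x ^ (2 * p)" for x
      unfolding t_def by (rule power_norm_le_trn[OF S p])
    \<comment> \<open>For t < 0 the bound \<open>*\<close> forces every vector to be 0, and then the
      trace vanishes.\<close>
    have t0: "t \<ge> 0"
    proof (rule ccontr)
      assume "\<not> t \<ge> 0"
      then have "x = 0" for x :: 'h
        using order_trans[OF _ *[of x], of 0] zero_le_even_power[of "2 * p" "norm x"]
        by (auto simp: zero_le_mult_iff p dest!: antisym)
      then have "t = 0" unfolding t_def trn_def by (intro sum.neutral ballI) (metis inner_zero_right)
      with \<open>\<not> t \<ge> 0\<close> show False by simp
    qed
    have "norm S \<le> root (2 * p) t"
    proof (rule norm_blinfun_bound)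
      show "0 \<le> root (2 * p) t" using t0 by (rule real_root_ge_zero)
      fix x
      have "norm (S x) = root (2 * p) (norm (S x) ^ (2 * p))" using p by (simp add: real_root_power_cancel)
      also have "\<dots> \<le> root (2 * p) (t * norm x ^ (2 * p))" using * p by (intro real_root_le_mono) auto
      also have "\<dots> = root (2 * p) t * norm x" using p by (simp add: real_root_mult real_root_power_cancel)
      finally show "norm (S x) \<le> root (2 * p) t * norm x" .
    qed
    then have "norm S ^ (2 * p) \<le> root (2 * p) t ^ (2 * p)" by (rule power_mono) auto
    then show ?thesis using p t0 by (simp add: t_def)
  qed
  show ?thesis
    unfolding phi_def
  proof (rule sums_le[OF _ cosh_converges summable_sums[OF summable_phi[OF nS norm_ge_zero]]])
    fix q :: nat
    show "(if even q then norm S ^ q /\<^sub>R fact q else 0)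
        \<le> phi_term N (blinfun_apply S) q"
      using le[of "q div 2"] by (auto simp: divide_inverse_commute elim!: evenE)
  qed
qed

lemma even_rem2_sums:
  assumes "l \<noteq> 0"
  shows "(\<lambda>q. if even q then rem2 s l q / fact q else 0) sums ((cosh (s + l) - cosh s - l * sinh s) / l\<^sup>2)"
proof -
  \<comment> \<open>The odd series of sinh, shifted by one index so that it runs over even
    q.\<close>
  have "(\<lambda>q. if even (Suc q) then real (Suc q) * s ^ (Suc q - 1) / fact (Suc q) else 0) sums sinh s"
    
  proof -
    have "real (Suc q) * s ^ (Suc q - 1) / fact (Suc q) = s ^ q /\<^sub>R fact q" for q
      using arg_cong[OF Suc_div_fact[of q], of "\<lambda>x. x * s ^ q"] by (simp add: field_simps)
    then have "(\<lambda>q. if even (Suc q) then real (Suc q) * s ^ (Suc q - 1) / fact (Suc q) else 0)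
      = (\<lambda>q. if even q then 0 else s ^ q /\<^sub>R fact q)" by (simp only: even_Suc) auto
    then show ?thesis using sinh_converges[of s] by simp
  qed
  then have "(\<lambda>q. if even q then real q * s ^ (q - 1) / fact q else 0) sums sinh s"
    by (subst (asm) sums_Suc_iff) simp
  then have "(\<lambda>q. ((if even q then (s + l) ^ q /\<^sub>R fact q else 0) - (if even q then s ^ q /\<^sub>R fact q else 0)
      - l * (if even q then real q * s ^ (q - 1) / fact q else 0)) / l\<^sup>2) sums ((cosh (s + l) - cosh s - l * sinh s) / l\<^sup>2)"
    by (intro sums_divide sums_diff sums_mult cosh_converges)
  moreover have "rem2 s l q = ((s + l) ^ q - s ^ q - q * s ^ (q - 1) * l) / l\<^sup>2" for q
    using rem2_closed[of l s q] assms by (simp add: field_simps)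
  ultimately show ?thesis
    by (elim sums_cong[THEN iffD1, rotated]) (auto simp: field_simps)
qed

text \<open>\<open>trn_funpow_add_le\<close> divided by q! and summed over even q: the first-order
  parts add up to \<open>sinh_vec\<close> and the remainders to a Taylor remainder of cosh, which
  \<open>cosh_add_tail_le\<close> simplifies.\<close>

lemma phi_add_le:
  fixes S Y :: "'h operator"
  assumes Y: "selfadj Y" "\<And>x. proj N (Y x) = Y x" "norm Y \<le> l" "0 < l"
    and S: "selfadj S" "\<And>x. proj N (S x) = S x"
  shows "phi N (S + Y) \<le> phi N S + (\<Sum>k<N. Y (bseq k) \<bullet> sinh_vec S (bseq k))
    + (hsn N Y)\<^sup>2 * ((exp l - 1 - l) / l\<^sup>2) * cosh (norm S)"
proof -
  define s where "s = norm S"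
  have s: "norm (S x) \<le> s * norm x" "0 \<le> s" for x by (auto simp: s_def norm_blinfun)
  have l: "norm (Y x) \<le> l * norm x" for x
    using norm_blinfun[of Y x] mult_right_mono[OF Y(3), of "norm x"] by simp
  have SY: "blinfun_apply (S + Y) = (\<lambda>x. S x + Y x)" by (auto simp: plus_blinfun.rep_eq)
  have lin: "linear S" "linear Y" by (simp_all add: bounded_linear.linear blinfun.bounded_linear_right)
  let ?L = "\<Sum>k<N. Y (bseq k) \<bullet> sinh_vec S (bseq k)"
  have "phi N (S + Y) \<le> phi N S + ?L
    + (hsn N Y)\<^sup>2 * ((cosh (s + l) - cosh s - l * sinh s) / l\<^sup>2)"
  proof (rule sums_le)
    show "phi_term N (blinfun_apply (S + Y)) sums phi N (S + Y)"
      unfolding phi_def by (rule summable_sums[OF summable_phi[OF norm_blinfun norm_ge_zero]])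
    show "(\<lambda>q. phi_term N (blinfun_apply S) q
       + (\<Sum>k<N. Y (bseq k) \<bullet> (if even q then (real q / fact q) *\<^sub>R (blinfun_apply S ^^ (q - 1)) (bseq k) else 0))
       + (hsn N (blinfun_apply Y))\<^sup>2 * (if even q then rem2 s l q / fact q else 0))
      sums (phi N S + ?L
    + (hsn N Y)\<^sup>2 * ((cosh (s + l) - cosh s - l * sinh s) / l\<^sup>2))"
      unfolding phi_def
      using Y(4) by (intro sums_add sums_mult even_rem2_sums summable_sums[OF summable_phi[OF s]] sums_sum
          bounded_linear.sums[OF bounded_linear_inner_right] sinh_vec_sums[OF s]) auto
    fix q :: nat
    show "phi_term N (blinfun_apply (S + Y)) q
      \<le> phi_term N (blinfun_apply S) q
       + (\<Sum>k<N. Y (bseq k) \<bullet> (if even q then (real q / fact q) *\<^sub>R (blinfun_apply S ^^ (q - 1)) (bseq k) else 0))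
       + (hsn N (blinfun_apply Y))\<^sup>2 * (if even q then rem2 s l q / fact q else 0)"
    proof (cases "q > 0 \<and> even q")
      case True
      have "trn N (blinfun_apply (S + Y) ^^ q) / fact q \<le> (trn N (blinfun_apply S ^^ q) + real q * (\<Sum>k<N. Y (bseq k) \<bullet> (blinfun_apply S ^^ (q - 1)) (bseq k))
          + (hsn N Y)\<^sup>2 * rem2 s l q) / fact q"
        unfolding SY using trn_funpow_add_le[OF lin(2) Y(1,2) l less_imp_le[OF Y(4)] lin(1) S s]
        by (intro divide_right_mono) auto
      then show ?thesis using True
        by (simp add: add_divide_distrib sum_distrib_left sum_divide_distrib)
    qed auto
  qed
  also have "\<dots> \<le> phi N S + ?L
    + (hsn N Y)\<^sup>2 * ((exp l - 1 - l) * cosh s / l\<^sup>2)"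
    using Y(4) s(2) by (intro add_left_mono mult_left_mono divide_right_mono cosh_add_tail_le) auto
  finally show ?thesis by (simp add: s_def)
qed

end

section \<open>Measurability of random operators\<close>

text \<open>
  In the operator norm the space of operators is not separable, and sums of random variables need not
  be measurable for its Borel sets.  Hence the coarser sigma-algebra generated by the evaluations.
\<close>

definition opM :: "'h::real_normed_vector operator measure" where
  "opM = sigma UNIV {(\<lambda>A. blinfun_apply A h) -` U | h U. open U}"

lemma space_opM [simp]: "space opM = UNIV"
  by (simp add: opM_def)

lemma measurable_opMI:
  fixes X :: "'w \<Rightarrow> 'h::real_normed_vector operator"
  assumes "\<And>h. (\<lambda>\<omega>. blinfun_apply (X \<omega>) h) \<in> borel_measurable M"
  shows "X \<in> M \<rightarrow>\<^sub>M opM"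
  unfolding opM_def
proof (rule measurable_measure_of)
  fix A :: "'h operator set" assume "A \<in> {(\<lambda>A. blinfun_apply A h) -` U | h U. open U}"
  then obtain h U where A: "A = (\<lambda>A. blinfun_apply A h) -` U" "open U" by blast
  have "X -` A \<inter> space M = (\<lambda>\<omega>. X \<omega> h) -` U \<inter> space M" using A by auto
  also have "\<dots> \<in> sets M" using assms A(2) by (intro measurable_sets[OF assms]) auto
  finally show "X -` A \<inter> space M \<in> sets M" .
qed auto

lemma measurable_opM_eval: "(\<lambda>A. blinfun_apply A (h::'a::real_normed_vector)) \<in> borel_measurable opM"
proof (rule borel_measurableI)
  fix U :: "'a set" assume "open U"
  then show "(\<lambda>A. blinfun_apply A h) -` U \<inter> space opM \<in> sets opM"
    unfolding opM_def by (auto intro!: sigma_sets.Basic)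
qed

text \<open>For simple \<open>v\<close> only finitely many evaluations are involved, and continuity
  of each operator carries measurability to the limit. This is what makes products of random
  operators measurable.\<close>

lemma measurable_opM_apply:
  fixes X :: "'w \<Rightarrow> 'h::{real_normed_vector,second_countable_topology} operator"
  assumes X: "X \<in> M \<rightarrow>\<^sub>M opM" and v: "v \<in> borel_measurable M"
  shows "(\<lambda>\<omega>. X \<omega> (v \<omega>)) \<in> borel_measurable M"
proof -
  obtain F where F: "\<And>i. simple_function M (F i)" "\<And>\<omega>. \<omega> \<in> space M \<Longrightarrow> (\<lambda>i. F i \<omega>) \<longlonglongrightarrow> v \<omega>"
    using borel_measurable_implies_sequence_metric[OF v, of 0] by blast
  show ?thesis
  proof (rule borel_measurable_LIMSEQ_metric)
    fix \<omega> assume "\<omega> \<in> space M"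
    then show "(\<lambda>i. X \<omega> (F i \<omega>)) \<longlonglongrightarrow> X \<omega> (v \<omega>)"
      by (intro tendsto_intros F)
  next
    fix i
    show "(\<lambda>\<omega>. X \<omega> (F i \<omega>)) \<in> borel_measurable M"
    proof (rule measurable_compose_countable'[where f = "\<lambda>h \<omega>. X \<omega> h" and g = "F i" and I = "F i ` space M"])
      show "F i \<in> M \<rightarrow>\<^sub>M count_space (F i ` space M)"
        using F(1)[of i] by (auto simp: simple_function_def measurable_count_space_eq2)
      show "countable (F i ` space M)" using F(1)[of i] by (simp add: simple_function_def countable_finite)
    qed (use measurable_compose[OF X measurable_opM_eval] in auto)
  qed
qed

text \<open>Through this map the coarser sigma-algebra inherits measurability and independence from
  the norm topology, in which the sample is given.\<close>

lemma measurable_borel_opM: "(\<lambda>A. A) \<in> borel \<rightarrow>\<^sub>M opM"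
  by (intro measurable_opMI borel_measurable_continuous_onI continuous_intros)

text \<open>By continuity the bound \<parallel>A x\<parallel> \<le> r \<parallel>x\<parallel> has to
  be tested only on a countable dense set of vectors, which turns a norm ball into a countable
  intersection.\<close>

lemma measurable_opM_norm:
  fixes X :: "'w \<Rightarrow> 'h::{real_normed_vector,second_countable_topology} operator"
  assumes X: "X \<in> M \<rightarrow>\<^sub>M opM"
  shows "(\<lambda>\<omega>. norm (X \<omega>)) \<in> borel_measurable M"
proof -
  obtain D :: "'h set" where D: "countable D" "\<And>U. open U \<Longrightarrow> U \<noteq> {} \<Longrightarrow> \<exists>d\<in>D. d \<in> U"
    by (erule countable_dense_setE)
  have iff: "norm A \<le> r \<longleftrightarrow> 0 \<le> r \<and> (\<forall>d\<in>D. norm (A d) \<le> r * norm d)" for A :: "'h operator" and r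
  proof safe
    fix d assume "norm A \<le> r"
    then show "norm (A d) \<le> r * norm d"
      using norm_blinfun[of A d] mult_right_mono[of "norm A" r "norm d"] by simp
  next
    assume "0 \<le> r" and *: "\<forall>d\<in>D. norm (A d) \<le> r * norm d"
    have "norm (A x) \<le> r * norm x" for x
    proof (rule ccontr)
      assume "\<not> norm (A x) \<le> r * norm x"
      moreover have "open {x. r * norm x < norm (A x)}"
        by (intro open_Collect_less continuous_intros)
      ultimately show False using D(2)[of "{x. r * norm x < norm (A x)}"] *
        by (metis (mono_tags, lifting) empty_iff mem_Collect_eq not_le)
    qed
    with \<open>0 \<le> r\<close> show "norm A \<le> r" by (rule norm_blinfun_bound)
  qed (use norm_ge_zero order_trans in blast)
  have [measurable]: "(\<lambda>\<omega>. X \<omega> d) \<in> borel_measurable M" for d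
    by (rule measurable_compose[OF X measurable_opM_eval])
  show ?thesis
  proof (rule borel_measurableI_le)
    fix r
    have "{\<omega> \<in> space M. norm (X \<omega>) \<le> r} =
      (if 0 \<le> r then {\<omega> \<in> space M. \<forall>d\<in>D. norm (X \<omega> d) \<le> r * norm d} else {})"
      by (auto simp: iff)
    also have "\<dots> \<in> sets M" using D(1) by auto
    finally show "{\<omega> \<in> space M. norm (X \<omega>) \<le> r} \<in> sets M" .
  qed
qed

section \<open>Bernstein's inequality for sums of operators\<close>

text \<open>The origin of the factor 1/3 in Bernstein's inequality: it lets a geometric series of
  ratio x / 3 dominate the exponential tail.\<close>

lemma fact_ge_two_mult_three_power: "2 * 3 ^ n \<le> (fact (n + 2) :: real)"
proof (induction n)
  case (Suc n)
  have "2 * 3 ^ Suc n \<le> 3 * (fact (n + 2) :: real)" using Suc unfolding power_Suc by linarith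
  also have "\<dots> \<le> real (Suc (n + 2)) * fact (n + 2)" by (intro mult_right_mono) auto
  also have "\<dots> = fact (Suc n + 2)" by (simp only: fact_Suc add_Suc)
  finally show ?case .
qed simp

lemma exp_tail_le:
  fixes x :: real
  assumes "0 \<le> x" "x < 3"
  shows "exp x - 1 - x \<le> x\<^sup>2 / (2 * (1 - x / 3))"
proof -
  have "exp x - 1 - x = (\<Sum>n. inverse (fact (n + 2)) * x ^ (n + 2))"
    using exp_first_two_terms[of x] by (simp add: scaleR_conv_of_real)
  also have "\<dots> \<le> (\<Sum>n. x\<^sup>2 / 2 * (x / 3) ^ n)"
  proof (rule suminf_le)
    show "summable (\<lambda>n. inverse (fact (n + 2)) * x ^ (n + 2))"
      using summable_ignore_initial_segment[OF summable_exp[of x], of 2] by simp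
    show "summable (\<lambda>n. x\<^sup>2 / 2 * (x / 3) ^ n)"
      using assms by (intro summable_mult summable_geometric) auto
    fix n
    have "inverse (fact (n + 2)) * x ^ (n + 2) \<le> inverse (2 * 3 ^ n) * x ^ (n + 2)"
      using fact_ge_two_mult_three_power[of n] assms
      by (intro mult_right_mono le_imp_inverse_le) auto
    then show "inverse (fact (n + 2)) * x ^ (n + 2) \<le> x\<^sup>2 / 2 * (x / 3) ^ n"
      by (simp add: field_simps power_add power2_eq_square)
  qed
  also have "\<dots> = x\<^sup>2 / 2 * (1 / (1 - x / 3))"
    using assms by (subst suminf_mult) (auto simp: suminf_geometric summable_geometric)
  finally show ?thesis by (simp add: field_simps)
qed

text \<open>The Chernoff exponent of Bennett's bound, inverted at the Bernstein deviation.\<close>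

lemma bernstein_exponent:
  fixes T L s :: real
  assumes "0 \<le> T" "0 < L" "0 < s"
  obtains \<theta> where "0 < \<theta>" "T * ((exp (\<theta> * L) - 1 - \<theta> * L) / L\<^sup>2) - \<theta> * (sqrt (2 * T * s) + L * s / 3) \<le> - s"
proof (cases "T = 0")
  case True
  \<comment> \<open>For T = 0 only the linear part of the deviation is left, and \<theta> = 3 / L
    makes \<theta> L s / 3 equal to s.\<close>
  then show ?thesis using assms by (intro that[of "3 / L"]) auto
next
  case False
  then have T: "T > 0" using assms by simp
  \<comment> \<open>With x = \<theta> L and the bound x^2 / (2 (1 - x/3)) for the exponential tail,
    the choice x / (1 - x/3) = k gives the exponent -s exactly.\<close>
  define k where "k = sqrt (2 * s / T) * L"
  have k: "k > 0" using T assms by (simp add: k_def)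
  define x where "x = k / (1 + k / 3)"
  have x: "0 < x" "x < 3" and x1: "1 - x / 3 = 1 / (1 + k / 3)"
    using k by (auto simp: x_def field_simps)
  have k2: "T * k\<^sup>2 / L\<^sup>2 = 2 * s" using T assms by (simp add: k_def power_mult_distrib)
  have ks: "k * sqrt (2 * T * s) / L = 2 * s"
  proof -
    have "sqrt (2 * s / T) * sqrt (2 * T * s) = sqrt ((2 * s)\<^sup>2)"
      using T by (simp add: real_sqrt_mult[symmetric] power2_eq_square)
    also have "\<dots> = 2 * s" using assms(3) by (intro real_sqrt_unique) auto
    finally show ?thesis using assms by (simp add: k_def)
  qed
  show ?thesis
  proof (rule that[of "x / L"])
    have "T * ((exp x - 1 - x) / L\<^sup>2) \<le> T * ((x\<^sup>2 / (2 * (1 - x / 3))) / L\<^sup>2)"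
      using x assms by (intro mult_left_mono divide_right_mono exp_tail_le) auto
    also have "\<dots> = (T * k\<^sup>2 / L\<^sup>2) / (2 * (1 + k / 3))"
    proof -
      have "T * ((k / u)\<^sup>2 / (2 * (1 / u)) / L\<^sup>2) = (T * k\<^sup>2 / L\<^sup>2) / (2 * u)" if "u > 0" for u
        using that by (simp add: field_simps power2_eq_square)
      from this[of "1 + k / 3"] show ?thesis unfolding x1 using k by (simp only: x_def)
    qed
    also have "\<dots> = s / (1 + k / 3)" unfolding k2 using k by (simp add: field_simps)
    finally have 1: "T * ((exp x - 1 - x) / L\<^sup>2) \<le> s / (1 + k / 3)" .
    have "x / L * (sqrt (2 * T * s) + L * s / 3) = (k * sqrt (2 * T * s) / L + k * s / 3) / (1 + k / 3)"
      using assms k by (simp add: x_def field_simps)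
    also have "\<dots> = s / (1 + k / 3) + s" unfolding ks using k by (simp add: field_simps)
    finally show "T * ((exp (x / L * L) - 1 - x / L * L) / L\<^sup>2) - x / L * (sqrt (2 * T * s) + L * s / 3) \<le> - s"
      using 1 assms by simp
    show "0 < x / L" using x assms by simp
  qed
qed

lemma markov_space:
  assumes u: "u \<in> borel_measurable M"
  shows "emeasure M {x \<in> space M. 1 \<le> c * u x} \<le> c * (\<integral>\<^sup>+x. u x \<partial>M)"
proof -
  have "(\<integral>\<^sup>+x. u x * indicator (space M) x \<partial>M) = (\<integral>\<^sup>+x. u x \<partial>M)"
    by (rule nn_integral_cong) simp
  then show ?thesis using nn_integral_Markov_inequality[of u "space M" M c] u by simp
qed

lemma (in prob_space) nn_integral_indep_var:
  assumes "indep_var N1 U N2 W"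
    and f: "(\<lambda>(x, y). f x y) \<in> borel_measurable (N1 \<Otimes>\<^sub>M N2)"
  shows "(\<integral>\<^sup>+\<omega>. f (U \<omega>) (W \<omega>) \<partial>M) = (\<integral>\<^sup>+\<omega>. \<integral>\<^sup>+\<omega>'. f (U \<omega>) (W \<omega>') \<partial>M \<partial>M)"
proof -
  have rv [measurable]: "U \<in> M \<rightarrow>\<^sub>M N1" "W \<in> M \<rightarrow>\<^sub>M N2"
    and eq: "distr M N1 U \<Otimes>\<^sub>M distr M N2 W = distr M (N1 \<Otimes>\<^sub>M N2) (\<lambda>x. (U x, W x))"
    using assms(1) by (auto simp: indep_var_distribution_eq)
  note f [measurable]
  interpret D: prob_space "distr M N2 W" by (rule prob_space_distr) (rule rv)
  have "(\<integral>\<^sup>+\<omega>. f (U \<omega>) (W \<omega>) \<partial>M) = (\<integral>\<^sup>+p. (case p of (x, y) \<Rightarrow> f x y) \<partial>distr M (N1 \<Otimes>\<^sub>M N2) (\<lambda>x. (U x, W x)))"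
    by (subst nn_integral_distr) auto
  also have "\<dots> = (\<integral>\<^sup>+x. \<integral>\<^sup>+y. f x y \<partial>distr M N2 W \<partial>distr M N1 U)"
    unfolding eq[symmetric] by (subst D.nn_integral_fst[symmetric]) auto
  also have "\<dots> = (\<integral>\<^sup>+\<omega>. \<integral>\<^sup>+y. f (U \<omega>) y \<partial>distr M N2 W \<partial>M)"
    by (subst nn_integral_distr) auto
  also have "\<dots> = (\<integral>\<^sup>+\<omega>. \<integral>\<^sup>+\<omega>'. f (U \<omega>) (W \<omega>') \<partial>M \<partial>M)"
    by (intro nn_integral_cong, subst nn_integral_distr) auto
  finally show ?thesis .
qed

locale hilbert_prob_space = hilbert_space K smult ip + prob_space M
  for K :: "complex set" and smult :: "complex \<Rightarrow> 'h::{real_inner,banach,second_countable_topology} \<Rightarrow> 'h"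
    and ip :: "'h \<Rightarrow> 'h \<Rightarrow> complex" and M :: "'w measure"
begin

lemma measurable_opM_eval' [measurable]:
  "X \<in> N \<rightarrow>\<^sub>M opM \<Longrightarrow> (\<lambda>\<omega>. blinfun_apply (X \<omega>) (h::'h)) \<in> borel_measurable N"
  by (rule measurable_compose[OF _ measurable_opM_eval])

lemma measurable_opM_add [measurable]:
  fixes X Y :: "'a \<Rightarrow> 'h operator"
  assumes [measurable]: "X \<in> N \<rightarrow>\<^sub>M opM" "Y \<in> N \<rightarrow>\<^sub>M opM"
  shows "(\<lambda>\<omega>. X \<omega> + Y \<omega>) \<in> N \<rightarrow>\<^sub>M opM"
  by (rule measurable_opMI) (simp add: plus_blinfun.rep_eq)

lemma measurable_opM_sum [measurable]:
  fixes X :: "'i \<Rightarrow> 'a \<Rightarrow> 'h operator"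
  assumes "\<And>i. i \<in> I \<Longrightarrow> X i \<in> N \<rightarrow>\<^sub>M opM"
  shows "(\<lambda>\<omega>. \<Sum>i\<in>I. X i \<omega>) \<in> N \<rightarrow>\<^sub>M opM"
proof (rule measurable_opMI)
  note assms [measurable]
  fix h show "(\<lambda>\<omega>. (\<Sum>i\<in>I. X i \<omega>) h) \<in> borel_measurable N"
    unfolding blinfun.sum_left by measurable
qed

lemma measurable_phi [measurable]:
  assumes [measurable]: "X \<in> N \<rightarrow>\<^sub>M opM"
  shows "(\<lambda>\<omega>. phi m (blinfun_apply (X \<omega>))) \<in> borel_measurable N"
proof -
  have [measurable]: "(\<lambda>\<omega>. (blinfun_apply (X \<omega>) ^^ q) x) \<in> borel_measurable N" for q x
    by (induction q) (auto intro: measurable_opM_apply assms)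
  show ?thesis
    unfolding phi_def trn_def
  proof (rule borel_measurable_suminf)
    fix q :: nat
    show "(\<lambda>\<omega>. if q = 0 then 1 else if even q then (\<Sum>k<m. (blinfun_apply (X \<omega>) ^^ q) (bseq k) \<bullet> bseq k) / fact q else 0)
      \<in> borel_measurable N"
      by (cases "q = 0"; cases "even q") simp_all
  qed
qed

text \<open>
  Conditioning on \<open>S\<close>: the linear term of \<open>phi_add_le\<close> has mean 0, and \<open>cosh (norm S) \<le> phi N S\<close>.
\<close>

lemma phi_step:
  fixes S Y :: "'w \<Rightarrow> 'h operator"
  assumes ind: "indep_var opM S opM Y"
    and S: "\<And>\<omega>. \<omega> \<in> space M \<Longrightarrow> selfadj (S \<omega>)" "\<And>\<omega> x. \<omega> \<in> space M \<Longrightarrow> proj N (S \<omega> x) = S \<omega> x"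
    and Y: "\<And>\<omega>. \<omega> \<in> space M \<Longrightarrow> selfadj (Y \<omega>)" "\<And>\<omega> x. \<omega> \<in> space M \<Longrightarrow> proj N (Y \<omega> x) = Y \<omega> x"
    and l: "AE \<omega> in M. norm (Y \<omega>) \<le> l" "0 < l"
    and mean: "\<And>h g. expectation (\<lambda>\<omega>. Y \<omega> h \<bullet> g) = 0"
    and v: "(\<integral>\<^sup>+\<omega>. ennreal ((hsn N (Y \<omega>))\<^sup>2) \<partial>M) \<le> ennreal v" "0 \<le> v"
  shows "(\<integral>\<^sup>+\<omega>. ennreal (phi N (S \<omega> + Y \<omega>)) \<partial>M)
    \<le> ennreal (1 + v * ((exp l - 1 - l) / l\<^sup>2)) * (\<integral>\<^sup>+\<omega>. ennreal (phi N (S \<omega>)) \<partial>M)"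
proof -
  define g where "g = (exp l - 1 - l) / l\<^sup>2"
  have g: "g \<ge> 0" unfolding g_def by (intro divide_nonneg_nonneg exp_tail_nonneg) simp
  have [measurable]: "S \<in> M \<rightarrow>\<^sub>M opM" "Y \<in> M \<rightarrow>\<^sub>M opM"
    using ind by (auto dest: indep_var_rv1 indep_var_rv2)
  have [measurable]: "(\<lambda>\<omega>. (hsn N (Y \<omega>))\<^sup>2) \<in> borel_measurable M"
    unfolding hsn_sq by measurable
  have ihs: "integrable M (\<lambda>\<omega>. (hsn N (Y \<omega>))\<^sup>2)"
    using v(1) by (intro integrableI_nonneg) (auto simp: le_less_trans ennreal_less_top)
  then have Ehs: "expectation (\<lambda>\<omega>. (hsn N (Y \<omega>))\<^sup>2) \<le> v"
    using v by (subst (asm) nn_integral_eq_integral) auto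
  have ilin: "integrable M (\<lambda>\<omega>. Y \<omega> h \<bullet> x)" for h x
  proof (rule integrable_const_bound[where B = "l * norm h * norm x"])
    show "AE \<omega> in M. norm (Y \<omega> h \<bullet> x) \<le> l * norm h * norm x"
      using l(1)
    proof eventually_elim
      case (elim \<omega>)
      have "norm (Y \<omega> h \<bullet> x) \<le> norm (Y \<omega> h) * norm x" by (simp add: Cauchy_Schwarz_ineq2)
      also have "\<dots> \<le> (l * norm h) * norm x"
        using norm_blinfun[of "Y \<omega>" h] mult_right_mono[OF elim, of "norm h"] by (intro mult_right_mono) auto
      finally show ?case .
    qed
  qed measurable
  have inner: "(\<integral>\<^sup>+\<omega>'. ennreal (phi N (S \<omega> + Y \<omega>')) \<partial>M) \<le> ennreal (1 + v * g) * ennreal (phi N (S \<omega>))"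
    if w: "\<omega> \<in> space M" for \<omega>
  proof -
    define s where "s = S \<omega>"
    define R where "R \<omega>' = phi N s + (\<Sum>k<N. Y \<omega>' (bseq k) \<bullet> sinh_vec s (bseq k))
      + (hsn N (Y \<omega>'))\<^sup>2 * g * cosh (norm s)" for \<omega>'
    have s: "selfadj s" "proj N (s x) = s x" for x using S w by (auto simp: s_def)
    have le: "AE \<omega>' in M. phi N (s + Y \<omega>') \<le> R \<omega>'"
      using l(1)
    proof (rule AE_mp, intro AE_I2 impI)
      fix \<omega>' assume "\<omega>' \<in> space M" "norm (Y \<omega>') \<le> l"
      then show "phi N (s + Y \<omega>') \<le> R \<omega>'"
        unfolding R_def g_def by (intro phi_add_le Y l s)
    qed
    \<comment> \<open>\<open>R\<close> contains a linear term of no definite sign. It is nonnegative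
      because it dominates \<open>phi\<close>, which is at least cosh; only then is its nonnegative
      integral an expectation.\<close>
    have pos: "AE \<omega>' in M. 0 \<le> R \<omega>'"
      using le
    proof (rule AE_mp, intro AE_I2 impI)
      fix \<omega>' assume w': "\<omega>' \<in> space M" and *: "phi N (s + Y \<omega>') \<le> R \<omega>'"
      have "0 \<le> cosh (norm (s + Y \<omega>'))" by simp
      also have "\<dots> \<le> phi N (s + Y \<omega>')"
      proof (rule cosh_norm_le_phi)
        show "selfadj (s + Y \<omega>')" using s(1) Y(1)[OF w']
          by (auto simp: selfadj_def ip_add_left ip_add_right plus_blinfun.rep_eq)
        show "proj N ((s + Y \<omega>') x) = (s + Y \<omega>') x" for x using s(2) Y(2)[OF w']
          by (simp add: plus_blinfun.rep_eq linear_add[OF linear_proj])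
      qed
      finally show "0 \<le> R \<omega>'" using * by simp
    qed
    have "(\<integral>\<^sup>+\<omega>'. ennreal (phi N (s + Y \<omega>')) \<partial>M) \<le> (\<integral>\<^sup>+\<omega>'. ennreal (R \<omega>') \<partial>M)"
      using le by (intro nn_integral_mono_AE) (auto elim!: eventually_mono intro: ennreal_leI)
    also have "\<dots> = ennreal (expectation R)"
      using ihs ilin by (intro nn_integral_eq_integral pos) (simp add: R_def)
    also have "expectation R = phi N s + expectation (\<lambda>\<omega>'. (hsn N (Y \<omega>'))\<^sup>2) * g * cosh (norm s)"
      unfolding R_def using ihs ilin by (simp add: mean prob_space)
    also have "\<dots> \<le> phi N s + v * g * phi N s"
      using Ehs g cosh_norm_le_phi[of s N] s v(2)
      by (intro add_left_mono mult_mono) (auto intro: mult_right_mono)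
    also have "\<dots> = (1 + v * g) * phi N s" by (simp add: algebra_simps)
    finally show ?thesis using g v(2) by (simp add: s_def ennreal_mult' ennreal_leI)
  qed
  have "(\<integral>\<^sup>+\<omega>. ennreal (phi N (S \<omega> + Y \<omega>)) \<partial>M) = (\<integral>\<^sup>+\<omega>. \<integral>\<^sup>+\<omega>'. ennreal (phi N (S \<omega> + Y \<omega>')) \<partial>M \<partial>M)"
    by (rule nn_integral_indep_var[OF ind, where f = "\<lambda>s y. ennreal (phi N (blinfun_apply (s + y)))"]) measurable
  also have "\<dots> \<le> (\<integral>\<^sup>+\<omega>. ennreal (1 + v * g) * ennreal (phi N (S \<omega>)) \<partial>M)"
    by (intro nn_integral_mono inner)
  also have "\<dots> = ennreal (1 + v * g) * (\<integral>\<^sup>+\<omega>. ennreal (phi N (S \<omega>)) \<partial>M)"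
    by (rule nn_integral_cmult) measurable
  finally show ?thesis by (simp add: g_def)
qed

lemma indep_var_sum_opM:
  fixes Y :: "'i \<Rightarrow> 'w \<Rightarrow> 'h operator"
  assumes "finite I" "j \<notin> I" and ind: "indep_vars (\<lambda>_. opM) Y (insert j I)"
  shows "indep_var opM (\<lambda>\<omega>. \<Sum>i\<in>I. Y i \<omega>) opM (Y j)"
proof -
  have "indep_var opM ((\<lambda>f. \<Sum>i\<in>I. f i) \<circ> (\<lambda>\<omega>. restrict (\<lambda>i. Y i \<omega>) I))
      opM ((\<lambda>f. f j) \<circ> (\<lambda>\<omega>. restrict (\<lambda>i. Y i \<omega>) {j}))"
    using assms(2)
    by (intro indep_var_compose[OF indep_var_restrict[OF ind]] measurable_opM_sum measurable_component_singleton) auto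
  also have "(\<lambda>f. \<Sum>i\<in>I. f i) \<circ> (\<lambda>\<omega>. restrict (\<lambda>i. Y i \<omega>) I) = (\<lambda>\<omega>. \<Sum>i\<in>I. Y i \<omega>)"
    by (auto cong: rev_conj_cong)
  also have "(\<lambda>f. f j) \<circ> (\<lambda>\<omega>. restrict (\<lambda>i. Y i \<omega>) {j}) = Y j" by auto
  finally show ?thesis .
qed

text \<open>The functional starts at 1 for the empty sum and gains one factor per summand; 1 + x
  \<le> exp x turns the product into the exponential of a sum.\<close>

lemma phi_sum_le:
  fixes Y :: "'i \<Rightarrow> 'w \<Rightarrow> 'h operator"
  assumes "finite I" and ind: "indep_vars (\<lambda>_. opM) Y I"
    and Y: "\<And>i \<omega>. i \<in> I \<Longrightarrow> \<omega> \<in> space M \<Longrightarrow> selfadj (Y i \<omega>)"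
      "\<And>i \<omega> x. i \<in> I \<Longrightarrow> \<omega> \<in> space M \<Longrightarrow> proj N (Y i \<omega> x) = Y i \<omega> x"
    and l: "\<And>i. i \<in> I \<Longrightarrow> AE \<omega> in M. norm (Y i \<omega>) \<le> l" "0 < l"
    and mean: "\<And>i h g. i \<in> I \<Longrightarrow> expectation (\<lambda>\<omega>. Y i \<omega> h \<bullet> g) = 0"
    and v: "\<And>i. i \<in> I \<Longrightarrow> (\<integral>\<^sup>+\<omega>. ennreal ((hsn N (Y i \<omega>))\<^sup>2) \<partial>M) \<le> ennreal (v i)"
      "\<And>i. i \<in> I \<Longrightarrow> 0 \<le> v i"
  shows "(\<integral>\<^sup>+\<omega>. ennreal (phi N (\<Sum>i\<in>I. Y i \<omega>)) \<partial>M) \<le> ennreal (exp ((\<Sum>i\<in>I. v i) * ((exp l - 1 - l) / l\<^sup>2)))"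
  using assms
proof (induction I rule: finite_induct)
  case empty
  have "phi N (\<lambda>x. 0) = 1"
  proof -
    have "trn N ((\<lambda>x. 0) ^^ q) = 0" if "q > 0" for q
      using that by (cases q) (auto simp: trn_def)
    then have "phi N (\<lambda>x. 0) = (\<Sum>q. if q = 0 then 1 else 0)"
      unfolding phi_def by (intro suminf_cong) auto
    also have "\<dots> = 1" using sums_single[of 0 "\<lambda>_. 1 :: real"] by (simp add: sums_iff)
    finally show ?thesis .
  qed
  then show ?case by (simp add: zero_blinfun.rep_eq emeasure_space_1)
next
  case (insert j I)
  define g where "g = (exp l - 1 - l) / l\<^sup>2"
  have g: "g \<ge> 0" unfolding g_def by (intro divide_nonneg_nonneg exp_tail_nonneg) simp
  let ?Y = "\<lambda>\<omega>. \<Sum>i\<in>I. Y i \<omega>"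
  have sa: "selfadj (?Y \<omega>)" "proj N ((?Y \<omega>) x) = (?Y \<omega>) x" if "\<omega> \<in> space M" for \<omega> x
    using insert.prems(2,3) that
    by (auto simp: selfadj_def blinfun.sum_left ip_sum_left ip_sum_right
        linear_sum[OF linear_proj])
  have "(\<integral>\<^sup>+\<omega>. ennreal (phi N (\<Sum>i\<in>insert j I. Y i \<omega>)) \<partial>M)
    = (\<integral>\<^sup>+\<omega>. ennreal (phi N ((?Y \<omega>) + Y j \<omega>)) \<partial>M)"
    using insert.hyps by (simp add: add.commute)
  also have "\<dots> \<le> ennreal (1 + v j * g) * (\<integral>\<^sup>+\<omega>. ennreal (phi N (?Y \<omega>)) \<partial>M)"
    unfolding g_def using insert.prems
    by (intro phi_step indep_var_sum_opM insert.hyps sa) auto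
  also have "\<dots> \<le> ennreal (exp (v j * g)) * ennreal (exp ((\<Sum>i\<in>I. v i) * g))"
    unfolding g_def using insert.prems
    by (intro mult_mono insert.IH ennreal_leI exp_ge_add_one_self) (auto intro: indep_vars_subset)
  also have "\<dots> = ennreal (exp ((\<Sum>i\<in>insert j I. v i) * g))"
    using insert.hyps by (simp add: ennreal_mult'[symmetric] exp_add[symmetric] distrib_right)
  finally show ?case by (simp add: g_def)
qed

text \<open>Markov's inequality for \<open>phi\<close> of the \<theta>-multiple of the sum, with
  \<theta> from \<open>bernstein_exponent\<close>. The factor 2 stems from cosh x \<ge> exp x /
  2.\<close>

lemma operator_bernstein_proj:
  fixes Y :: "'i \<Rightarrow> 'w \<Rightarrow> 'h operator"
  assumes "finite I" and ind: "indep_vars (\<lambda>_. opM) Y I"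
    and Y: "\<And>i \<omega>. i \<in> I \<Longrightarrow> \<omega> \<in> space M \<Longrightarrow> selfadj (Y i \<omega>)"
      "\<And>i \<omega> x. i \<in> I \<Longrightarrow> \<omega> \<in> space M \<Longrightarrow> proj N (Y i \<omega> x) = Y i \<omega> x"
    and L: "\<And>i. i \<in> I \<Longrightarrow> AE \<omega> in M. norm (Y i \<omega>) \<le> L" "0 < L"
    and mean: "\<And>i h g. i \<in> I \<Longrightarrow> expectation (\<lambda>\<omega>. Y i \<omega> h \<bullet> g) = 0"
    and v: "\<And>i. i \<in> I \<Longrightarrow> (\<integral>\<^sup>+\<omega>. ennreal ((hsn N (Y i \<omega>))\<^sup>2) \<partial>M) \<le> ennreal (v i)"
      "\<And>i. i \<in> I \<Longrightarrow> 0 \<le> v i"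
    and s: "0 < s"
  shows "prob {\<omega> \<in> space M. sqrt (2 * (\<Sum>i\<in>I. v i) * s) + L * s / 3 \<le> norm (\<Sum>i\<in>I. Y i \<omega>)} \<le> 2 * exp (- s)"
proof -
  define T where "T = (\<Sum>i\<in>I. v i)"
  have T: "T \<ge> 0" by (simp add: T_def v sum_nonneg)
  define t where "t = sqrt (2 * T * s) + L * s / 3"
  have t: "t \<ge> 0" using T L(2) s by (simp add: t_def)
  obtain \<theta> where \<theta>: "0 < \<theta>" "T * ((exp (\<theta> * L) - 1 - \<theta> * L) / L\<^sup>2) - \<theta> * t \<le> - s"
    unfolding t_def using bernstein_exponent[OF T L(2) s] by blast
  define U where "U i \<omega> = \<theta> *\<^sub>R Y i \<omega>" for i \<omega>
  have rvY: "Y i \<in> M \<rightarrow>\<^sub>M opM" if "i \<in> I" for i using ind that by (auto simp: indep_vars_def)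
  have scale: "(\<lambda>A. \<theta> *\<^sub>R A) \<in> opM \<rightarrow>\<^sub>M (opM :: 'h operator measure)"
    by (rule measurable_opMI) (auto simp: scaleR_blinfun.rep_eq intro: borel_measurable_scaleR measurable_opM_eval)
  have indU: "indep_vars (\<lambda>_. opM) U I"
    unfolding U_def by (rule indep_vars_compose2[OF ind]) (rule scale)
  let ?U = "\<lambda>\<omega>. \<Sum>i\<in>I. U i \<omega>"
  have rvU: "?U \<in> M \<rightarrow>\<^sub>M opM"
    using indU by (intro measurable_opM_sum) (auto simp: indep_vars_def)
  have saU: "selfadj (U i \<omega>)" if "i \<in> I" "\<omega> \<in> space M" for i \<omega>
    using Y(1)[OF that] by (auto simp: U_def selfadj_def scaleR_blinfun.rep_eq ip_scaleR_left ip_scaleR_right)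
  have prU: "proj N (U i \<omega> x) = U i \<omega> x" if "i \<in> I" "\<omega> \<in> space M" for i \<omega> x
    using Y(2)[OF that] by (simp add: U_def scaleR_blinfun.rep_eq linear_scale[OF linear_proj])
  let ?I = "\<integral>\<^sup>+\<omega>. ennreal (phi N (?U \<omega>)) \<partial>M"
  let ?E = "{\<omega> \<in> space M. t \<le> norm (\<Sum>i\<in>I. Y i \<omega>)}"
  let ?F = "{\<omega> \<in> space M. 1 \<le> ennreal (2 * exp (- (\<theta> * t))) * ennreal (phi N (?U \<omega>))}"
  have "?I
    \<le> ennreal (exp ((\<Sum>i\<in>I. \<theta>\<^sup>2 * v i) * ((exp (\<theta> * L) - 1 - \<theta> * L) / (\<theta> * L)\<^sup>2)))"
  proof (rule phi_sum_le[OF assms(1) indU saU prU])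
    fix i assume i: "i \<in> I"
    show "AE \<omega> in M. norm (U i \<omega>) \<le> \<theta> * L"
      using L(1)[OF i] \<theta>(1) by (auto simp: U_def elim!: eventually_mono)
    show "expectation (\<lambda>\<omega>. U i \<omega> h \<bullet> g) = 0" for h g
      using mean[OF i] by (simp add: U_def scaleR_blinfun.rep_eq)
    have "(hsn N (U i \<omega>))\<^sup>2 = \<theta>\<^sup>2 * (hsn N (Y i \<omega>))\<^sup>2" for \<omega>
      by (simp add: hsn_sq U_def scaleR_blinfun.rep_eq power_mult_distrib sum_distrib_left)
    moreover have "(\<lambda>\<omega>. (hsn N (Y i \<omega>))\<^sup>2) \<in> borel_measurable M"
      unfolding hsn_sq using rvY[OF i] by measurable
    ultimately show "(\<integral>\<^sup>+\<omega>. ennreal ((hsn N (U i \<omega>))\<^sup>2) \<partial>M) \<le> ennreal (\<theta>\<^sup>2 * v i)"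
      using v(1)[OF i] by (simp add: ennreal_mult' nn_integral_cmult mult_left_mono)
    show "0 \<le> \<theta>\<^sup>2 * v i" using v(2)[OF i] by simp
  qed (use \<theta> L in auto)
  also have "(\<Sum>i\<in>I. \<theta>\<^sup>2 * v i) * ((exp (\<theta> * L) - 1 - \<theta> * L) / (\<theta> * L)\<^sup>2) = T * ((exp (\<theta> * L) - 1 - \<theta> * L) / L\<^sup>2)"
    using \<theta>(1) L(2) by (simp add: T_def sum_distrib_left[symmetric] power_mult_distrib)
  finally have E: "?I \<le> ennreal (exp (\<theta> * t - s))"
    by (rule order_trans) (use \<theta>(2) in \<open>auto intro!: ennreal_leI\<close>)
  have [measurable]: "(\<lambda>\<omega>. phi N (?U \<omega>)) \<in> borel_measurable M"
    by (rule measurable_phi[OF rvU])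
  have sub: "?E
    \<subseteq> ?F"
  proof safe
    fix \<omega> assume w: "\<omega> \<in> space M" and *: "t \<le> norm (\<Sum>i\<in>I. Y i \<omega>)"
    have "exp (\<theta> * t) / 2 \<le> cosh (\<theta> * t)" by (rule cosh_ge_half_exp)
    also have "\<dots> \<le> cosh (norm (?U \<omega>))"
      using * \<theta>(1) t by (subst cosh_real_nonneg_le_iff) (auto simp: U_def scaleR_sum_right[symmetric])
    also have "\<dots> \<le> phi N (?U \<omega>)"
    proof (rule cosh_norm_le_phi)
      show "selfadj (?U \<omega>)" using saU[OF _ w]
        by (auto simp: selfadj_def blinfun.sum_left ip_sum_left ip_sum_right)
      show "proj N ((?U \<omega>) x) = (?U \<omega>) x" for x using prU[OF _ w]
        by (simp add: blinfun.sum_left linear_sum[OF linear_proj])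
    qed
    finally have "1 \<le> 2 * exp (- (\<theta> * t)) * phi N (?U \<omega>)"
      by (simp add: exp_minus field_simps)
    then show "1 \<le> ennreal (2 * exp (- (\<theta> * t))) * ennreal (phi N (?U \<omega>))"
      by (simp add: ennreal_mult'[symmetric] ennreal_1[symmetric] del: ennreal_1)
  qed
  have "emeasure M ?E
    \<le> emeasure M ?F"
    by (intro emeasure_mono sub) measurable
  also have "\<dots> \<le> ennreal (2 * exp (- (\<theta> * t))) * ?I"
    by (rule markov_space) measurable
  also have "\<dots> \<le> ennreal (2 * exp (- (\<theta> * t))) * ennreal (exp (\<theta> * t - s))"
    by (intro mult_left_mono E) auto
  also have "\<dots> = ennreal (2 * exp (- s))"
    by (simp add: ennreal_mult'[symmetric] exp_add[symmetric])
  finally show ?thesis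
    by (simp add: T_def t_def emeasure_eq_measure)
qed

text \<open>Compressions to the span of the first \<open>N\<close> basis vectors converge strongly,
  and their norms increase. So the events for the compressions increase, and their union contains
  the event for the full sum: the strict inequality lets each outcome be caught at a finite
  \<open>N\<close>. The bound does not depend on \<open>N\<close>.\<close>

lemma operator_bernstein:
  fixes A :: "'i \<Rightarrow> 'w \<Rightarrow> 'h operator"
  assumes "finite I" and ind: "indep_vars (\<lambda>_. opM) A I"
    and A: "\<And>i \<omega>. i \<in> I \<Longrightarrow> \<omega> \<in> space M \<Longrightarrow> selfadj (A i \<omega>)"
    and L: "\<And>i. i \<in> I \<Longrightarrow> AE \<omega> in M. norm (A i \<omega>) \<le> L" "0 < L"
    and mean: "\<And>i h g. i \<in> I \<Longrightarrow> expectation (\<lambda>\<omega>. A i \<omega> h \<bullet> g) = 0"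
    and v: "\<And>i. i \<in> I \<Longrightarrow> (\<integral>\<^sup>+\<omega>. (\<Sum>k. ennreal ((norm (A i \<omega> (bseq k)))\<^sup>2)) \<partial>M) \<le> ennreal (v i)"
      "\<And>i. i \<in> I \<Longrightarrow> 0 \<le> v i"
    and s: "0 < s"
  shows "prob {\<omega> \<in> space M. sqrt (2 * (\<Sum>i\<in>I. v i) * s) + L * s / 3 < norm (\<Sum>i\<in>I. A i \<omega>)} \<le> 2 * exp (- s)"
proof -
  define t where "t = sqrt (2 * (\<Sum>i\<in>I. v i) * s) + L * s / 3"
  define P where "P N = Blinfun (proj N)" for N
  have P: "blinfun_apply (P N) = proj N" for N
    unfolding P_def by (rule bounded_linear_Blinfun_apply[OF bounded_linear_proj])
  have nP: "norm (P N) \<le> 1" for N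
    by (rule norm_blinfun_bound) (auto simp: P norm_proj_le)
  define C where "C N B = P N o\<^sub>L B o\<^sub>L P N" for N and B :: "'h operator"
  have C: "blinfun_apply (C N B) = (\<lambda>x. proj N (B (proj N x)))" for N B
    by (auto simp: C_def P)
  let ?A = "\<lambda>\<omega>. \<Sum>i\<in>I. A i \<omega>"
  have C_sum: "C N (?A \<omega>) = (\<Sum>i\<in>I. C N (A i \<omega>))" for N \<omega>
    by (rule blinfun_eqI) (simp add: C blinfun.sum_left linear_sum[OF linear_proj])
  have nC: "norm (C N B) \<le> norm B" for N B
  proof (rule norm_blinfun_bound)
    fix x
    have "norm (C N B x) \<le> norm (B (proj N x))" by (simp add: C norm_proj_le)
    also have "\<dots> \<le> norm B * norm x"
      using mult_left_mono[OF norm_proj_le, of "norm B" N x] norm_blinfun[of B "proj N x"] by simp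
    finally show "norm (C N B x) \<le> norm B * norm x" .
  qed simp
  \<comment> \<open>Compressing in two stages shows that the norms of the compressions are monotone
    in \<open>N\<close>.\<close>
  have CC: "C N (C N' B) = C N B" if "N \<le> N'" for N N' B
  proof (rule blinfun_eqI)
    fix x
    have "proj N (proj N' y) = proj N y" for y
    proof -
      have "ip (proj N (proj N' y) - proj N y) z = 0" for z
        using that by (simp add: ip_diff_left proj_selfadjoint proj_proj_le)
      then have "ip (proj N (proj N' y) - proj N y) (proj N (proj N' y) - proj N y) = 0" by blast
      then show ?thesis by (simp add: ip_self)
    qed
    then show "C N (C N' B) x = C N B x" using that by (simp add: C proj_proj_le)
  qed
  have rvA: "A i \<in> M \<rightarrow>\<^sub>M opM" if "i \<in> I" for i using ind that by (auto simp: indep_vars_def)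
  have mproj: "proj N \<in> borel_measurable borel" for N
    by (intro borel_measurable_continuous_onI linear_continuous_on bounded_linear_proj)
  have mC: "C N \<in> opM \<rightarrow>\<^sub>M opM" for N
    unfolding C by (intro measurable_opMI) (auto simp: C intro: measurable_compose[OF measurable_opM_eval mproj])
  have rvS: "?A \<in> M \<rightarrow>\<^sub>M opM"
    using rvA by (intro measurable_opM_sum) auto
  let ?E = "\<lambda>N. {\<omega> \<in> space M. t < norm (C N (?A \<omega>))}"
  have bound: "prob (?E N) \<le> 2 * exp (- s)" for N
  proof -
    have "prob {\<omega> \<in> space M. t \<le> norm (\<Sum>i\<in>I. C N (A i \<omega>))} \<le> 2 * exp (- s)"
      unfolding t_def
    proof (rule operator_bernstein_proj[where N = N])
      show "indep_vars (\<lambda>_. opM) (\<lambda>i \<omega>. C N (A i \<omega>)) I"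
        by (rule indep_vars_compose2[OF ind mC])
      fix i assume i: "i \<in> I"
      show "selfadj (C N (A i \<omega>))" if "\<omega> \<in> space M" for \<omega>
        using A[OF i that] by (auto simp: C selfadj_def proj_selfadjoint)
      show "proj N (C N (A i \<omega>) x) = C N (A i \<omega>) x" for \<omega> x by (simp add: C proj_proj)
      show "AE \<omega> in M. norm (C N (A i \<omega>)) \<le> L"
        using L(1)[OF i] by eventually_elim (use nC order_trans in blast)
      have "C N (A i \<omega>) h \<bullet> g = A i \<omega> (proj N h) \<bullet> proj N g" for \<omega> h g
        by (metis C Re_ip proj_selfadjoint)
      then show "expectation (\<lambda>\<omega>. C N (A i \<omega>) h \<bullet> g) = 0" for h g using mean[OF i] by simp
      have "(hsn N (C N (A i \<omega>)))\<^sup>2 \<le> (\<Sum>k<N. (norm (A i \<omega> (bseq k)))\<^sup>2)" for \<omega>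
        unfolding hsn_sq by (intro sum_mono power_mono) (auto simp: C proj_bseq norm_proj_le)
      then have "ennreal ((hsn N (C N (A i \<omega>)))\<^sup>2) \<le> (\<Sum>k. ennreal ((norm (A i \<omega> (bseq k)))\<^sup>2))" for \<omega>
        by (rule order_trans[OF ennreal_leI], subst sum_ennreal[symmetric]) (simp, intro sum_le_suminf summableI, simp_all)
      then show "(\<integral>\<^sup>+\<omega>. ennreal ((hsn N (C N (A i \<omega>)))\<^sup>2) \<partial>M) \<le> ennreal (v i)"
        by (intro order_trans[OF nn_integral_mono v(1)[OF i]])
    qed (use assms(1) L(2) v(2) s in simp_all)
    moreover have "prob (?E N)
      \<le> prob {\<omega> \<in> space M. t \<le> norm (\<Sum>i\<in>I. C N (A i \<omega>))}"
    proof (rule finite_measure_mono)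
      have "(\<lambda>\<omega>. norm (C N (?A \<omega>))) \<in> borel_measurable M"
        by (intro measurable_opM_norm measurable_compose[OF rvS mC])
      then show "{\<omega> \<in> space M. t \<le> norm (\<Sum>i\<in>I. C N (A i \<omega>))} \<in> sets M"
        unfolding C_sum[symmetric] by measurable
    qed (auto simp: C_sum)
    ultimately show ?thesis by linarith
  qed
  have incr: "incseq ?E"
  proof (rule incseq_SucI, safe)
    fix N \<omega> assume "t < norm (C N (?A \<omega>))"
    also have "\<dots> = norm (C N (C (Suc N) (?A \<omega>)))" by (simp add: CC)
    also have "\<dots> \<le> norm (C (Suc N) (?A \<omega>))" by (rule nC)
    finally show "t < norm (C (Suc N) (?A \<omega>))" .
  qed
  have union: "{\<omega> \<in> space M. t < norm (?A \<omega>)} \<subseteq> (\<Union>N. ?E N)"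
  proof safe
    fix \<omega> assume w: "\<omega> \<in> space M" and *: "t < norm (?A \<omega>)"
    define B where "B = (?A \<omega>)"
    have t: "t \<ge> 0" using L(2) s v(2) by (auto simp: t_def sum_nonneg)
    have "\<exists>N. t < norm (C N B)"
    proof (rule ccontr)
      assume "\<not> ?thesis"
      then have le: "norm (C N B) \<le> t" for N by (simp add: not_less)
      have "norm B \<le> t"
      proof (rule norm_blinfun_bound[OF t])
        fix x
        have "(\<lambda>N. norm (proj N (B (proj N x)))) \<longlonglongrightarrow> norm (B x)"
        proof (intro tendsto_norm)
          have "(\<lambda>N. proj N (B (proj N x)) - proj N (B x)) \<longlonglongrightarrow> 0"
          proof (rule Lim_null_comparison)
            show "\<forall>\<^sub>F N in sequentially. norm (proj N (B (proj N x)) - proj N (B x)) \<le> norm (B (proj N x) - B x)"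
              using norm_proj_le by (simp add: linear_diff[OF linear_proj, symmetric])
            have "(\<lambda>N. norm (B (proj N x) - B x)) \<longlonglongrightarrow> norm (B x - B x)"
              by (intro tendsto_intros proj_tendsto)
            then show "(\<lambda>N. norm (B (proj N x) - B x)) \<longlonglongrightarrow> 0" by simp
          qed
          from tendsto_add[OF this proj_tendsto[of "B x"]]
          show "(\<lambda>N. proj N (B (proj N x))) \<longlonglongrightarrow> B x" by simp
        qed
        moreover have "norm (proj N (B (proj N x))) \<le> t * norm x" for N
          using norm_blinfun[of "C N B" x] mult_right_mono[OF le[of N], of "norm x"] by (simp add: C)
        ultimately show "norm (B x) \<le> t * norm x" by (intro LIMSEQ_le_const2) auto
      qed
      with * show False by (simp add: B_def)
    qed
    then show "\<omega> \<in> (\<Union>N. ?E N)" using w by (auto simp: B_def)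
  qed
  have meas: "?E N \<in> sets M" for N
  proof -
    have "(\<lambda>\<omega>. norm (C N (?A \<omega>))) \<in> borel_measurable M"
      by (intro measurable_opM_norm measurable_compose[OF rvS mC])
    then show ?thesis by measurable
  qed
  have "prob {\<omega> \<in> space M. t < norm (?A \<omega>)} \<le> prob (\<Union>N. ?E N)"
    using meas by (intro finite_measure_mono union) auto
  also have "\<dots> \<le> 2 * exp (- s)"
    using finite_Lim_measure_incseq[of ?E] meas incr bound
    by (intro LIMSEQ_le_const2[where X = "\<lambda>N. prob (?E N)"]) auto
  finally show ?thesis by (simp add: t_def)
qed

end

section \<open>The empirical Bernstein inequality\<close>

text \<open>In the exponential series y^k \<le> y^2 for all k \<ge> 2, so beyond the mean only the
  second moment enters the moment generating function.\<close>

lemma exp_mult_le: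
  fixes x y :: real
  assumes "0 \<le> x" "\<bar>y\<bar> \<le> 1"
  shows "exp (x * y) \<le> 1 + x * y + (exp x - 1 - x) * y\<^sup>2"
proof -
  have "(\<Sum>n. inverse (fact (n + 2)) * (x * y) ^ (n + 2)) \<le> (\<Sum>n. inverse (fact (n + 2)) * x ^ (n + 2) * y\<^sup>2)"
  proof (rule suminf_le)
    show "summable (\<lambda>n. inverse (fact (n + 2)) * (x * y) ^ (n + 2))"
      using summable_ignore_initial_segment[OF summable_exp[of "x * y"], of 2] by simp
    show "summable (\<lambda>n. inverse (fact (n + 2)) * x ^ (n + 2) * y\<^sup>2)"
      using summable_ignore_initial_segment[OF summable_exp[of x], of 2] by (intro summable_mult2) simp
    fix n
    have "y ^ (n + 2) \<le> \<bar>y\<bar> ^ (n + 2)" using abs_ge_self[of "y ^ (n + 2)"] by (simp only: power_abs)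
    also have "\<dots> \<le> \<bar>y\<bar> ^ 2" using assms(2) by (intro power_decreasing) auto
    finally have "y ^ (n + 2) \<le> y\<^sup>2" by simp
    then show "inverse (fact (n + 2)) * (x * y) ^ (n + 2) \<le> inverse (fact (n + 2)) * x ^ (n + 2) * y\<^sup>2"
      using assms(1) by (auto simp only: power_mult_distrib mult.assoc intro!: mult_left_mono) auto
  qed
  also have "\<dots> = (exp x - 1 - x) * y\<^sup>2"
    using summable_ignore_initial_segment[OF summable_exp[of x], of 2] exp_first_two_terms[of x]
    by (subst suminf_mult2[symmetric]) (auto simp: scaleR_conv_of_real)
  finally show ?thesis using exp_first_two_terms[of "x * y"] by (simp add: scaleR_conv_of_real)
qed

text \<open>Exact to second order, which gives lower tails of nonnegative variables their Gaussian
  form. It holds because the product of 1 - x + x^2/2 and 1 + x + x^2/2 is 1 + x^4/4.\<close>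

lemma exp_minus_le:
  fixes x :: real
  assumes "0 \<le> x"
  shows "exp (- x) \<le> 1 - x + x\<^sup>2 / 2"
proof -
  have "1 + x + x\<^sup>2 / 2 \<le> exp x" using exp_lower_Taylor_quadratic[OF assms] by simp
  then have "exp (- x) \<le> 1 / (1 + x + x\<^sup>2 / 2)"
    using assms by (simp add: exp_minus field_simps add_pos_nonneg)
  also have "\<dots> \<le> 1 - x + x\<^sup>2 / 2"
  proof -
    have "(1 - x + x\<^sup>2 / 2) * (1 + x + x\<^sup>2 / 2) = 1 + x ^ 4 / 4"
      by (simp add: algebra_simps power2_eq_square power4_eq_xxxx)
    then have "1 \<le> (1 - x + x\<^sup>2 / 2) * (1 + x + x\<^sup>2 / 2)" by simp
    then show ?thesis using assms by (subst pos_divide_le_eq) (auto simp: add_pos_nonneg)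
  qed
  finally show ?thesis .
qed

lemma sum_pairs_sq_diff:
  fixes z :: "nat \<Rightarrow> real"
  shows "(\<Sum>j=1..m. \<Sum>i\<in>{1..<j}. (z i - z j)\<^sup>2) = m * (\<Sum>i=1..m. (z i)\<^sup>2) - (\<Sum>i=1..m. z i)\<^sup>2"
proof (induction m)
  case (Suc m)
  have "(\<Sum>i\<in>{1..<Suc m}. (z i - z (Suc m))\<^sup>2)
      = (\<Sum>i=1..m. (z i)\<^sup>2) - 2 * z (Suc m) * (\<Sum>i=1..m. z i) + m * (z (Suc m))\<^sup>2"
    unfolding atLeastLessThanSuc_atLeastAtMost
    by (simp add: power2_diff sum.distrib sum_subtractf sum_distrib_left mult.assoc mult.left_commute mult.commute)
  with Suc show ?case by (simp add: power2_eq_square algebra_simps)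
qed simp

lemma sample_var_shift: "sample_var m (\<lambda>i. a - z i) = sample_var m z"
  by (simp add: sample_var_def power2_commute)

lemma sample_sd_scale: "0 \<le> c \<Longrightarrow> sample_sd m (\<lambda>i. c * z i) = c * sample_sd m z"
proof -
  assume c: "0 \<le> c"
  have "sample_var m (\<lambda>i. c * z i) = c\<^sup>2 * sample_var m z"
    unfolding sample_var_def sum_distrib_left
    by (intro sum.cong refl) (simp add: right_diff_distrib[symmetric] power_mult_distrib)
  then show ?thesis using c by (simp add: sample_sd_def real_sqrt_mult)
qed

text \<open>The sum over pairs is Lagrange's form of the variance. The unbiased normalisation
  exceeds the biased one by the factor m / (m - 1), and neither depends on the center
  \<open>a\<close>.\<close>

lemma sample_var_ge:
  fixes z :: "nat \<Rightarrow> real"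
  assumes "m \<ge> 2"
  shows "(\<Sum>i=1..m. (a - z i)\<^sup>2) / m - ((\<Sum>i=1..m. a - z i) / m)\<^sup>2 \<le> sample_var m z"
    "0 \<le> (\<Sum>i=1..m. (a - z i)\<^sup>2) / m - ((\<Sum>i=1..m. a - z i) / m)\<^sup>2"
proof -
  define Q where "Q = (\<Sum>j=1..m. \<Sum>i\<in>{1..<j}. ((a - z i) - (a - z j))\<^sup>2)"
  let ?V = "(\<Sum>i=1..m. (a - z i)\<^sup>2) / m - ((\<Sum>i=1..m. a - z i) / m)\<^sup>2"
  have Q: "Q \<ge> 0" unfolding Q_def by (intro sum_nonneg) auto
  have "Q = m * (\<Sum>i=1..m. (a - z i)\<^sup>2) - (\<Sum>i=1..m. a - z i)\<^sup>2"
    unfolding Q_def by (rule sum_pairs_sq_diff)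
  then have eq: "?V = Q / (real m * real m)"
    using assms by (simp add: field_simps power2_eq_square)
  have "Q / (real m * real m) \<le> Q / (real m * (real m - 1))"
    using assms Q by (intro divide_left_mono) auto
  also have "\<dots> = sample_var m z"
    unfolding Q_def using sample_var_shift[of m a z] by (simp add: sample_var_def)
  finally show "?V \<le> sample_var m z" unfolding eq .
  show "0 \<le> ?V" unfolding eq using Q by simp
qed

text \<open>
  Here \<open>D\<close> is the deviation of the mean, \<open>U\<close> the empirical second moment about the true mean and
  \<open>V = U - D\<^sup>2\<close> the empirical variance.  Centering at \<open>d\<close> instead of 0 makes \<open>(D - d)\<^sup>2\<close>, which is
  what has to be subtracted to get \<open>V\<close>, negligible.
\<close>

lemma deviation_from_empirical_variance:
  fixes D U V \<sigma> r d :: real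
  assumes r: "r > 0" and \<sigma>: "0 \<le> \<sigma>" "\<sigma> \<le> 1" and d: "d = 7/6 * r\<^sup>2"
    and A: "D < \<sigma> * r + r\<^sup>2 / 6"
    and B: "d \<le> D \<Longrightarrow> \<sigma> > 0 \<Longrightarrow> \<sigma>\<^sup>2 + d\<^sup>2 - sqrt (\<sigma>\<^sup>2 + d\<^sup>2) * r < U - 2 * d * D + d\<^sup>2"
    and V: "U - D\<^sup>2 \<le> V" "0 \<le> V"
  shows "D < r * sqrt V + d"
proof (rule ccontr)
  assume "\<not> D < r * sqrt V + d"
  then have D: "r * sqrt V + d \<le> D" by simp
  moreover have "0 \<le> r * sqrt V" using r V by simp
  ultimately have dD: "d \<le> D" by linarith
  \<comment> \<open>From d \<le> D and \<open>A\<close>, as 7/6 - 1/6 = 1.\<close>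
  have "r * r < r * \<sigma>"
    using A dD d by (simp add: power2_eq_square algebra_simps)
  then have \<sigma>r: "r < \<sigma>" using r by simp
  define sa where "sa = sqrt (\<sigma>\<^sup>2 + d\<^sup>2)"
  have sa: "\<sigma> \<le> sa" "sa\<^sup>2 = \<sigma>\<^sup>2 + d\<^sup>2"
    using \<sigma> by (auto simp: sa_def intro: real_le_rsqrt)
  \<comment> \<open>x (x - r) increases for x \<ge> r, so the root of the second moment about the
    shifted center may be replaced by \<sigma>.\<close>
  have "\<sigma> * (\<sigma> - r) \<le> sa * (sa - r)"
    using sa \<sigma> \<sigma>r by (intro mult_mono) auto
  also have "\<dots> < U - 2 * d * D + d\<^sup>2"
    using B[OF dD] \<sigma>r r sa(2) by (simp add: sa_def algebra_simps power2_eq_square)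
  finally have 1: "\<sigma> * (\<sigma> - r) < V + (D - d)\<^sup>2"
    using V(1) by (simp add: power2_eq_square algebra_simps)
  \<comment> \<open>Both r and \<sigma> - r are at most 1, so the square costs at most r (\<sigma> -
    r); what remains of \<sigma> (\<sigma> - r) is exactly (\<sigma> - r)^2.\<close>
  have "(D - d)\<^sup>2 \<le> (r * (\<sigma> - r))\<^sup>2"
    using dD A d by (intro power_mono) (auto simp: power2_eq_square algebra_simps)
  also have "\<dots> = (r * (\<sigma> - r)) * (r * (\<sigma> - r))" by (simp add: power2_eq_square)
  also have "\<dots> \<le> (r * (\<sigma> - r)) * 1"
    using r \<sigma>r \<sigma> by (intro mult_left_mono mult_le_one) auto
  finally have "(\<sigma> - r)\<^sup>2 < V" using 1 by (simp add: power2_eq_square algebra_simps)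
  then have "\<sigma> - r < sqrt V" by (rule real_less_rsqrt)
  then have "r * (\<sigma> - r) < r * sqrt V" using r by simp
  then show False using D A d by (simp add: power2_eq_square algebra_simps)
qed

context prob_space
begin

lemma chernoff_sum:
  fixes Z :: "'i \<Rightarrow> 'a \<Rightarrow> real"
  assumes "finite I" and ind: "indep_vars (\<lambda>_. borel) Z I"
    and \<kappa>: "\<And>i. i \<in> I \<Longrightarrow> (\<integral>\<^sup>+\<omega>. ennreal (exp (Z i \<omega>)) \<partial>M) \<le> ennreal (exp (\<kappa> i))"
  shows "prob {\<omega> \<in> space M. c \<le> (\<Sum>i\<in>I. Z i \<omega>)} \<le> exp ((\<Sum>i\<in>I. \<kappa> i) - c)"
proof -
  have [measurable]: "i \<in> I \<Longrightarrow> Z i \<in> borel_measurable M" for i using ind by (auto simp: indep_vars_def)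
  have "indep_vars (\<lambda>_. borel) (\<lambda>i \<omega>. ennreal (exp (Z i \<omega>))) I"
    by (rule indep_vars_compose2[OF ind]) auto
  then have "(\<integral>\<^sup>+\<omega>. (\<Prod>i\<in>I. ennreal (exp (Z i \<omega>))) \<partial>M) = (\<Prod>i\<in>I. \<integral>\<^sup>+\<omega>. ennreal (exp (Z i \<omega>)) \<partial>M)"
    using assms(1) by (intro indep_vars_nn_integral) auto
  also have "\<dots> \<le> (\<Prod>i\<in>I. ennreal (exp (\<kappa> i)))"
    by (intro prod_mono_ennreal \<kappa>)
  finally have E: "(\<integral>\<^sup>+\<omega>. ennreal (exp (\<Sum>i\<in>I. Z i \<omega>)) \<partial>M) \<le> ennreal (exp (\<Sum>i\<in>I. \<kappa> i))"
    using assms(1) by (simp add: prod_ennreal exp_sum)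
  have "emeasure M {\<omega> \<in> space M. c \<le> (\<Sum>i\<in>I. Z i \<omega>)}
    \<le> emeasure M {\<omega> \<in> space M. 1 \<le> ennreal (exp (- c)) * ennreal (exp (\<Sum>i\<in>I. Z i \<omega>))}"
    by (intro emeasure_mono) (auto simp: ennreal_mult'[symmetric] exp_add[symmetric] ennreal_1[symmetric] simp del: ennreal_1)
  also have "\<dots> \<le> ennreal (exp (- c)) * (\<integral>\<^sup>+\<omega>. ennreal (exp (\<Sum>i\<in>I. Z i \<omega>)) \<partial>M)"
    by (rule markov_space) measurable
  also have "\<dots> \<le> ennreal (exp (- c)) * ennreal (exp (\<Sum>i\<in>I. \<kappa> i))"
    by (intro mult_left_mono E) auto
  also have "\<dots> = ennreal (exp ((\<Sum>i\<in>I. \<kappa> i) - c))"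
    by (simp add: ennreal_mult'[symmetric] exp_add[symmetric])
  finally show ?thesis by (simp add: emeasure_eq_measure)
qed

lemma nn_integral_exp_le:
  fixes f g :: "'a \<Rightarrow> real"
  assumes f [measurable]: "f \<in> borel_measurable M" and g: "integrable M g"
    and le: "AE \<omega> in M. exp (f \<omega>) \<le> 1 + g \<omega>" and k: "expectation g \<le> k"
  shows "(\<integral>\<^sup>+\<omega>. ennreal (exp (f \<omega>)) \<partial>M) \<le> ennreal (exp k)"
proof -
  have "(\<integral>\<^sup>+\<omega>. ennreal (exp (f \<omega>)) \<partial>M) \<le> (\<integral>\<^sup>+\<omega>. ennreal (1 + g \<omega>) \<partial>M)"
    using le by (intro nn_integral_mono_AE) (auto elim!: eventually_mono intro: ennreal_leI)
  also have "\<dots> = ennreal (expectation (\<lambda>\<omega>. 1 + g \<omega>))"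
  proof (rule nn_integral_eq_integral)
    show "AE \<omega> in M. 0 \<le> 1 + g \<omega>" using le by eventually_elim (use exp_ge_zero order_trans in blast)
  qed (use g in auto)
  also have "\<dots> \<le> ennreal (exp k)"
    using g k order_trans[OF _ exp_ge_add_one_self[of k], of "1 + expectation g"]
    by (intro ennreal_leI) (simp add: prob_space)
  finally show ?thesis .
qed

text \<open>All variables are centered at the average \<mu> of their means, because the sample
  variance refers to one common center. The first-order terms do not vanish one by one, but their
  sum does. With r = sqrt (2 s / m), the constant 7/3 arises from 7/6 r^2 = 7 s / (3 m), where 1/6
  comes from Bernstein's inequality and 1 from the loss of r in the estimate of \<sigma>.\<close>

lemma empirical_bernstein_unit:
  fixes Z :: "nat \<Rightarrow> 'a \<Rightarrow> real"
  assumes m: "m \<ge> 2" and s: "s > 0" and ind: "indep_vars (\<lambda>_. borel) Z {1..m}"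
    and Z: "\<And>i. i \<in> {1..m} \<Longrightarrow> AE \<omega> in M. 0 \<le> Z i \<omega> \<and> Z i \<omega> \<le> 1"
  shows "prob {\<omega> \<in> space M. sample_sd m (\<lambda>i. Z i \<omega>) * sqrt (2 * s / m) + 7 * s / (3 * (real m - 1))
      \<le> (\<Sum>i=1..m. expectation (Z i)) / m - (\<Sum>i=1..m. Z i \<omega>) / m} \<le> 2 * exp (- s)"
proof -
  have rv [measurable]: "i \<in> {1..m} \<Longrightarrow> Z i \<in> borel_measurable M" for i using ind by (auto simp: indep_vars_def)
  have int: "integrable M (\<lambda>\<omega>. f (Z i \<omega>))" if "i \<in> {1..m}" "continuous_on UNIV f" for i and f :: "real \<Rightarrow> real"
  proof -
    have "bounded (f ` {0..1})"
      by (intro compact_imp_bounded compact_continuous_image continuous_on_subset[OF that(2)]) auto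
    then obtain C where "\<forall>x\<in>{0..1}. norm (f x) \<le> C" unfolding bounded_iff by auto
    then have "AE \<omega> in M. norm (f (Z i \<omega>)) \<le> C"
      by (intro eventually_mono[OF Z[OF that(1)]]) auto
    then show ?thesis using rv[OF that(1)] borel_measurable_continuous_onI[OF that(2)]
      by (intro integrable_const_bound[where B = C]) auto
  qed
  have intZ: "integrable M (Z i)" if "i \<in> {1..m}" for i using int[OF that, of "\<lambda>x. x"] by simp
  define \<mu> where "\<mu> = (\<Sum>i=1..m. expectation (Z i)) / m"
  have EZ: "0 \<le> expectation (Z i)" "expectation (Z i) \<le> 1" if "i \<in> {1..m}" for i
    using Z[OF that] intZ[OF that] integral_mono_AE[OF intZ[OF that], of "\<lambda>_. 1"]
    by (auto intro!: integral_nonneg_AE simp: prob_space elim: eventually_mono)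
  have \<mu>: "0 \<le> \<mu>" "\<mu> \<le> 1"
    using sum_nonneg[of "{1..m}" "\<lambda>i. expectation (Z i)"] sum_bounded_above[of "{1..m}" "\<lambda>i. expectation (Z i)" 1] EZ m
    by (auto simp: \<mu>_def divide_le_eq)
  define v where "v i = expectation (\<lambda>\<omega>. (\<mu> - Z i \<omega>)\<^sup>2)" for i
  define T where "T = (\<Sum>i=1..m. v i)"
  have v0: "0 \<le> v i" for i by (simp add: v_def)
  have v1: "v i \<le> 1" if "i \<in> {1..m}" for i
  proof -
    have "v i \<le> expectation (\<lambda>\<omega>. 1)"
      unfolding v_def
    proof (rule integral_mono_AE)
      show "AE \<omega> in M. (\<mu> - Z i \<omega>)\<^sup>2 \<le> 1"
        using Z[OF that] by eventually_elim (use \<mu> in \<open>auto simp: abs_square_le_1\<close>)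
    qed (auto intro!: int[OF that, of "\<lambda>x. (\<mu> - x)\<^sup>2"] continuous_intros)
    then show ?thesis by (simp add: prob_space)
  qed
  have T: "0 \<le> T" "T \<le> m" unfolding T_def using sum_bounded_above[of "{1..m}" v 1] v0 v1 by (auto simp: sum_nonneg)
  have sum0: "(\<Sum>i=1..m. \<mu> - expectation (Z i)) = 0"
    using m by (simp add: \<mu>_def sum_subtractf)
  have Ey: "expectation (\<lambda>\<omega>. \<mu> - Z i \<omega>) = \<mu> - expectation (Z i)" if "i \<in> {1..m}" for i
    using intZ[OF that] by (simp add: prob_space)
  define \<sigma> where "\<sigma> = sqrt (T / m)"
  define r where "r = sqrt (2 * s / m)"
  define d where "d = 7/6 * r\<^sup>2"
  have r: "r > 0" and r2: "m * r\<^sup>2 = 2 * s" using m s by (auto simp: r_def)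
  have \<sigma>: "0 \<le> \<sigma>" "\<sigma> \<le> 1" and \<sigma>2: "m * \<sigma>\<^sup>2 = T" using T m by (auto simp: \<sigma>_def)
  define EvA where "EvA = {\<omega> \<in> space M. \<sigma> * r + r\<^sup>2 / 6 \<le> (\<Sum>i=1..m. \<mu> - Z i \<omega>) / m}"
  \<comment> \<open>For d > \<mu> there is nothing to estimate, since almost surely the deviation of
    the mean does not exceed \<mu>. For d \<le> \<mu> the center \<mu> - d lies in [0,1], and almost
    surely all squares are at most 1.\<close>
  define EvB where "EvB = {\<omega> \<in> space M. d \<le> \<mu> \<and> \<sigma> > 0 \<and>
      (\<Sum>i=1..m. (\<mu> - d - Z i \<omega>)\<^sup>2) / m \<le> \<sigma>\<^sup>2 + d\<^sup>2 - sqrt (\<sigma>\<^sup>2 + d\<^sup>2) * r}"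
  have [measurable]: "EvA \<in> sets M" "EvB \<in> sets M" unfolding EvA_def EvB_def by measurable
  have PA: "prob EvA \<le> exp (- s)"
  proof -
    obtain \<theta> where \<theta>: "0 < \<theta>" "T * ((exp (\<theta> * 1) - 1 - \<theta> * 1) / 1\<^sup>2) - \<theta> * (sqrt (2 * T * s) + 1 * s / 3) \<le> - s"
      using bernstein_exponent[OF T(1) zero_less_one s] by blast
    have eq: "m * (\<sigma> * r + r\<^sup>2 / 6) = sqrt (2 * T * s) + s / 3"
    proof -
      have "m * (\<sigma> * r) = sqrt (2 * T * s)"
      proof -
        have "(m * (\<sigma> * r))\<^sup>2 = (m * \<sigma>\<^sup>2) * (m * r\<^sup>2)" by (simp add: power2_eq_square)
        also have "\<dots> = 2 * T * s" unfolding \<sigma>2 r2 by simp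
        finally show ?thesis using r \<sigma>(1) by (metis abs_of_nonneg real_sqrt_abs mult_nonneg_nonneg of_nat_0_le_iff less_imp_le)
      qed
      then show ?thesis using r2 by (simp add: algebra_simps)
    qed
    have ind': "indep_vars (\<lambda>_. borel) (\<lambda>i \<omega>. \<theta> * (\<mu> - Z i \<omega>)) {1..m}"
      by (rule indep_vars_compose2[OF ind]) auto
    have "prob {\<omega> \<in> space M. \<theta> * (sqrt (2 * T * s) + s / 3) \<le> (\<Sum>i\<in>{1..m}. \<theta> * (\<mu> - Z i \<omega>))}
      \<le> exp ((\<Sum>i\<in>{1..m}. \<theta> * (\<mu> - expectation (Z i)) + (exp \<theta> - 1 - \<theta>) * v i) - \<theta> * (sqrt (2 * T * s) + s / 3))"
    proof (rule chernoff_sum[OF _ ind'])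
      fix i assume i: "i \<in> {1..m}"
      have i2: "integrable M (\<lambda>\<omega>. (\<mu> - Z i \<omega>)\<^sup>2)" "integrable M (\<lambda>\<omega>. \<mu> - Z i \<omega>)"
        by (simp_all add: int[OF i, of "\<lambda>x. (\<mu> - x)\<^sup>2"] int[OF i, of "\<lambda>x. \<mu> - x"] continuous_intros)
      show "(\<integral>\<^sup>+\<omega>. ennreal (exp (\<theta> * (\<mu> - Z i \<omega>))) \<partial>M) \<le> ennreal (exp (\<theta> * (\<mu> - expectation (Z i)) + (exp \<theta> - 1 - \<theta>) * v i))"
      proof (rule nn_integral_exp_le)
        show "AE \<omega> in M. exp (\<theta> * (\<mu> - Z i \<omega>)) \<le> 1 + (\<theta> * (\<mu> - Z i \<omega>) + (exp \<theta> - 1 - \<theta>) * (\<mu> - Z i \<omega>)\<^sup>2)"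
          using Z[OF i]
        proof eventually_elim
          case (elim \<omega>)
          then have "\<bar>\<mu> - Z i \<omega>\<bar> \<le> 1" using \<mu> by (simp add: abs_le_iff)
          then show ?case using exp_mult_le[of \<theta> "\<mu> - Z i \<omega>"] \<theta>(1) by (simp add: add.assoc)
        qed
        show "expectation (\<lambda>\<omega>. \<theta> * (\<mu> - Z i \<omega>) + (exp \<theta> - 1 - \<theta>) * (\<mu> - Z i \<omega>)\<^sup>2)
            \<le> \<theta> * (\<mu> - expectation (Z i)) + (exp \<theta> - 1 - \<theta>) * v i"
          using i2 Ey[OF i] by (simp add: v_def del: Bochner_Integration.integral_diff)
      qed (use i i2 in auto)
    qed auto
    also have "(\<Sum>i\<in>{1..m}. \<theta> * (\<mu> - expectation (Z i)) + (exp \<theta> - 1 - \<theta>) * v i) = (exp \<theta> - 1 - \<theta>) * T"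
      unfolding sum.distrib sum_distrib_left[symmetric] sum0 by (simp add: T_def)
    also have "exp ((exp \<theta> - 1 - \<theta>) * T - \<theta> * (sqrt (2 * T * s) + s / 3)) \<le> exp (- s)"
      using \<theta> by (simp add: mult.commute)
    also have "{\<omega> \<in> space M. \<theta> * (sqrt (2 * T * s) + s / 3) \<le> (\<Sum>i\<in>{1..m}. \<theta> * (\<mu> - Z i \<omega>))} = EvA"
    proof -
      have "\<theta> * (sqrt (2 * T * s) + s / 3) \<le> (\<Sum>i\<in>{1..m}. \<theta> * (\<mu> - Z i \<omega>))
          \<longleftrightarrow> \<sigma> * r + r\<^sup>2 / 6 \<le> (\<Sum>i=1..m. \<mu> - Z i \<omega>) / m" for \<omega>
        unfolding eq[symmetric] sum_distrib_left[symmetric]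
        using \<theta>(1) m by (subst pos_le_divide_eq) (simp_all add: mult.commute[of _ "real m"])
      then show ?thesis by (simp only: EvA_def)
    qed
    finally show ?thesis .
  qed
  have PB: "prob EvB \<le> exp (- s)"
  proof (cases "d \<le> \<mu> \<and> \<sigma> > 0")
    case True
    define Ta where "Ta = m * (\<sigma>\<^sup>2 + d\<^sup>2)"
    have Ta: "Ta > 0" using True m by (simp add: Ta_def add_pos_nonneg)
    define a where "a = \<mu> - d"
    have a: "0 \<le> a" "a \<le> 1" using True \<mu> r by (auto simp: a_def d_def intro: order_trans[of _ \<mu>])
    \<comment> \<open>The Chernoff exponent at this deviation is - \<theta>^2 Ta / 2, which this
      choice makes equal to - s.\<close>
    define \<theta> where "\<theta> = sqrt (2 * s / Ta)"
    have \<theta>: "\<theta> > 0" "\<theta>\<^sup>2 * Ta = 2 * s" using Ta s by (auto simp: \<theta>_def)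
    have eq: "m * (\<sigma>\<^sup>2 + d\<^sup>2 - sqrt (\<sigma>\<^sup>2 + d\<^sup>2) * r) = Ta - \<theta> * Ta"
    proof -
      have "(m * (sqrt (\<sigma>\<^sup>2 + d\<^sup>2) * r))\<^sup>2 = (m * (\<sigma>\<^sup>2 + d\<^sup>2)) * (m * r\<^sup>2)"
        by (simp add: power_mult_distrib power2_eq_square[of "real m"])
      also have "\<dots> = (\<theta> * Ta)\<^sup>2" unfolding r2 Ta_def[symmetric] \<theta>(2)[symmetric] by (simp add: power2_eq_square)
      finally have "m * (sqrt (\<sigma>\<^sup>2 + d\<^sup>2) * r) = \<theta> * Ta"
        using r \<theta> Ta by (subst (asm) power2_eq_iff_nonneg) auto
      then show ?thesis by (simp add: Ta_def right_diff_distrib)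
    qed
    define w where "w i = expectation (\<lambda>\<omega>. (a - Z i \<omega>)\<^sup>2)" for i
    have i2: "integrable M (\<lambda>\<omega>. (a - Z i \<omega>)\<^sup>2)" if "i \<in> {1..m}" for i
      by (simp add: int[OF that, of "\<lambda>x. (a - x)\<^sup>2"] continuous_intros)
    have w: "w i = v i - 2 * d * (\<mu> - expectation (Z i)) + d\<^sup>2" if "i \<in> {1..m}" for i
    proof -
      have "w i = expectation (\<lambda>\<omega>. (\<mu> - Z i \<omega>)\<^sup>2 - 2 * d * (\<mu> - Z i \<omega>) + d\<^sup>2)"
        unfolding w_def a_def by (intro Bochner_Integration.integral_cong) (auto simp: power2_eq_square algebra_simps)
      also have "\<dots> = v i - 2 * d * expectation (\<lambda>\<omega>. \<mu> - Z i \<omega>) + d\<^sup>2"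
      proof -
        have i2: "integrable M (\<lambda>\<omega>. (\<mu> - Z i \<omega>)\<^sup>2)" "integrable M (\<lambda>\<omega>. \<mu> - Z i \<omega>)"
          by (simp_all add: int[OF that, of "\<lambda>x. (\<mu> - x)\<^sup>2"] int[OF that, of "\<lambda>x. \<mu> - x"] continuous_intros)
        then show ?thesis unfolding v_def by (simp add: prob_space)
      qed
      finally show ?thesis by (simp add: Ey[OF that])
    qed
    have sumw: "(\<Sum>i\<in>{1..m}. w i) = Ta"
    proof -
      have "(\<Sum>i\<in>{1..m}. w i) = (\<Sum>i\<in>{1..m}. v i) - 2 * d * (\<Sum>i\<in>{1..m}. \<mu> - expectation (Z i)) + m * d\<^sup>2"
      proof -
        have "(\<Sum>i\<in>{1..m}. w i) = (\<Sum>i\<in>{1..m}. v i - 2 * d * (\<mu> - expectation (Z i)) + d\<^sup>2)"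
          using w by (intro sum.cong) auto
        also have "\<dots> = (\<Sum>i\<in>{1..m}. v i) - 2 * d * (\<Sum>i\<in>{1..m}. \<mu> - expectation (Z i)) + m * d\<^sup>2"
          unfolding sum.distrib sum_subtractf[of v] sum_distrib_left[symmetric] by simp
        finally show ?thesis .
      qed
      then show ?thesis unfolding sum0 unfolding T_def[symmetric] Ta_def \<sigma>2[symmetric] by (simp add: distrib_left)
    qed
    have ind': "indep_vars (\<lambda>_. borel) (\<lambda>i \<omega>. - \<theta> * (a - Z i \<omega>)\<^sup>2) {1..m}"
      by (rule indep_vars_compose2[OF ind]) auto
    have "prob {\<omega> \<in> space M. - \<theta> * (Ta - \<theta> * Ta) \<le> (\<Sum>i\<in>{1..m}. - \<theta> * (a - Z i \<omega>)\<^sup>2)}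
      \<le> exp ((\<Sum>i\<in>{1..m}. (- \<theta> + \<theta>\<^sup>2 / 2) * w i) - (- \<theta> * (Ta - \<theta> * Ta)))"
    proof (rule chernoff_sum[OF _ ind'])
      fix i assume i: "i \<in> {1..m}"
      show "(\<integral>\<^sup>+\<omega>. ennreal (exp (- \<theta> * (a - Z i \<omega>)\<^sup>2)) \<partial>M) \<le> ennreal (exp ((- \<theta> + \<theta>\<^sup>2 / 2) * w i))"
      proof (rule nn_integral_exp_le)
        show "AE \<omega> in M. exp (- \<theta> * (a - Z i \<omega>)\<^sup>2) \<le> 1 + (- \<theta> + \<theta>\<^sup>2 / 2) * (a - Z i \<omega>)\<^sup>2"
          using Z[OF i]
        proof eventually_elim
          case (elim \<omega>)
          define x where "x = (a - Z i \<omega>)\<^sup>2"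
          have x: "0 \<le> x" "x \<le> 1" using elim a by (auto simp: x_def abs_square_le_1)
          have "exp (- (\<theta> * x)) \<le> 1 - \<theta> * x + (\<theta> * x)\<^sup>2 / 2" using \<theta> x by (intro exp_minus_le) auto
          \<comment> \<open>As x \<le> 1, the fourth power of a - Z is bounded by its square, and no
            moment beyond the second is required.\<close>
          also have "(\<theta> * x)\<^sup>2 \<le> \<theta>\<^sup>2 * x"
            using x by (simp add: power_mult_distrib mult_left_mono power2_eq_square[of x] mult_left_le)
          finally show ?case by (simp add: x_def[symmetric] algebra_simps)
        qed
      qed (use i i2 in \<open>auto simp: w_def\<close>)
    qed auto
    also have "(\<Sum>i\<in>{1..m}. (- \<theta> + \<theta>\<^sup>2 / 2) * w i) - (- \<theta> * (Ta - \<theta> * Ta)) = - s"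
      unfolding sum_distrib_left[symmetric] sumw using \<theta>(2) by (simp add: algebra_simps power2_eq_square)
    also have "{\<omega> \<in> space M. - \<theta> * (Ta - \<theta> * Ta) \<le> (\<Sum>i\<in>{1..m}. - \<theta> * (a - Z i \<omega>)\<^sup>2)} = EvB"
      unfolding EvB_def sum_distrib_left[symmetric] eq[symmetric]
      using True \<theta>(1) m by (auto simp: a_def pos_divide_le_eq mult.commute)
    finally show ?thesis .
  next
    case False
    then show ?thesis by (auto simp: EvB_def)
  qed
  define bad where "bad = {\<omega> \<in> space M. sample_sd m (\<lambda>i. Z i \<omega>) * sqrt (2 * s / m) + 7 * s / (3 * (real m - 1))
      \<le> (\<Sum>i=1..m. expectation (Z i)) / m - (\<Sum>i=1..m. Z i \<omega>) / m}"
  have AEZ: "AE \<omega> in M. \<forall>i\<in>{1..m}. 0 \<le> Z i \<omega> \<and> Z i \<omega> \<le> 1"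
    using Z by (subst AE_finite_all) auto
  have "prob bad \<le> prob (EvA \<union> EvB)"
  proof (rule finite_measure_mono_AE)
    show "AE \<omega> in M. \<omega> \<in> bad \<longrightarrow> \<omega> \<in> EvA \<union> EvB"
      using AEZ
    proof (rule AE_mp, intro AE_I2 impI)
      fix \<omega> assume w: "\<omega> \<in> space M" and Zw: "\<forall>i\<in>{1..m}. 0 \<le> Z i \<omega> \<and> Z i \<omega> \<le> 1" and bad: "\<omega> \<in> bad"
      show "\<omega> \<in> EvA \<union> EvB"
      proof (rule ccontr)
        assume no: "\<omega> \<notin> EvA \<union> EvB"
        define D where "D = (\<Sum>i=1..m. \<mu> - Z i \<omega>) / m"
        define U where "U = (\<Sum>i=1..m. (\<mu> - Z i \<omega>)\<^sup>2) / m"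
        have D: "D = \<mu> - (\<Sum>i=1..m. Z i \<omega>) / m" using m by (simp add: D_def sum_subtractf diff_divide_distrib)
        have "D \<le> \<mu>" using sum_nonneg[of "{1..m}" "\<lambda>i. Z i \<omega>"] Zw by (simp add: D)
        have Ua: "(\<Sum>i=1..m. (\<mu> - d - Z i \<omega>)\<^sup>2) / m = U - 2 * d * D + d\<^sup>2"
        proof -
          have "(\<Sum>i=1..m. (\<mu> - d - Z i \<omega>)\<^sup>2) = (\<Sum>i=1..m. (\<mu> - Z i \<omega>)\<^sup>2 - 2 * d * (\<mu> - Z i \<omega>) + d\<^sup>2)"
            by (intro sum.cong) (auto simp: power2_eq_square algebra_simps)
          also have "\<dots> = (\<Sum>i=1..m. (\<mu> - Z i \<omega>)\<^sup>2) - 2 * d * (\<Sum>i=1..m. \<mu> - Z i \<omega>) + m * d\<^sup>2"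
            unfolding sum.distrib sum_subtractf[of "\<lambda>i. (\<mu> - Z i \<omega>)\<^sup>2"] sum_distrib_left[symmetric] by simp
          finally show ?thesis using m by (simp add: U_def D_def add_divide_distrib diff_divide_distrib)
        qed
        have "D < r * sqrt (sample_var m (\<lambda>i. Z i \<omega>)) + d"
        proof (rule deviation_from_empirical_variance[OF r \<sigma> d_def])
          show "D < \<sigma> * r + r\<^sup>2 / 6" using no w by (auto simp: EvA_def D_def)
          show "\<sigma>\<^sup>2 + d\<^sup>2 - sqrt (\<sigma>\<^sup>2 + d\<^sup>2) * r < U - 2 * d * D + d\<^sup>2" if "d \<le> D" "\<sigma> > 0"
            unfolding Ua[symmetric] using no w that \<open>D \<le> \<mu>\<close> by (auto simp: EvB_def)
          show "U - D\<^sup>2 \<le> sample_var m (\<lambda>i. Z i \<omega>)" unfolding U_def D_def by (rule sample_var_ge[OF m])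
          show "0 \<le> sample_var m (\<lambda>i. Z i \<omega>)"
            using sample_var_ge[OF m, of \<mu> "\<lambda>i. Z i \<omega>"] by linarith
        qed
        \<comment> \<open>The stated term has m - 1 in place of m and is therefore larger.\<close>
        moreover have "d \<le> 7 * s / (3 * (real m - 1))"
        proof -
          have "d = 7 * s / (3 * real m)" using m r2 by (simp add: d_def field_simps)
          also have "\<dots> \<le> 7 * s / (3 * (real m - 1))" using m s by (intro divide_left_mono) auto
          finally show ?thesis .
        qed
        moreover have "sqrt (sample_var m (\<lambda>i. Z i \<omega>)) * r + 7 * s / (3 * (real m - 1)) \<le> D"
          using bad unfolding bad_def D \<mu>_def r_def sample_sd_def by simp
        ultimately show False by (simp add: mult.commute)
      qed
    qed
  qed auto
  also have "\<dots> \<le> prob EvA + prob EvB" by (rule measure_Un_le) auto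
  also have "\<dots> \<le> 2 * exp (- s)" using PA PB by simp
  finally show ?thesis by (simp add: bad_def)
qed

lemma empirical_bernstein_lower:
  fixes Z :: "nat \<Rightarrow> 'a \<Rightarrow> real"
  assumes m: "m \<ge> 2" and s: "s > 0" and ind: "indep_vars (\<lambda>_. borel) Z {1..m}" and b: "b > 0"
    and Z: "\<And>i. i \<in> {1..m} \<Longrightarrow> AE \<omega> in M. 0 \<le> Z i \<omega> \<and> Z i \<omega> \<le> b"
  shows "prob {\<omega> \<in> space M. sample_sd m (\<lambda>i. Z i \<omega>) * sqrt (2 * s / m) + 7 * b * s / (3 * (real m - 1))
      \<le> (\<Sum>i=1..m. expectation (Z i)) / m - (\<Sum>i=1..m. Z i \<omega>) / m} \<le> 2 * exp (- s)"
proof -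
  define W where "W i \<omega> = (1 / b) * Z i \<omega>" for i \<omega>
  have "prob {\<omega> \<in> space M. sample_sd m (\<lambda>i. W i \<omega>) * sqrt (2 * s / m) + 7 * s / (3 * (real m - 1))
      \<le> (\<Sum>i=1..m. expectation (W i)) / m - (\<Sum>i=1..m. W i \<omega>) / m} \<le> 2 * exp (- s)"
  proof (rule empirical_bernstein_unit[OF m s])
    show "indep_vars (\<lambda>_. borel) W {1..m}"
      unfolding W_def by (rule indep_vars_compose2[OF ind]) auto
    show "AE \<omega> in M. 0 \<le> W i \<omega> \<and> W i \<omega> \<le> 1" if "i \<in> {1..m}" for i
      using Z[OF that] b by (auto simp: W_def elim!: eventually_mono)
  qed
  moreover have "(sample_sd m (\<lambda>i. W i \<omega>) * sqrt (2 * s / m) + 7 * s / (3 * (real m - 1))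
      \<le> (\<Sum>i=1..m. expectation (W i)) / m - (\<Sum>i=1..m. W i \<omega>) / m) \<longleftrightarrow>
     (sample_sd m (\<lambda>i. Z i \<omega>) * sqrt (2 * s / m) + 7 * b * s / (3 * (real m - 1))
      \<le> (\<Sum>i=1..m. expectation (Z i)) / m - (\<Sum>i=1..m. Z i \<omega>) / m)" for \<omega>
  proof -
    have W: "sample_sd m (\<lambda>i. W i \<omega>) = 1 / b * sample_sd m (\<lambda>i. Z i \<omega>)"
      "(\<Sum>i=1..m. expectation (W i)) = 1 / b * (\<Sum>i=1..m. expectation (Z i))"
      "(\<Sum>i=1..m. W i \<omega>) = 1 / b * (\<Sum>i=1..m. Z i \<omega>)"
      unfolding W_def using b by (auto simp: sample_sd_scale sum_distrib_left sum_divide_distrib simp del: times_divide_eq_left)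
    have "sample_sd m (\<lambda>i. W i \<omega>) * sqrt (2 * s / m) + 7 * s / (3 * (real m - 1))
       = 1 / b * (sample_sd m (\<lambda>i. Z i \<omega>) * sqrt (2 * s / m) + 7 * b * s / (3 * (real m - 1)))"
      "(\<Sum>i=1..m. expectation (W i)) / m - (\<Sum>i=1..m. W i \<omega>) / m
       = 1 / b * ((\<Sum>i=1..m. expectation (Z i)) / m - (\<Sum>i=1..m. Z i \<omega>) / m)"
      unfolding W using b by (simp_all add: distrib_left right_diff_distrib)
    then show ?thesis using b by (simp add: mult_le_cancel_left_pos divide_le_cancel)
  qed
  ultimately show ?thesis by simp
qed

text \<open>The reflection Z \<mapsto> b - Z keeps the range [0,b] and the sample variance, and
  exchanges the two tails.\<close>

lemma empirical_bernstein_upper: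
  fixes Z :: "nat \<Rightarrow> 'a \<Rightarrow> real"
  assumes m: "m \<ge> 2" and s: "s > 0" and ind: "indep_vars (\<lambda>_. borel) Z {1..m}" and b: "b > 0"
    and Z: "\<And>i. i \<in> {1..m} \<Longrightarrow> AE \<omega> in M. 0 \<le> Z i \<omega> \<and> Z i \<omega> \<le> b"
  shows "prob {\<omega> \<in> space M. sample_sd m (\<lambda>i. Z i \<omega>) * sqrt (2 * s / m) + 7 * b * s / (3 * (real m - 1))
      \<le> (\<Sum>i=1..m. Z i \<omega>) / m - (\<Sum>i=1..m. expectation (Z i)) / m} \<le> 2 * exp (- s)"
proof -
  have rv: "i \<in> {1..m} \<Longrightarrow> Z i \<in> borel_measurable M" for i using ind by (auto simp: indep_vars_def)
  have int: "integrable M (Z i)" if "i \<in> {1..m}" for i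
    using Z[OF that] rv[OF that] b by (intro integrable_const_bound[where B = b]) (auto intro: eventually_mono[OF Z[OF that]])
  have "prob {\<omega> \<in> space M. sample_sd m (\<lambda>i. b - Z i \<omega>) * sqrt (2 * s / m) + 7 * b * s / (3 * (real m - 1))
      \<le> (\<Sum>i=1..m. expectation (\<lambda>\<omega>. b - Z i \<omega>)) / m - (\<Sum>i=1..m. b - Z i \<omega>) / m} \<le> 2 * exp (- s)"
  proof (rule empirical_bernstein_lower[OF m s _ b])
    show "indep_vars (\<lambda>_. borel) (\<lambda>i \<omega>. b - Z i \<omega>) {1..m}"
      by (rule indep_vars_compose2[OF ind]) auto
    show "AE \<omega> in M. 0 \<le> b - Z i \<omega> \<and> b - Z i \<omega> \<le> b" if "i \<in> {1..m}" for i
      using Z[OF that] by (auto elim!: eventually_mono)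
  qed
  moreover have "(\<Sum>i=1..m. expectation (\<lambda>\<omega>. b - Z i \<omega>)) / m - (\<Sum>i=1..m. b - Z i \<omega>) / m
     = (\<Sum>i=1..m. Z i \<omega>) / m - (\<Sum>i=1..m. expectation (Z i)) / m" for \<omega>
    using int by (simp add: sum_subtractf prob_space diff_divide_distrib)
  ultimately show ?thesis by (simp add: sample_sd_def sample_var_shift)
qed

end

section \<open>Traces of positive operators\<close>

context hilbert_space
begin

text \<open>In the first equation a divergent sum becomes 0 on both sides: by
  \<open>enn2real\<close> on the right, by the default value of \<open>infsum\<close> on the
  left.\<close>

lemma suminf_bseq_eq_infsum:
  fixes f :: "'h \<Rightarrow> real"
  assumes f: "\<And>x. 0 \<le> f x" "f 0 = 0"
  shows "infsum f (basis ip) = enn2real (\<Sum>k. ennreal (f (bseq k)))"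
    and "f summable_on basis ip \<Longrightarrow> (\<Sum>k. ennreal (f (bseq k))) = ennreal (infsum f (basis ip))"
proof -
  let ?N = "to_nat_on (basis ip)"
  have inj: "inj_on ?N (basis ip)" by (rule inj_on_to_nat_on[OF countable_basis])
  have zero: "f (bseq k) = 0" if "k \<notin> ?N ` basis ip" for k using that f(2) by (simp add: bseq_def)
  let ?g = "\<lambda>k. f (bseq k)"
  let ?s = "\<Sum>k. ennreal (f (bseq k))"
  have inf: "infsum f (basis ip) = infsum ?g UNIV"
  proof -
    have "infsum f (basis ip) = infsum (?g \<circ> ?N) (basis ip)" by (rule infsum_cong) simp
    also have "\<dots> = infsum ?g (?N ` basis ip)" by (rule infsum_reindex[OF inj, symmetric])
    also have "\<dots> = infsum ?g UNIV" by (rule infsum_cong_neutral) (auto simp: zero)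
    finally show ?thesis .
  qed
  have sm: "f summable_on basis ip \<longleftrightarrow> summable ?g"
  proof -
    have "f summable_on basis ip \<longleftrightarrow> (?g \<circ> ?N) summable_on basis ip" by (rule summable_on_cong) simp
    also have "\<dots> \<longleftrightarrow> ?g summable_on (?N ` basis ip)" by (rule summable_on_reindex[OF inj, symmetric])
    also have "\<dots> \<longleftrightarrow> ?g summable_on UNIV" by (rule summable_on_cong_neutral) (auto simp: zero)
    also have "\<dots> \<longleftrightarrow> summable ?g" by (rule summable_on_UNIV_nonneg_real_iff) (simp add: f)
    finally show ?thesis .
  qed
  have eq: "?s = ennreal (infsum f (basis ip))" if "summable ?g"
  proof -
    have "?g summable_on UNIV" using that f(1) by (subst summable_on_UNIV_nonneg_real_iff) auto
    then have "?g sums infsum ?g UNIV"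
      by (intro has_sum_imp_sums has_sum_infsum)
    then have "(\<lambda>k. ennreal (f (bseq k))) sums ennreal (infsum f (basis ip))"
      unfolding inf using f(1) by (subst sums_ennreal) (auto intro: infsum_nonneg)
    then show ?thesis by (simp add: sums_iff)
  qed
  then show "f summable_on basis ip \<Longrightarrow> ?s = ennreal (infsum f (basis ip))" unfolding sm .
  show "infsum f (basis ip) = enn2real ?s"
  proof (cases "summable ?g")
    case True
    then show ?thesis using f(1) by (subst eq) (simp_all add: infsum_nonneg)
  next
    case False
    have "?s = top"
    proof (rule ccontr)
      assume "?s \<noteq> top"
      with summable_suminf_not_top[of "\<lambda>k. f (bseq k)"] f(1) False show False by simp
    qed
    then show ?thesis using False sm by (simp add: infsum_not_exists)
  qed
qed

text \<open>A trace with values in [0,\<infinity>]. It is meant for positive operators, where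
  \<open>ennreal\<close> does not cut off negative diagonal entries.\<close>

definition ptr :: "'h operator \<Rightarrow> ennreal" where
  "ptr T = (\<Sum>k. ennreal (T (bseq k) \<bullet> bseq k))"

text \<open>The square of the Hilbert-Schmidt norm, possibly infinite.\<close>

definition hs2 :: "'h operator \<Rightarrow> ennreal" where
  "hs2 T = (\<Sum>k. ennreal ((norm (T (bseq k)))\<^sup>2))"

definition posop :: "'h operator \<Rightarrow> bool" where
  "posop T \<longleftrightarrow> selfadj T \<and> (\<forall>x. 0 \<le> T x \<bullet> x)"

lemma ip_selfadj_self: "selfadj T \<Longrightarrow> ip (T x) x = of_real (T x \<bullet> x)"
proof -
  assume "selfadj T"
  then have "cnj (ip (T x) x) = ip (T x) x" by (metis selfadj_def ip_commute)
  then have "Im (ip (T x) x) = 0" by (simp add: complex_eq_iff)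
  then show ?thesis by (simp add: complex_eq_iff Re_ip)
qed

lemma tr_posop:
  assumes "posop T"
  shows "tr ip T = enn2real (ptr T)"
    and "finite_trace ip T \<Longrightarrow> ptr T = ennreal (tr ip T)"
proof -
  define f where "f x = T x \<bullet> x" for x
  have f: "\<And>x. 0 \<le> f x" "f 0 = 0" using assms by (auto simp: f_def posop_def)
  have ipf: "ip (T x) x = of_real (f x)" for x
    using assms by (simp add: f_def posop_def ip_selfadj_self)
  have sm: "finite_trace ip T \<longleftrightarrow> f summable_on basis ip"
  proof
    assume "finite_trace ip T"
    then have "(\<lambda>x. Re (complex_of_real (f x))) summable_on basis ip"
      unfolding finite_trace_def ipf by (rule summable_on_bounded_linear[OF bounded_linear_Re])
    then show "f summable_on basis ip" by simp
  qed (simp add: finite_trace_def ipf summable_on_of_real)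
  have tr: "tr ip T = infsum f (basis ip)"
  proof (cases "f summable_on basis ip")
    case True
    then have "((\<lambda>x. complex_of_real (f x)) has_sum of_real (infsum f (basis ip))) (basis ip)"
      by (intro has_sum_of_real has_sum_infsum)
    then show ?thesis by (simp add: tr_def ipf infsumI)
  next
    case False
    then have "\<not> finite_trace ip T" using sm by simp
    then show ?thesis using False by (simp add: tr_def finite_trace_def infsum_not_exists)
  qed
  show "tr ip T = enn2real (ptr T)"
    unfolding tr ptr_def using suminf_bseq_eq_infsum(1)[of f, OF f] by (simp add: f_def)
  show "finite_trace ip T \<Longrightarrow> ptr T = ennreal (tr ip T)"
    unfolding tr ptr_def using suminf_bseq_eq_infsum(2)[of f, OF f] sm by (simp add: f_def)
qed

lemma posop_sum: "(\<And>i. i \<in> I \<Longrightarrow> posop (T i)) \<Longrightarrow> posop (\<Sum>i\<in>I. T i)"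
  by (auto simp: posop_def selfadj_def blinfun.sum_left ip_sum_left ip_sum_right inner_sum_left intro: sum_nonneg)

lemma posop_scaleR: "0 \<le> c \<Longrightarrow> posop T \<Longrightarrow> posop (c *\<^sub>R T)"
  by (auto simp: posop_def selfadj_def scaleR_blinfun.rep_eq ip_scaleR_left ip_scaleR_right)

lemma ptr_add: "posop S \<Longrightarrow> posop T \<Longrightarrow> ptr (S + T) = ptr S + ptr T"
  unfolding ptr_def by (subst suminf_add) (auto simp: posop_def plus_blinfun.rep_eq inner_add_left intro: summableI)

lemma ptr_zero: "ptr 0 = 0"
  by (simp add: ptr_def zero_blinfun.rep_eq)

lemma ptr_sum: "(\<And>i. i \<in> I \<Longrightarrow> posop (T i)) \<Longrightarrow> ptr (\<Sum>i\<in>I. T i) = (\<Sum>i\<in>I. ptr (T i))"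
  by (induction I rule: infinite_finite_induct) (auto simp: ptr_zero ptr_add posop_sum)

lemma ptr_scaleR: "0 \<le> c \<Longrightarrow> ptr (c *\<^sub>R T) = ennreal c * ptr T"
  unfolding ptr_def by (subst ennreal_suminf_cmult[symmetric]) (auto simp: scaleR_blinfun.rep_eq ennreal_mult')

text \<open>On positive operators \<open>ptr\<close> is additive even for infinite values;
  finiteness enters because \<open>tr\<close> records an infinite trace as 0.\<close>

lemma tr_scaleR_sum_posop:
  assumes T: "\<And>i. i \<in> I \<Longrightarrow> posop (T i)" "\<And>i. i \<in> I \<Longrightarrow> ptr (T i) < top" and c: "0 \<le> c"
  shows "tr ip (c *\<^sub>R (\<Sum>i\<in>I. T i)) = c * (\<Sum>i\<in>I. tr ip (T i))"
proof -
  have "tr ip (c *\<^sub>R (\<Sum>i\<in>I. T i)) = enn2real (ennreal c * (\<Sum>i\<in>I. ptr (T i)))"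
    using T c by (simp add: tr_posop posop_scaleR posop_sum ptr_scaleR ptr_sum)
  also have "(\<Sum>i\<in>I. ptr (T i)) = ennreal (\<Sum>i\<in>I. tr ip (T i))"
    using T by (subst sum_ennreal[symmetric]) (auto simp: tr_posop intro!: sum.cong)
  finally show ?thesis using c T by (simp add: enn2real_mult sum_nonneg tr_posop)
qed

lemma selfadj_diff: "selfadj (blinfun_apply S) \<Longrightarrow> selfadj (blinfun_apply T) \<Longrightarrow> selfadj (blinfun_apply (S - T))"
  by (auto simp: selfadj_def minus_blinfun.rep_eq ip_diff_left ip_diff_right)

lemma half_opsq:
  assumes D: "selfadj (blinfun_apply D)"
  shows "posop ((1/2) *\<^sub>R opsq D)" "((1/2) *\<^sub>R opsq D) x \<bullet> x = (norm (D x))\<^sup>2 / 2"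
    "norm ((1/2) *\<^sub>R opsq D) \<le> (norm D)\<^sup>2 / 2" "ptr ((1/2) *\<^sub>R opsq D) = ennreal (1/2) * hs2 D"
proof -
  show *: "((1/2) *\<^sub>R opsq D) x \<bullet> x = (norm (D x))\<^sup>2 / 2" for x
    using selfadj_inner[OF D] by (simp add: opsq_def scaleR_blinfun.rep_eq power2_norm_eq_inner)
  show "posop ((1/2) *\<^sub>R opsq D)"
    unfolding posop_def * using D by (auto simp: selfadj_def scaleR_blinfun.rep_eq opsq_def ip_scaleR_left ip_scaleR_right)
  show "norm ((1/2) *\<^sub>R opsq D) \<le> (norm D)\<^sup>2 / 2"
    using norm_blinfun_compose[of D D] by (simp add: opsq_def power2_eq_square)
  show "ptr ((1/2) *\<^sub>R opsq D) = ennreal (1/2) * hs2 D"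
    unfolding ptr_def hs2_def * ennreal_suminf_cmult[symmetric] by (simp add: ennreal_mult'[symmetric] del: ennreal_half)
qed

text \<open>Parseval turns both sides into the double series of squared matrix entries, and the
  order of summation is free for nonnegative terms.\<close>

lemma hs2_adjoint:
  fixes S T :: "'h operator"
  assumes "\<And>x y. ip (S x) y = ip x (T y)"
  shows "hs2 S = hs2 T"
proof -
  have pars: "ennreal ((norm x)\<^sup>2) = (\<Sum>j. ennreal ((cmod (ip x (bseq j)))\<^sup>2))" for x
    using parseval[of x] by (subst (asm) sums_ennreal[symmetric]) (auto simp: sums_iff)
  let ?c = "\<lambda>k j. ennreal ((cmod (ip (S (bseq k)) (bseq j)))\<^sup>2)"
  have "hs2 S = (\<Sum>k. \<Sum>j. ?c k j)"
    by (simp only: hs2_def pars)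
  also have "\<dots> = (\<Sum>j. \<Sum>k. ?c k j)"
  proof -
    have "(\<Sum>k. \<Sum>j. ?c k j)
      = (\<integral>\<^sup>+k. (\<Sum>j. ?c k j) \<partial>count_space UNIV)"
      by (simp add: nn_integral_count_space_nat)
    also have "\<dots> = (\<Sum>j. \<integral>\<^sup>+k. ?c k j \<partial>count_space UNIV)"
      by (rule nn_integral_suminf) simp
    finally show ?thesis by (simp add: nn_integral_count_space_nat)
  qed
  also have "cmod (ip (S (bseq k)) (bseq j)) = cmod (ip (T (bseq j)) (bseq k))" for j k
    unfolding assms ip_commute[where y = "bseq k" and x = "T (bseq j)"] by simp
  then have "(\<Sum>j. \<Sum>k. ?c k j) = hs2 T"
    by (simp only: hs2_def pars)
  finally show ?thesis .
qed

lemma hs2_compose_le: "hs2 (A o\<^sub>L D) \<le> ennreal ((norm A)\<^sup>2) * hs2 D"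
  unfolding hs2_def ennreal_suminf_cmult[symmetric]
proof (intro suminf_le summableI)
  fix k
  have "(norm (A (D (bseq k))))\<^sup>2 \<le> (norm A * norm (D (bseq k)))\<^sup>2"
    by (intro power_mono norm_blinfun) simp
  then show "ennreal ((norm ((A o\<^sub>L D) (bseq k)))\<^sup>2) \<le> ennreal ((norm A)\<^sup>2) * ennreal ((norm (D (bseq k)))\<^sup>2)"
    by (simp add: ennreal_mult'[symmetric] power_mult_distrib ennreal_leI)
qed

lemma hs2_diff_le: "hs2 (S - T) \<le> 2 * hs2 S + 2 * hs2 T"
proof -
  have "(norm (x - y))\<^sup>2 \<le> 2 * (norm x)\<^sup>2 + 2 * (norm y)\<^sup>2" for x y :: 'h
  proof -
    have "(norm (x - y))\<^sup>2 + (norm (x + y))\<^sup>2 = 2 * (norm x)\<^sup>2 + 2 * (norm y)\<^sup>2"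
      by (simp add: power2_norm_eq_inner inner_diff inner_add inner_commute)
    then show ?thesis using zero_le_power2[of "norm (x + y)"] by linarith
  qed
  then have "ennreal ((norm ((S - T) x))\<^sup>2) \<le> 2 * ennreal ((norm (S x))\<^sup>2) + 2 * ennreal ((norm (T x))\<^sup>2)" for x
    by (simp add: minus_blinfun.rep_eq ennreal_leI flip: ennreal_plus ennreal_numeral ennreal_mult')
  then have "hs2 (S - T) \<le> (\<Sum>k. 2 * ennreal ((norm (S (bseq k)))\<^sup>2) + 2 * ennreal ((norm (T (bseq k)))\<^sup>2))"
    unfolding hs2_def by (intro suminf_le summableI)
  also have "\<dots> = 2 * hs2 S + 2 * hs2 T"
    unfolding hs2_def ennreal_suminf_cmult[symmetric] by (simp only: suminf_add[OF summableI summableI])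
  finally show ?thesis .
qed

lemma norm_le_quadratic_form:
  assumes A: "selfadj (blinfun_apply A)" and q: "\<And>x. \<bar>A x \<bullet> x\<bar> \<le> a * (norm x)\<^sup>2" and a: "0 \<le> a"
  shows "norm A \<le> a"
proof (rule norm_blinfun_bound[OF a])
  fix x
  show "norm (A x) \<le> a * norm x"
  proof (cases "A x = 0 \<or> x = 0")
    case False
    \<comment> \<open>A x rescaled to the norm of x: the polarised form then equals
      \<parallel>x\<parallel> \<parallel>A x\<parallel>, and both squares from the parallelogram
      identity coincide.\<close>
    define y where "y = (norm x / norm (A x)) *\<^sub>R A x"
    have ny: "norm y = norm x" using False by (simp add: y_def)
    have "4 * (A x \<bullet> y) = A (x + y) \<bullet> (x + y) - A (x - y) \<bullet> (x - y)"
      using selfadj_inner[OF A, of x y] selfadj_inner[OF A, of y x]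
      by (simp add: blinfun.add_right blinfun.diff_right inner_add inner_diff inner_commute)
    also have "\<dots> \<le> a * (norm (x + y))\<^sup>2 + a * (norm (x - y))\<^sup>2"
      using q[of "x + y"] q[of "x - y"] by linarith
    also have "\<dots> = a * (2 * (norm x)\<^sup>2 + 2 * (norm y)\<^sup>2)"
      by (simp add: power2_norm_eq_inner inner_diff inner_add inner_commute algebra_simps)
    finally have "A x \<bullet> y \<le> a * (norm x)\<^sup>2" by (simp add: ny)
    moreover have "A x \<bullet> y = norm x * norm (A x)"
      using False by (simp add: y_def dot_square_norm power2_eq_square)
    ultimately show ?thesis using False by (simp add: power2_eq_square)
  qed (use a in auto)
qed

text \<open>
  \<open>tr A\<^sup>2 = tr (A P) - tr (A Q) \<le> \<parallel>A\<parallel> (tr P + tr Q)\<close> for \<open>A = P - Q\<close>; the trace inequality is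
  elementary because \<open>P = D\<^sup>2 / 2\<close> and \<open>Q = E\<^sup>2 / 2\<close> come with square roots.
\<close>

lemma hs2_diff_half_opsq_le:
  assumes D: "selfadj (blinfun_apply D)" and E: "selfadj (blinfun_apply E)"
    and A: "A = (1/2) *\<^sub>R opsq D - (1/2) *\<^sub>R opsq E" and a: "norm A \<le> a" "0 < a"
  shows "hs2 A \<le> ennreal (a / 2) * (hs2 D + hs2 E)"
proof -
  have sA: "selfadj (blinfun_apply A)"
    unfolding A using half_opsq(1)[OF D] half_opsq(1)[OF E] by (intro selfadj_diff) (auto simp: posop_def)
  \<comment> \<open>The factors are exchanged by passing to the adjoint, so that the operator norm
    is taken of \<open>A\<close> and never of \<open>C\<close>.\<close>
  have key: "hs2 (C o\<^sub>L A) \<le> ennreal (a\<^sup>2) * hs2 C" if C: "selfadj (blinfun_apply C)" for C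
  proof -
    have "hs2 (C o\<^sub>L A) = hs2 (A o\<^sub>L C)"
      by (rule hs2_adjoint) (use C sA in \<open>auto simp: selfadj_def\<close>)
    also have "\<dots> \<le> ennreal ((norm A)\<^sup>2) * hs2 C" by (rule hs2_compose_le)
    also have "\<dots> \<le> ennreal (a\<^sup>2) * hs2 C"
      using a by (intro mult_right_mono ennreal_leI power_mono) auto
    finally show ?thesis .
  qed
  have pt: "(norm (A x))\<^sup>2 \<le> (1 / (4 * a)) * (norm (D (A x)))\<^sup>2 + (a / 4) * (norm (D x))\<^sup>2
     + ((1 / (4 * a)) * (norm (E (A x)))\<^sup>2 + (a / 4) * (norm (E x))\<^sup>2)" for x
  proof -
    \<comment> \<open>Young's inequality, weighted by \<open>a\<close>: once \<open>key\<close> has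
      contributed a^2, both terms carry the same coefficient a / 4.\<close>
    have amgm: "u \<bullet> w / 2 \<le> (1 / (4 * a)) * (norm u)\<^sup>2 + (a / 4) * (norm w)\<^sup>2" for u w :: 'h
    proof -
      have "0 \<le> (norm u - a * norm w)\<^sup>2" by simp
      then have "2 * a * (norm u * norm w) \<le> (norm u)\<^sup>2 + a\<^sup>2 * (norm w)\<^sup>2"
        by (simp add: power2_eq_square algebra_simps)
      moreover have "2 * a * (u \<bullet> w) \<le> 2 * a * (norm u * norm w)"
        using a by (intro mult_left_mono norm_cauchy_schwarz) auto
      ultimately have "2 * a * (u \<bullet> w) \<le> (norm u)\<^sup>2 + a\<^sup>2 * (norm w)\<^sup>2" by linarith
      then have "2 * a * (u \<bullet> w) / (4 * a) \<le> ((norm u)\<^sup>2 + a\<^sup>2 * (norm w)\<^sup>2) / (4 * a)"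
        using a by (intro divide_right_mono) auto
      then show ?thesis using a by (simp add: add_divide_distrib power2_eq_square[of a])
    qed
    have "(norm (A x))\<^sup>2 = A x \<bullet> A x" by (simp add: power2_norm_eq_inner)
    also have "\<dots> = D (A x) \<bullet> D x / 2 + (- E (A x)) \<bullet> E x / 2"
      using selfadj_inner[OF D] selfadj_inner[OF E]
      by (subst (2) A) (simp add: minus_blinfun.rep_eq scaleR_blinfun.rep_eq opsq_def inner_diff_right)
    also have "\<dots> \<le> (1 / (4 * a)) * (norm (D (A x)))\<^sup>2 + (a / 4) * (norm (D x))\<^sup>2
     + ((1 / (4 * a)) * (norm (E (A x)))\<^sup>2 + (a / 4) * (norm (E x))\<^sup>2)"
      using amgm[of "D (A x)" "D x"] amgm[of "- E (A x)" "E x"] by simp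
    finally show ?thesis .
  qed
  define q1 where "q1 = 1 / (4 * a)"
  define q2 where "q2 = a / 4"
  have q: "0 \<le> q1" "0 \<le> q2" using a by (auto simp: q1_def q2_def)
  let ?F = "\<lambda>k. (ennreal q1 * ennreal ((norm (D (A (bseq k))))\<^sup>2) + ennreal q2 * ennreal ((norm (D (bseq k)))\<^sup>2))
     + (ennreal q1 * ennreal ((norm (E (A (bseq k))))\<^sup>2) + ennreal q2 * ennreal ((norm (E (bseq k)))\<^sup>2))"
  have "hs2 A \<le> (\<Sum>k. ?F k)"
    unfolding hs2_def
  proof (intro suminf_le summableI)
    fix k
    have "ennreal ((norm (A (bseq k)))\<^sup>2) \<le> ennreal (q1 * (norm (D (A (bseq k))))\<^sup>2 + q2 * (norm (D (bseq k)))\<^sup>2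
     + (q1 * (norm (E (A (bseq k))))\<^sup>2 + q2 * (norm (E (bseq k)))\<^sup>2))"
      unfolding q1_def q2_def by (rule ennreal_leI[OF pt])
    then show "ennreal ((norm (A (bseq k)))\<^sup>2) \<le> ?F k"
      using q by (simp add: ennreal_mult' ennreal_plus)
  qed
  also have "\<dots> = (ennreal q1 * hs2 (D o\<^sub>L A) + ennreal q2 * hs2 D) + (ennreal q1 * hs2 (E o\<^sub>L A) + ennreal q2 * hs2 E)"
    unfolding hs2_def ennreal_suminf_cmult[symmetric] by (simp only: blinfun_apply_blinfun_compose suminf_add[OF summableI summableI])
  also have "\<dots> \<le> (ennreal q1 * (ennreal (a\<^sup>2) * hs2 D) + ennreal q2 * hs2 D) + (ennreal q1 * (ennreal (a\<^sup>2) * hs2 E) + ennreal q2 * hs2 E)"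
    by (intro add_mono mult_left_mono key D E) auto
  also have "\<dots> = (ennreal (q1 * a\<^sup>2) + ennreal q2) * (hs2 D + hs2 E)"
    unfolding ennreal_mult'[OF q(1)] by (simp only: algebra_simps)
  also have "ennreal (q1 * a\<^sup>2) + ennreal q2 = ennreal (a / 2)"
    using a q by (subst ennreal_plus[symmetric]) (auto simp: q1_def q2_def power2_eq_square)
  finally show ?thesis .
qed

end

section \<open>Random self-adjoint operators\<close>

context hilbert_prob_space
begin

lemma measurable_opM_diff [measurable]:
  fixes X Y :: "'a \<Rightarrow> 'h operator"
  assumes [measurable]: "X \<in> N \<rightarrow>\<^sub>M opM" "Y \<in> N \<rightarrow>\<^sub>M opM"
  shows "(\<lambda>\<omega>. X \<omega> - Y \<omega>) \<in> N \<rightarrow>\<^sub>M opM"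
  by (rule measurable_opMI) (simp add: minus_blinfun.rep_eq)

lemma measurable_opM_scaleR [measurable]:
  fixes X :: "'a \<Rightarrow> 'h operator"
  assumes [measurable]: "X \<in> N \<rightarrow>\<^sub>M opM"
  shows "(\<lambda>\<omega>. r *\<^sub>R X \<omega>) \<in> N \<rightarrow>\<^sub>M opM"
  by (rule measurable_opMI) (simp add: scaleR_blinfun.rep_eq)

lemma measurable_opM_opsq [measurable]:
  fixes X :: "'a \<Rightarrow> 'h operator"
  assumes [measurable]: "X \<in> N \<rightarrow>\<^sub>M opM"
  shows "(\<lambda>\<omega>. opsq (X \<omega>)) \<in> N \<rightarrow>\<^sub>M opM"
  by (rule measurable_opMI) (simp add: opsq_def measurable_opM_apply)

lemma measurable_hs2 [measurable]:
  assumes [measurable]: "X \<in> N \<rightarrow>\<^sub>M opM"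
  shows "(\<lambda>\<omega>. hs2 (X \<omega>)) \<in> borel_measurable N"
  unfolding hs2_def by measurable

lemma measurable_ptr [measurable]:
  assumes [measurable]: "X \<in> N \<rightarrow>\<^sub>M opM"
  shows "(\<lambda>\<omega>. ptr (X \<omega>)) \<in> borel_measurable N"
  unfolding ptr_def by measurable

text \<open>The standing hypothesis on a random operator, under which its pointwise expectation
  exists and is an operator of norm at most \<open>c\<close>.\<close>

definition rop :: "('w \<Rightarrow> 'h operator) \<Rightarrow> real \<Rightarrow> bool" where
  "rop X c \<longleftrightarrow> X \<in> M \<rightarrow>\<^sub>M opM \<and> (\<forall>\<omega>\<in>space M. selfadj (X \<omega>)) \<and> (AE \<omega> in M. norm (X \<omega>) \<le> c)"

lemma rop_measurable: "rop X c \<Longrightarrow> X \<in> M \<rightarrow>\<^sub>M opM"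
  by (simp add: rop_def)

lemma rop_selfadj: "rop X c \<Longrightarrow> \<omega> \<in> space M \<Longrightarrow> selfadj (X \<omega>)"
  by (simp add: rop_def)

lemma rop_AE_norm:
  assumes "rop X c"
  shows "AE \<omega> in M. norm (X \<omega> h) \<le> c * norm h"
proof -
  have "AE \<omega> in M. norm (X \<omega>) \<le> c" using assms by (simp add: rop_def)
  then show ?thesis
  proof eventually_elim
    case (elim \<omega>)
    then show ?case using norm_blinfun[of "X \<omega>" h] mult_right_mono[OF elim, of "norm h"] by simp
  qed
qed

lemma rop_nonneg: "rop X c \<Longrightarrow> 0 \<le> c"
proof -
  assume "rop X c"
  then have "AE \<omega> in M. norm (X \<omega>) \<le> c" by (simp add: rop_def)
  then have "AE \<omega> in M. 0 \<le> c" by eventually_elim (use norm_ge_zero order_trans in blast)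
  then show ?thesis by simp
qed

lemma rop_integrable: "rop X c \<Longrightarrow> integrable M (\<lambda>\<omega>. X \<omega> h)"
  by (rule integrable_const_bound[OF rop_AE_norm]) (auto intro: measurable_opM_eval' rop_measurable)

lemma rop_integrable_sq: "rop X c \<Longrightarrow> integrable M (\<lambda>\<omega>. (norm (X \<omega> h - u))\<^sup>2)"
proof (rule integrable_const_bound[where B = "(c * norm h + norm u)\<^sup>2"])
  assume X: "rop X c"
  show "AE \<omega> in M. norm ((norm (X \<omega> h - u))\<^sup>2) \<le> (c * norm h + norm u)\<^sup>2"
    using rop_AE_norm[OF X, of h]
  proof eventually_elim
    case (elim \<omega>)
    then show ?case using norm_triangle_ineq4[of "X \<omega> h" u] by (auto intro!: power_mono)
  qed
  have "X \<in> M \<rightarrow>\<^sub>M opM" using X by (rule rop_measurable)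
  then show "(\<lambda>\<omega>. (norm (X \<omega> h - u))\<^sup>2) \<in> borel_measurable M" by measurable
qed

text \<open>\<open>expect\<close> packs a function with \<open>Blinfun\<close>, which is meaningful
  only for bounded linear functions; the almost sure norm bound supplies this.\<close>

lemma expect_apply:
  assumes X: "rop X c"
  shows "expect M X h = (\<integral>\<omega>. X \<omega> h \<partial>M)"
proof -
  have "bounded_linear (\<lambda>h. \<integral>\<omega>. X \<omega> h \<partial>M)"
  proof (rule bounded_linear_intro[where K = c])
    fix x y r
    show "(\<integral>\<omega>. X \<omega> (x + y) \<partial>M) = (\<integral>\<omega>. X \<omega> x \<partial>M) + (\<integral>\<omega>. X \<omega> y \<partial>M)"
      using rop_integrable[OF X] by (simp add: blinfun.add_right)
    show "(\<integral>\<omega>. X \<omega> (r *\<^sub>R x) \<partial>M) = r *\<^sub>R (\<integral>\<omega>. X \<omega> x \<partial>M)"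
      by (simp add: blinfun.scaleR_right)
    have "norm (\<integral>\<omega>. X \<omega> x \<partial>M) \<le> (\<integral>\<omega>. norm (X \<omega> x) \<partial>M)" by (rule integral_norm_bound)
    also have "\<dots> \<le> (\<integral>\<omega>. c * norm x \<partial>M)"
      using rop_integrable[OF X] rop_AE_norm[OF X] by (intro integral_mono_AE) auto
    finally show "norm (\<integral>\<omega>. X \<omega> x \<partial>M) \<le> norm x * c" by (simp add: prob_space mult.commute)
  qed
  then show ?thesis by (simp add: expect_def bounded_linear_Blinfun_apply)
qed

lemma expect_inner:
  assumes X: "rop X c"
  shows "expectation (\<lambda>\<omega>. X \<omega> h \<bullet> g) = expect M X h \<bullet> g"
  using rop_integrable[OF X, of h] by (simp add: expect_apply[OF X])

lemma selfadj_expect: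
  assumes X: "rop X c"
  shows "selfadj (expect M X)"
  unfolding selfadj_def
proof safe
  fix x y
  have "ip (expect M X x) y = (\<integral>\<omega>. ip (X \<omega> x) y \<partial>M)"
    unfolding expect_apply[OF X] by (rule integral_bounded_linear[OF bounded_linear_ip_left rop_integrable[OF X], symmetric])
  also have "\<dots> = (\<integral>\<omega>. ip x (X \<omega> y) \<partial>M)"
    using rop_selfadj[OF X] by (intro Bochner_Integration.integral_cong) (auto simp: selfadj_def)
  also have "\<dots> = ip x (expect M X y)"
    unfolding expect_apply[OF X] by (rule integral_bounded_linear[OF bounded_linear_ip_right rop_integrable[OF X]])
  finally show "ip (expect M X x) y = ip x (expect M X y)" .
qed

lemma rop_diff_const:
  assumes X: "rop X c" and S: "selfadj (blinfun_apply S)"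
  shows "rop (\<lambda>\<omega>. X \<omega> - S) (c + norm S)"
proof -
  have [measurable]: "X \<in> M \<rightarrow>\<^sub>M opM" using X by (rule rop_measurable)
  have "AE \<omega> in M. norm (X \<omega>) \<le> c" using X by (simp add: rop_def)
  then have "AE \<omega> in M. norm (X \<omega> - S) \<le> c + norm S"
  proof eventually_elim
    case (elim \<omega>)
    then show ?case using norm_triangle_ineq4[of "X \<omega>" S] by simp
  qed
  moreover have "(\<lambda>\<omega>. X \<omega> - S) \<in> M \<rightarrow>\<^sub>M opM"
    by (rule measurable_opMI) (simp add: minus_blinfun.rep_eq)
  ultimately show ?thesis using rop_selfadj[OF X] selfadj_diff[OF _ S] by (auto simp: rop_def)
qed

lemma rop_opsq:
  assumes X: "rop X c"
  shows "rop (\<lambda>\<omega>. opsq (X \<omega>)) (c\<^sup>2)"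
proof -
  have "AE \<omega> in M. norm (X \<omega>) \<le> c" using X by (simp add: rop_def)
  then have "AE \<omega> in M. norm (opsq (X \<omega>)) \<le> c\<^sup>2"
  proof eventually_elim
    case (elim \<omega>)
    have "norm (opsq (X \<omega>)) \<le> norm (X \<omega>) * norm (X \<omega>)" unfolding opsq_def by (rule norm_blinfun_compose)
    also have "\<dots> \<le> c * c" using elim rop_nonneg[OF X] by (intro mult_mono) auto
    finally show ?case by (simp add: power2_eq_square)
  qed
  moreover have "(\<lambda>\<omega>. opsq (X \<omega>)) \<in> M \<rightarrow>\<^sub>M opM" using rop_measurable[OF X] by (rule measurable_opM_opsq)
  ultimately show ?thesis using rop_selfadj[OF X] by (auto simp: rop_def selfadj_def opsq_def)
qed

lemma expectation_sq_diff:
  assumes X: "rop X c"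
  shows "expectation (\<lambda>\<omega>. (norm (X \<omega> h - x))\<^sup>2)
    = (norm (expect M X h - x))\<^sup>2 + expectation (\<lambda>\<omega>. (norm (X \<omega> h - expect M X h))\<^sup>2)"
proof -
  define u where "u = expect M X h"
  have "expectation (\<lambda>\<omega>. (norm (X \<omega> h - x))\<^sup>2) =
      expectation (\<lambda>\<omega>. (norm (u - x))\<^sup>2 + 2 * ((X \<omega> h - u) \<bullet> (u - x)) + (norm (X \<omega> h - u))\<^sup>2)"
    by (intro Bochner_Integration.integral_cong) (auto simp: power2_norm_eq_inner inner_diff inner_commute)
  also have "\<dots> = (norm (u - x))\<^sup>2 + 2 * expectation (\<lambda>\<omega>. (X \<omega> h - u) \<bullet> (u - x)) + expectation (\<lambda>\<omega>. (norm (X \<omega> h - u))\<^sup>2)"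
    using rop_integrable[OF X, of h] rop_integrable_sq[OF X, of h u] by (simp add: prob_space)
  also have "expectation (\<lambda>\<omega>. (X \<omega> h - u) \<bullet> (u - x)) = 0"
    using rop_integrable[OF X, of h] by (simp add: inner_diff_left u_def expect_apply[OF X] prob_space)
  finally show ?thesis by (simp add: u_def)
qed

lemma var_quadratic_form:
  assumes X: "rop X c"
  shows "var M X h \<bullet> h = expectation (\<lambda>\<omega>. (norm (X \<omega> h - expect M X h))\<^sup>2)"
    and "selfadj (var M X)" and "0 \<le> var M X h \<bullet> h" and "var M X h \<bullet> h \<le> c\<^sup>2 * (norm h)\<^sup>2"
proof -
  have D: "rop (\<lambda>\<omega>. X \<omega> - expect M X) (c + norm (expect M X))"
    by (rule rop_diff_const[OF X selfadj_expect[OF X]])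
  show "selfadj (var M X)" unfolding var_def by (rule selfadj_expect[OF rop_opsq[OF D]])
  have "var M X h \<bullet> h = expectation (\<lambda>\<omega>. opsq (X \<omega> - expect M X) h \<bullet> h)"
    unfolding var_def by (rule expect_inner[OF rop_opsq[OF D], symmetric])
  also have "\<dots> = expectation (\<lambda>\<omega>. (norm (X \<omega> h - expect M X h))\<^sup>2)"
    using selfadj_inner[OF rop_selfadj[OF D]]
    by (intro Bochner_Integration.integral_cong) (auto simp: opsq_def power2_norm_eq_inner minus_blinfun.rep_eq)
  finally show eq: "var M X h \<bullet> h = expectation (\<lambda>\<omega>. (norm (X \<omega> h - expect M X h))\<^sup>2)" .
  then show "0 \<le> var M X h \<bullet> h" by simp
  have "var M X h \<bullet> h \<le> expectation (\<lambda>\<omega>. (norm (X \<omega> h - 0))\<^sup>2)"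
    unfolding eq expectation_sq_diff[OF X, of h 0] by simp
  also have "\<dots> \<le> expectation (\<lambda>\<omega>. (c * norm h)\<^sup>2)"
  proof (rule integral_mono_AE)
    show "AE \<omega> in M. (norm (X \<omega> h - 0))\<^sup>2 \<le> (c * norm h)\<^sup>2"
      using rop_AE_norm[OF X, of h] by eventually_elim (auto intro: power_mono)
  qed (use rop_integrable_sq[OF X, of h 0] in auto)
  also have "\<dots> = c\<^sup>2 * (norm h)\<^sup>2" by (simp add: prob_space power_mult_distrib)
  finally show "var M X h \<bullet> h \<le> c\<^sup>2 * (norm h)\<^sup>2" .
qed

text \<open>For fixed x, E \<parallel>x - Y h\<parallel>^2 = \<parallel>x - u\<parallel>^2 + E
  \<parallel>Y h - u\<parallel>^2; then x is replaced by the independent X h. Nonnegative integrals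
  allow summing over the basis while finiteness is still unknown.\<close>

lemma indep_var_sq_diff:
  fixes X Y :: "'w \<Rightarrow> 'h operator"
  assumes ind: "indep_var opM X opM Y" and X: "rop X c" and Y: "rop Y c"
    and u: "expect M X h = u" "expect M Y h = u"
  shows "(\<integral>\<^sup>+\<omega>. ennreal ((norm (X \<omega> h - Y \<omega> h))\<^sup>2) \<partial>M)
    = (\<integral>\<^sup>+\<omega>. ennreal ((norm (X \<omega> h - u))\<^sup>2) \<partial>M) + (\<integral>\<^sup>+\<omega>. ennreal ((norm (Y \<omega> h - u))\<^sup>2) \<partial>M)"
proof -
  have [measurable]: "X \<in> M \<rightarrow>\<^sub>M opM" "Y \<in> M \<rightarrow>\<^sub>M opM" using X Y by (auto intro: rop_measurable)
  have fst [measurable]: "(\<lambda>p. blinfun_apply (fst p) h) \<in> borel_measurable (opM \<Otimes>\<^sub>M opM)"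
    by (rule measurable_compose[OF measurable_fst measurable_opM_eval])
  have snd [measurable]: "(\<lambda>p. blinfun_apply (snd p) h) \<in> borel_measurable (opM \<Otimes>\<^sub>M opM)"
    by (rule measurable_compose[OF measurable_snd measurable_opM_eval])
  let ?J = "\<integral>\<^sup>+\<omega>. ennreal ((norm (Y \<omega> h - u))\<^sup>2) \<partial>M"
  have inner: "(\<integral>\<^sup>+\<omega>'. ennreal ((norm (x - Y \<omega>' h))\<^sup>2) \<partial>M)
     = ennreal ((norm (x - u))\<^sup>2) + ?J" for x
  proof -
    have "(\<integral>\<^sup>+\<omega>'. ennreal ((norm (x - Y \<omega>' h))\<^sup>2) \<partial>M) = ennreal (expectation (\<lambda>\<omega>'. (norm (Y \<omega>' h - x))\<^sup>2))"
      unfolding norm_minus_commute[of x] by (intro nn_integral_eq_integral rop_integrable_sq[OF Y]) simp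
    also have "\<dots> = ennreal ((norm (x - u))\<^sup>2) + ennreal (expectation (\<lambda>\<omega>. (norm (Y \<omega> h - u))\<^sup>2))"
      using expectation_sq_diff[OF Y, of h x] unfolding u(2) norm_minus_commute[of x] by (simp add: ennreal_plus)
    also have "ennreal (expectation (\<lambda>\<omega>. (norm (Y \<omega> h - u))\<^sup>2)) = ?J"
      by (intro nn_integral_eq_integral[symmetric] rop_integrable_sq[OF Y]) simp
    finally show ?thesis .
  qed
  have "(\<integral>\<^sup>+\<omega>. ennreal ((norm (X \<omega> h - Y \<omega> h))\<^sup>2) \<partial>M)
    = (\<integral>\<^sup>+\<omega>. \<integral>\<^sup>+\<omega>'. ennreal ((norm (X \<omega> h - Y \<omega>' h))\<^sup>2) \<partial>M \<partial>M)"
    by (rule nn_integral_indep_var[OF ind, where f = "\<lambda>A B. ennreal ((norm (blinfun_apply A h - blinfun_apply B h))\<^sup>2)"])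
      (simp add: case_prod_beta')
  also have "\<dots> = (\<integral>\<^sup>+\<omega>. ennreal ((norm (X \<omega> h - u))\<^sup>2) + ?J \<partial>M)"
    unfolding inner ..
  also have "\<dots> = (\<integral>\<^sup>+\<omega>. ennreal ((norm (X \<omega> h - u))\<^sup>2) \<partial>M) + ?J"
    by (subst nn_integral_add) (auto simp: emeasure_space_1)
  finally show ?thesis .
qed

lemma nn_integral_hs2:
  assumes "X \<in> M \<rightarrow>\<^sub>M opM"
  shows "(\<integral>\<^sup>+\<omega>. hs2 (X \<omega>) \<partial>M) = (\<Sum>k. \<integral>\<^sup>+\<omega>. ennreal ((norm (X \<omega> (bseq k)))\<^sup>2) \<partial>M)"
  using assms unfolding hs2_def by (intro nn_integral_suminf) measurable

lemma indep_var_hs2_diff: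
  fixes X Y :: "'w \<Rightarrow> 'h operator"
  assumes ind: "indep_var opM X opM Y" and X: "rop X c" and Y: "rop Y c"
    and u: "expect M X = U" "expect M Y = U"
  shows "(\<integral>\<^sup>+\<omega>. hs2 (X \<omega> - Y \<omega>) \<partial>M) = (\<integral>\<^sup>+\<omega>. hs2 (X \<omega> - U) \<partial>M) + (\<integral>\<^sup>+\<omega>. hs2 (Y \<omega> - U) \<partial>M)"
proof -
  have [measurable]: "X \<in> M \<rightarrow>\<^sub>M opM" "Y \<in> M \<rightarrow>\<^sub>M opM" using X Y by (auto intro: rop_measurable)
  have c: "(\<lambda>\<omega>. U) \<in> M \<rightarrow>\<^sub>M opM" by (rule measurable_opMI) simp
  have m: "(\<lambda>\<omega>. X \<omega> - Y \<omega>) \<in> M \<rightarrow>\<^sub>M opM" "(\<lambda>\<omega>. X \<omega> - U) \<in> M \<rightarrow>\<^sub>M opM" "(\<lambda>\<omega>. Y \<omega> - U) \<in> M \<rightarrow>\<^sub>M opM"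
    by (intro measurable_opM_diff rop_measurable[OF X] rop_measurable[OF Y] c)+
  have sq: "(\<integral>\<^sup>+\<omega>. ennreal ((norm (X \<omega> h - Y \<omega> h))\<^sup>2) \<partial>M)
    = (\<integral>\<^sup>+\<omega>. ennreal ((norm (X \<omega> h - U h))\<^sup>2) \<partial>M) + (\<integral>\<^sup>+\<omega>. ennreal ((norm (Y \<omega> h - U h))\<^sup>2) \<partial>M)" for h
    using u by (intro indep_var_sq_diff[OF ind X Y]) simp_all
  show ?thesis
    unfolding nn_integral_hs2[OF m(1)] nn_integral_hs2[OF m(2)] nn_integral_hs2[OF m(3)]
    unfolding minus_blinfun.rep_eq sq
    by (rule suminf_add[OF summableI summableI, symmetric])
qed

text \<open>Independence identifies the quadratic form of the expectation, as E \<parallel>(X - Y)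
  h\<parallel>^2 is twice that of S. The form determines a self-adjoint operator, by
  \<open>norm_le_quadratic_form\<close> with bound 0. The range is (2 c)^2 / 2.\<close>

lemma half_opsq_indep:
  fixes X Y :: "'w \<Rightarrow> 'h operator"
  assumes ind: "indep_var opM X opM Y" and X: "rop X c" and Y: "rop Y c"
    and u: "expect M X = U" "expect M Y = U" and S: "var M X = S" "var M Y = S"
  shows "rop (\<lambda>\<omega>. (1/2) *\<^sub>R opsq (X \<omega> - Y \<omega>)) (2 * c\<^sup>2)"
    and "expect M (\<lambda>\<omega>. (1/2) *\<^sub>R opsq (X \<omega> - Y \<omega>)) = S"
proof -
  have [measurable]: "X \<in> M \<rightarrow>\<^sub>M opM" "Y \<in> M \<rightarrow>\<^sub>M opM" using X Y by (auto intro: rop_measurable)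
  define P where "P \<omega> = (1/2) *\<^sub>R opsq (X \<omega> - Y \<omega>)" for \<omega>
  have sd: "selfadj (X \<omega> - Y \<omega>)" if "\<omega> \<in> space M" for \<omega>
    by (intro selfadj_diff rop_selfadj[OF X] rop_selfadj[OF Y] that)
  have nX: "AE \<omega> in M. norm (X \<omega>) \<le> c" "AE \<omega> in M. norm (Y \<omega>) \<le> c" using X Y by (auto simp: rop_def)
  show P: "rop P (2 * c\<^sup>2)"
    unfolding rop_def
  proof safe
    show "P \<in> M \<rightarrow>\<^sub>M opM" unfolding P_def by measurable
    show "selfadj (P \<omega>)" if "\<omega> \<in> space M" for \<omega>
      using half_opsq(1)[OF sd[OF that]] by (simp add: P_def posop_def)
    show "AE \<omega> in M. norm (P \<omega>) \<le> 2 * c\<^sup>2"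
      using nX AE_space
    proof eventually_elim
      case (elim \<omega>)
      have "norm (P \<omega>) \<le> (norm (X \<omega> - Y \<omega>))\<^sup>2 / 2"
        unfolding P_def by (rule half_opsq(3)[OF sd[OF elim(3)]])
      also have "\<dots> \<le> (2 * c)\<^sup>2 / 2"
        using norm_triangle_ineq4[of "X \<omega>" "Y \<omega>"] elim by (intro divide_right_mono power_mono) auto
      finally show ?case by (simp add: power_mult_distrib)
    qed
  qed
  have Pq: "P \<omega> h \<bullet> h = (norm (X \<omega> h - Y \<omega> h))\<^sup>2 / 2" if "\<omega> \<in> space M" for \<omega> h
    unfolding P_def half_opsq(2)[OF sd[OF that]] by (simp add: minus_blinfun.rep_eq)
  have q: "expect M P h \<bullet> h = S h \<bullet> h" for h
  proof -
    have "ennreal (expect M P h \<bullet> h) = ennreal (expectation (\<lambda>\<omega>. (norm (X \<omega> h - Y \<omega> h))\<^sup>2 / 2))"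
      unfolding expect_inner[OF P, symmetric]
      by (intro arg_cong[of _ _ ennreal] Bochner_Integration.integral_cong) (simp_all add: Pq)
    also have "\<dots> = (\<integral>\<^sup>+\<omega>. ennreal ((norm (X \<omega> h - Y \<omega> h))\<^sup>2 / 2) \<partial>M)"
    proof (rule nn_integral_eq_integral[symmetric])
      show "integrable M (\<lambda>\<omega>. (norm (X \<omega> h - Y \<omega> h))\<^sup>2 / 2)"
      proof -
        have "integrable M (\<lambda>\<omega>. P \<omega> h \<bullet> h) \<longleftrightarrow> ?thesis"
          by (intro Bochner_Integration.integrable_cong) (simp_all add: Pq)
        then show ?thesis using rop_integrable[OF P, of h] by simp
      qed
    qed simp
    also have "\<dots> = ennreal (1/2) * (\<integral>\<^sup>+\<omega>. ennreal ((norm (X \<omega> h - Y \<omega> h))\<^sup>2) \<partial>M)"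
      by (subst nn_integral_cmult[symmetric]) (simp_all add: ennreal_mult'[symmetric] del: ennreal_half)
    also have "\<dots> = ennreal (1/2) * (ennreal (S h \<bullet> h) + ennreal (S h \<bullet> h))"
    proof -
      have "(\<integral>\<^sup>+\<omega>. ennreal ((norm (X \<omega> h - U h))\<^sup>2) \<partial>M) = ennreal (S h \<bullet> h)"
        using var_quadratic_form(1)[OF X, of h] u S
        by (subst nn_integral_eq_integral) (auto intro: rop_integrable_sq[OF X])
      moreover have "(\<integral>\<^sup>+\<omega>. ennreal ((norm (Y \<omega> h - U h))\<^sup>2) \<partial>M) = ennreal (S h \<bullet> h)"
        using var_quadratic_form(1)[OF Y, of h] u S
        by (subst nn_integral_eq_integral) (auto intro: rop_integrable_sq[OF Y])
      ultimately show ?thesis using indep_var_sq_diff[OF ind X Y, of h "U h"] u by simp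
    qed
    also have "\<dots> = ennreal (S h \<bullet> h)"
    proof -
      have "0 \<le> S h \<bullet> h" using var_quadratic_form(3)[OF X, of h] S by simp
      then show ?thesis by (simp add: ennreal_plus[symmetric] ennreal_mult'[symmetric] del: ennreal_plus ennreal_half)
    qed
    finally have e: "ennreal (expect M P h \<bullet> h) = ennreal (S h \<bullet> h)" .
    have "0 \<le> expect M P h \<bullet> h"
      unfolding expect_inner[OF P, symmetric] by (intro Bochner_Integration.integral_nonneg) (simp add: Pq)
    moreover have "0 \<le> S h \<bullet> h" using var_quadratic_form(3)[OF X, of h] S by simp
    ultimately show ?thesis using e by simp
  qed
  have "norm (expect M P - S) \<le> 0"
    using selfadj_expect[OF P] var_quadratic_form(2)[OF X] q unfolding S
    by (intro norm_le_quadratic_form selfadj_diff) (auto simp: minus_blinfun.rep_eq inner_diff_left)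
  then show "expect M P = S" by simp
qed

lemma pairsq_cong: "X (2 * i - 1) = Y (2 * i - 1) \<Longrightarrow> X (2 * i) = Y (2 * i) \<Longrightarrow> pairsq X i = pairsq Y i"
  by (simp add: pairsq_def)

lemma indep_vars_pairsq:
  fixes X :: "nat \<Rightarrow> 'w \<Rightarrow> 'h operator"
  assumes ind: "indep_vars (\<lambda>_. opM) X {1..2 * m}"
  shows "indep_vars (\<lambda>_. opM) (\<lambda>i \<omega>. pairsq (\<lambda>i. X i \<omega>) i) {1..m}"
proof -
  define J where "J i = {2 * i - 1, 2 * i}" for i :: nat
  have "indep_vars (\<lambda>i. PiM (J i) (\<lambda>_. opM)) (\<lambda>i \<omega>. restrict (\<lambda>j. X j \<omega>) (J i)) {1..m}"
    using ind
  proof (rule indep_vars_restrict)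
    show "J i \<subseteq> {1..2 * m}" if "i \<in> {1..m}" for i using that by (auto simp: J_def)
    show "disjoint_family_on J {1..m}"
    proof -
      \<comment> \<open>The block of an index is recovered from the index, hence the blocks are
        disjoint.\<close>
      have "(x + 1) div 2 = i" if "x \<in> J i" "i \<in> {1..m}" for x i
        using that by (auto simp: J_def)
      then show ?thesis unfolding disjoint_family_on_def by (metis disjoint_iff)
    qed
  qed
  then have "indep_vars (\<lambda>_. opM) (\<lambda>i \<omega>. pairsq (restrict (\<lambda>j. X j \<omega>) (J i)) i) {1..m}"
  proof (rule indep_vars_compose2)
    fix i assume "i \<in> {1..m}"
    have "(\<lambda>f. f (2 * i - 1)) \<in> PiM (J i) (\<lambda>_. opM) \<rightarrow>\<^sub>M (opM :: 'h operator measure)"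
      "(\<lambda>f. f (2 * i)) \<in> PiM (J i) (\<lambda>_. opM) \<rightarrow>\<^sub>M (opM :: 'h operator measure)"
      by (auto intro!: measurable_component_singleton simp: J_def)
    then show "(\<lambda>f. pairsq f i) \<in> PiM (J i) (\<lambda>_. opM) \<rightarrow>\<^sub>M (opM :: 'h operator measure)"
      unfolding pairsq_def by (intro measurable_opM_scaleR measurable_opM_opsq measurable_opM_diff)
  qed
  moreover have "pairsq (restrict (\<lambda>j. X j \<omega>) (J i)) i = pairsq (\<lambda>i. X i \<omega>) i" for i \<omega>
    by (rule pairsq_cong) (auto simp: J_def)
  ultimately show ?thesis by simp
qed

lemma indep_var_pair:
  fixes X :: "nat \<Rightarrow> 'w \<Rightarrow> 'h operator"
  assumes ind: "indep_vars (\<lambda>_. opM) X {1..2 * m}" and i: "i \<in> {1..m}"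
  shows "indep_var opM (X (2 * i - 1)) opM (X (2 * i))"
proof -
  have "indep_vars (\<lambda>_. opM) X (insert (2 * i) {2 * i - 1})"
    by (rule indep_vars_subset[OF ind]) (use i in auto)
  \<comment> \<open>A sum with one term, so that \<open>indep_var_sum_opM\<close> yields an
    independent pair.\<close>
  then have "indep_var opM (\<lambda>\<omega>. \<Sum>j\<in>{2 * i - 1}. X j \<omega>) opM (X (2 * i))"
    using i by (intro indep_var_sum_opM) auto
  then show ?thesis by simp
qed

end

section \<open>Estimating the effective rank\<close>

context hilbert_space
begin

lemma ptr_opsq:
  assumes D: "selfadj (blinfun_apply D)"
  shows "posop (opsq D)" "ptr (opsq D) = hs2 D"
proof -
  have *: "opsq D x \<bullet> x = (norm (D x))\<^sup>2" for x
    using selfadj_inner[OF D] by (simp add: opsq_def power2_norm_eq_inner)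
  show "posop (opsq D)" unfolding posop_def * using D by (auto simp: selfadj_def opsq_def)
  show "ptr (opsq D) = hs2 D" by (simp add: ptr_def hs2_def *)
qed

lemma hs2_diff_le_four:
  assumes "hs2 S \<le> ennreal B" "hs2 T \<le> ennreal B" "0 \<le> B"
  shows "hs2 (S - T) \<le> ennreal (4 * B)"
proof -
  have "hs2 (S - T) \<le> 2 * ennreal B + 2 * ennreal B"
    by (rule order_trans[OF hs2_diff_le]) (intro add_mono mult_left_mono assms, simp_all)
  also have "\<dots> = ennreal (4 * B)"
  proof -
    have "2 * ennreal B = ennreal (2 * B)" using assms(3) by (simp add: ennreal_mult')
    then show ?thesis using assms(3) by (simp add: ennreal_plus[symmetric] del: ennreal_plus)
  qed
  finally show ?thesis .
qed

text \<open>Half of 4 B, where 4 B = 2 B + 2 B is the parallelogram bound for the squared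
  Hilbert-Schmidt norm of a difference.\<close>

lemma ptr_half_opsq_diff_le:
  assumes "selfadj (blinfun_apply S)" "selfadj (blinfun_apply T)"
    and "hs2 S \<le> ennreal B" "hs2 T \<le> ennreal B" "0 \<le> B"
  shows "ptr ((1/2) *\<^sub>R opsq (S - T)) \<le> ennreal (2 * B)"
proof -
  have "ptr ((1/2) *\<^sub>R opsq (S - T)) = ennreal (1/2) * hs2 (S - T)"
    by (intro half_opsq(4) selfadj_diff assms)
  also have "\<dots> \<le> ennreal (1/2) * ennreal (4 * B)"
    by (intro mult_left_mono hs2_diff_le_four assms) simp
  also have "\<dots> = ennreal (2 * B)" using assms(5) by (subst ennreal_mult'[symmetric]) auto
  finally show ?thesis .
qed

text \<open>The inner difference is one of two operators between 0 and 2 c^2, so its norm is at most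
  2 c^2 and not just 4 c^2. Its squared Hilbert-Schmidt norm is then at most c^2 (4 B + 4 B), and
  half of this is 4 B c^2.\<close>

lemma ptr_half_opsq_half_opsq_le:
  assumes D: "selfadj (blinfun_apply D)" "norm D \<le> 2 * c" "hs2 D \<le> ennreal (4 * B)"
    and E: "selfadj (blinfun_apply E)" "norm E \<le> 2 * c" "hs2 E \<le> ennreal (4 * B)"
    and pos: "0 < c" "0 \<le> B"
  shows "ptr ((1/2) *\<^sub>R opsq ((1/2) *\<^sub>R opsq D - (1/2) *\<^sub>R opsq E)) \<le> ennreal (4 * B * c\<^sup>2)"
proof -
  define A where "A = (1/2) *\<^sub>R opsq D - (1/2) *\<^sub>R opsq E"
  have sA: "selfadj (blinfun_apply A)"
    unfolding A_def using half_opsq(1)[OF D(1)] half_opsq(1)[OF E(1)] by (intro selfadj_diff) (auto simp: posop_def)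
  have bd: "0 \<le> ((1/2) *\<^sub>R opsq F) x \<bullet> x \<and> ((1/2) *\<^sub>R opsq F) x \<bullet> x \<le> 2 * c\<^sup>2 * (norm x)\<^sup>2"
    if F: "selfadj (blinfun_apply F)" "norm F \<le> 2 * c" for F x
  proof -
    have "norm (F x) \<le> 2 * c * norm x"
      using norm_blinfun[of F x] mult_right_mono[OF F(2), of "norm x"] by simp
    then have "(norm (F x))\<^sup>2 \<le> (2 * c * norm x)\<^sup>2" by (intro power_mono) auto
    then show ?thesis unfolding half_opsq(2)[OF F(1)] by (simp add: power_mult_distrib)
  qed
  have "norm A \<le> 2 * c\<^sup>2"
  proof (rule norm_le_quadratic_form[OF sA])
    fix x
    show "\<bar>A x \<bullet> x\<bar> \<le> 2 * c\<^sup>2 * (norm x)\<^sup>2"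
      using bd[OF D(1,2), of x] bd[OF E(1,2), of x] unfolding abs_le_iff
      by (auto simp: A_def minus_blinfun.rep_eq inner_diff_left)
  qed simp
  have "ptr ((1/2) *\<^sub>R opsq A) = ennreal (1/2) * hs2 A" by (rule half_opsq(4)[OF sA])
  also have "\<dots> \<le> ennreal (1/2) * (ennreal (2 * c\<^sup>2 / 2) * (hs2 D + hs2 E))"
    using pos by (intro mult_left_mono hs2_diff_half_opsq_le[OF D(1) E(1) A_def \<open>norm A \<le> 2 * c\<^sup>2\<close>]) auto
  also have "\<dots> \<le> ennreal (1/2) * (ennreal (2 * c\<^sup>2 / 2) * (ennreal (4 * B) + ennreal (4 * B)))"
    by (intro mult_left_mono add_mono D E) auto
  also have "\<dots> = ennreal (1/2 * (2 * c\<^sup>2 / 2 * (4 * B + 4 * B)))"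
  proof -
    have "ennreal x * (ennreal y * (ennreal z + ennreal z)) = ennreal (x * (y * (z + z)))"
      if "0 \<le> x" "0 \<le> y" "0 \<le> z" for x y z
      using that by (simp only: ennreal_mult' ennreal_plus add_nonneg_nonneg mult_nonneg_nonneg)
    note eq = this
    show ?thesis using pos by (intro eq) auto
  qed
  also have "1/2 * (2 * c\<^sup>2 / 2 * (4 * B + 4 * B)) = 4 * B * c\<^sup>2" by simp
  finally show ?thesis by (simp only: A_def)
qed

end

context hilbert_prob_space
begin

lemma nn_integral_ptr:
  assumes P: "rop P c" and pos: "\<And>\<omega>. \<omega> \<in> space M \<Longrightarrow> posop (P \<omega>)"
  shows "(\<integral>\<^sup>+\<omega>. ptr (P \<omega>) \<partial>M) = ptr (expect M P)"
proof -
  have [measurable]: "P \<in> M \<rightarrow>\<^sub>M opM" by (rule rop_measurable[OF P])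
  have "(\<integral>\<^sup>+\<omega>. ptr (P \<omega>) \<partial>M) = (\<Sum>k. \<integral>\<^sup>+\<omega>. ennreal (P \<omega> (bseq k) \<bullet> bseq k) \<partial>M)"
    unfolding ptr_def by (rule nn_integral_suminf) measurable
  also have "\<dots> = (\<Sum>k. ennreal (expectation (\<lambda>\<omega>. P \<omega> (bseq k) \<bullet> bseq k)))"
    using pos rop_integrable[OF P]
    by (intro suminf_cong nn_integral_eq_integral) (auto intro!: AE_I2 simp: posop_def)
  finally show ?thesis by (simp add: ptr_def expect_inner[OF P])
qed

lemma expectation_enn2real:
  assumes "f \<in> borel_measurable M" "AE \<omega> in M. f \<omega> < top"
  shows "expectation (\<lambda>\<omega>. enn2real (f \<omega>)) = enn2real (\<integral>\<^sup>+\<omega>. f \<omega> \<partial>M)"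
proof -
  have "expectation (\<lambda>\<omega>. enn2real (f \<omega>)) = enn2real (\<integral>\<^sup>+\<omega>. ennreal (enn2real (f \<omega>)) \<partial>M)"
    using assms(1) by (intro integral_eq_nn_integral) auto
  also have "(\<integral>\<^sup>+\<omega>. ennreal (enn2real (f \<omega>)) \<partial>M) = (\<integral>\<^sup>+\<omega>. f \<omega> \<partial>M)"
    using assms(2) by (intro nn_integral_cong_AE) (auto elim!: eventually_mono)
  finally show ?thesis .
qed

lemma indep_vars_ptr:
  assumes "indep_vars (\<lambda>_. opM) P I"
  shows "indep_vars (\<lambda>_. borel) (\<lambda>i \<omega>. enn2real (ptr (P i \<omega>))) I"
proof (rule indep_vars_compose2[OF assms])
  have "(\<lambda>A. A) \<in> opM \<rightarrow>\<^sub>M (opM :: 'h operator measure)" by simp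
  then show "(\<lambda>A. enn2real (ptr A)) \<in> borel_measurable opM" by measurable
qed

end

lemma sum_pairs: "(\<Sum>j=1..q. f (2 * j - 1) + f (2 * j)) = (\<Sum>i=1..2 * q. f i :: real)" for q :: nat
  by (induction q) simp_all

text \<open>The event \<open>E\<close> need not be measurable, because \<open>measure\<close> is 0 on non-measurable sets.\<close>

lemma (in prob_space) prob_le_if_subset_null_Un:
  assumes "A \<in> events" "B \<in> events" "C \<in> events"
    and "AE \<omega> in M. \<omega> \<in> E \<longrightarrow> \<omega> \<in> A \<or> \<omega> \<in> B \<or> \<omega> \<in> C"
    and "prob A \<le> a" "prob B \<le> b" "prob C \<le> c"
  shows "measure M E \<le> a + (b + c)"
proof (cases "E \<in> events")
  case True
  have "prob E \<le> prob (A \<union> (B \<union> C))"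
    using assms by (intro finite_measure_mono_AE) auto
  also have "\<dots> \<le> prob A + (prob B + prob C)"
    using measure_Un_le[of A M "B \<union> C"] measure_Un_le[of B M C] assms by simp
  finally show ?thesis using assms by linarith
next
  case False
  then show ?thesis using assms measure_nonneg[of M A] measure_nonneg[of M B] measure_nonneg[of M C]
    by (simp add: measure_notin_sets del: measure_nonneg)
qed

theorem theoremA1:
  fixes K :: "complex set"
    and smult :: "complex \<Rightarrow> 'h::{real_inner,banach,second_countable_topology} \<Rightarrow> 'h"
    and ip :: "'h \<Rightarrow> 'h \<Rightarrow> complex"
    and M :: "'w measure"
    and n :: nat
    and X :: "nat \<Rightarrow> 'w \<Rightarrow> 'h operator"
    and c B :: real
    and \<mu> S S' V :: "'h operator"
    and \<delta>\<^sub>2 \<delta>\<^sub>3 :: real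
  assumes hilbert: "hilbert_space K smult ip"
    and prob: "prob_space M"
    and n: "n \<ge> 8" "4 dvd n"
    and indep: "prob_space.indep_vars M (\<lambda>_. borel) X {1..n}"
    and compact: "\<And>i \<omega>. i \<in> {1..n} \<Longrightarrow> \<omega> \<in> space M \<Longrightarrow> compact_operator (X i \<omega>)"
    and self_adjoint: "\<And>i \<omega>. i \<in> {1..n} \<Longrightarrow> \<omega> \<in> space M \<Longrightarrow> self_adjoint ip (X i \<omega>)"
    and pos: "c > 0" "B > 0"
    and bound_norm: "\<And>i. i \<in> {1..n} \<Longrightarrow> AE \<omega> in M. norm (X i \<omega>) \<le> c"
    and bound_tr: "\<And>i. i \<in> {1..n} \<Longrightarrow>
          AE \<omega> in M. finite_trace ip (opsq (X i \<omega>)) \<and> tr ip (opsq (X i \<omega>)) \<le> B"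
    and mean: "\<And>i. i \<in> {1..n} \<Longrightarrow> expect M (X i) = \<mu>"
    and variance: "\<And>i. i \<in> {1..n} \<Longrightarrow> var M (X i) = S"
    and variance': "\<And>i. i \<in> {1..n} \<Longrightarrow> var M (\<lambda>\<omega>. opsq (X i \<omega> - \<mu>) - S) = S'"
    and nonzero: "S \<noteq> 0"
    and V: "V = (\<Sum>i=1..n. var M (X i))"
    and \<delta>\<^sub>2: "0 < \<delta>\<^sub>2" "\<delta>\<^sub>2 < 1"
    and \<delta>\<^sub>3: "0 < \<delta>\<^sub>3" "\<delta>\<^sub>3 < 1"
  shows "measure M {\<omega> \<in> space M. ereal (tr ip V / norm V) \<ge>
             (if sigma2_l ip B c n (\<lambda>i. X i \<omega>) \<delta>\<^sub>3 = 0 then \<infinity>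
              else ereal (tau_u ip B n (\<lambda>i. X i \<omega>) \<delta>\<^sub>2 / sigma2_l ip B c n (\<lambda>i. X i \<omega>) \<delta>\<^sub>3))}
           \<le> \<delta>\<^sub>2 + \<delta>\<^sub>3
       \<and> measure M {\<omega> \<in> space M. tr ip V / norm V \<le>
             tau_l ip B n (\<lambda>i. X i \<omega>) \<delta>\<^sub>2 / sigma2_u ip B c n (\<lambda>i. X i \<omega>) \<delta>\<^sub>3}
           \<le> \<delta>\<^sub>2 + \<delta>\<^sub>3"
proof -

  \<comment> \<open>The sample in the coarser sigma-algebra and its almost sure bounds\<close>
  interpret hilbert_prob_space K smult ip M
    using hilbert prob by (intro hilbert_prob_space.intro)
  define m where "m = n div 2"
  define q where "q = n div 4"
  have nm: "n = 2 * m" "m = 2 * q" and q: "q \<ge> 2" and m: "m \<ge> 2"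
    using n by (auto simp: m_def q_def elim!: dvdE)
  have rn: "real n / 2 = real m" "real n / 4 = real q" "2 / real n = 1 / real m" "4 / real n = 1 / real q"
    using m by (auto simp: nm)
  have sa: "selfadj (X i \<omega>)" if "i \<in> {1..n}" "\<omega> \<in> space M" for i \<omega>
    using self_adjoint[OF that] by (simp add: self_adjoint_def selfadj_def)
  have rX: "rop (X i) c" if "i \<in> {1..n}" for i
    using indep that sa bound_norm unfolding rop_def
    by (auto simp: indep_vars_def intro: measurable_compose[OF _ measurable_borel_opM])
  have indX: "indep_vars (\<lambda>_. opM) X {1..2 * m}"
    unfolding nm(1)[symmetric] by (rule indep_vars_compose2[OF indep measurable_borel_opM])
  \<comment> \<open>\<open>finite_trace\<close> excludes that the bound by \<open>B\<close> holds
    merely because a divergent trace is 0.\<close>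
  have AEX: "AE \<omega> in M. \<forall>i\<in>{1..n}. norm (X i \<omega>) \<le> c \<and> hs2 (X i \<omega>) \<le> ennreal B"
  proof (subst AE_finite_all, simp, intro ballI)
    fix i assume i: "i \<in> {1..n}"
    show "AE \<omega> in M. norm (X i \<omega>) \<le> c \<and> hs2 (X i \<omega>) \<le> ennreal B"
      using bound_norm[OF i] bound_tr[OF i] AE_space
    proof eventually_elim
      case (elim \<omega>)
      then have "ptr (opsq (X i \<omega>)) = ennreal (tr ip (opsq (X i \<omega>)))"
        using ptr_opsq(1)[OF sa[OF i elim(3)]] by (intro tr_posop(2)) auto
      then show ?case using elim ptr_opsq(2)[OF sa[OF i elim(3)]] by (auto intro: ennreal_leI)
    qed
  qed

  \<comment> \<open>The operators X' as independent unbiased estimates of S\<close>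
  define P where "P i \<omega> = pairsq (\<lambda>i. X i \<omega>) i" for i \<omega>
  have P_alt: "P i = (\<lambda>\<omega>. (1/2) *\<^sub>R opsq (X (2 * i - 1) \<omega> - X (2 * i) \<omega>))" for i
    by (simp add: P_def pairsq_def fun_eq_iff)
  have idx: "2 * i - 1 \<in> {1..n}" "2 * i \<in> {1..n}" if "i \<in> {1..m}" for i
    using that by (auto simp: nm(1))
  have P: "rop (P i) (2 * c\<^sup>2)" "expect M (P i) = S" if i: "i \<in> {1..m}" for i
    unfolding P_alt using idx[OF i] mean variance
    by (intro half_opsq_indep[OF indep_var_pair[OF indX i] rX rX]; simp)+
  have posP: "posop (P i \<omega>)" if "i \<in> {1..m}" "\<omega> \<in> space M" for i \<omega>
    unfolding P_alt using idx[OF that(1)] that(2) by (intro half_opsq(1) selfadj_diff sa)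
  have indP: "indep_vars (\<lambda>_. opM) P {1..2 * q}"
    unfolding P_def nm(2)[symmetric] by (rule indep_vars_pairsq[OF indX])
  have S: "selfadj (blinfun_apply S)" "0 \<le> S h \<bullet> h" "S h \<bullet> h \<le> c\<^sup>2 * (norm h)\<^sup>2" for h
    using var_quadratic_form[OF rX[of 1]] variance[of 1] q nm by auto
  have posS: "posop S" using S by (simp add: posop_def)

  \<comment> \<open>The operators X''\<close>
  define Q where "Q j \<omega> = pairsq (\<lambda>i. P i \<omega>) j" for j \<omega>
  have Q_alt: "Q j \<omega> = (1/2) *\<^sub>R opsq (P (2 * j - 1) \<omega> - P (2 * j) \<omega>)" for j \<omega>
    by (simp add: Q_def pairsq_def)
  have jdx: "2 * j - 1 \<in> {1..m}" "2 * j \<in> {1..m}" if "j \<in> {1..q}" for j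
    using that by (auto simp: nm(2))
  have indQ: "indep_vars (\<lambda>_. opM) Q {1..q}"
    unfolding Q_def by (rule indep_vars_pairsq[OF indP])
  have saP: "selfadj (P i \<omega>)" if "i \<in> {1..m}" "\<omega> \<in> space M" for i \<omega>
    using posP[OF that] by (simp add: posop_def)
  have posQ: "posop (Q j \<omega>)" if "j \<in> {1..q}" "\<omega> \<in> space M" for j \<omega>
    unfolding Q_alt using jdx[OF that(1)] that(2) by (intro half_opsq(1) selfadj_diff saP)

  have AEP: "AE \<omega> in M. \<forall>i\<in>{1..m}. ptr (P i \<omega>) \<le> ennreal (2 * B)"
    using AEX AE_space
  proof eventually_elim
    case (elim \<omega>)
    then show ?case
      unfolding P_alt using idx pos by (intro ballI ptr_half_opsq_diff_le sa) auto
  qed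
  have AEQ: "AE \<omega> in M. \<forall>j\<in>{1..q}. ptr (Q j \<omega>) \<le> ennreal (4 * B * c\<^sup>2)"
    using AEX AE_space
  proof eventually_elim
    case (elim \<omega>)
    show ?case
    proof
      fix j assume j: "j \<in> {1..q}"
      have D: "selfadj (X (2 * i - 1) \<omega> - X (2 * i) \<omega>)" "norm (X (2 * i - 1) \<omega> - X (2 * i) \<omega>) \<le> 2 * c"
        "hs2 (X (2 * i - 1) \<omega> - X (2 * i) \<omega>) \<le> ennreal (4 * B)" if "i \<in> {1..m}" for i
      proof -
        show "selfadj (X (2 * i - 1) \<omega> - X (2 * i) \<omega>)" by (intro selfadj_diff sa idx that elim)
        have "norm (X (2 * i - 1) \<omega>) \<le> c" "norm (X (2 * i) \<omega>) \<le> c" using elim(1) idx[OF that] by auto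
        then show "norm (X (2 * i - 1) \<omega> - X (2 * i) \<omega>) \<le> 2 * c"
          using norm_triangle_ineq4[of "X (2 * i - 1) \<omega>" "X (2 * i) \<omega>"] by linarith
        show "hs2 (X (2 * i - 1) \<omega> - X (2 * i) \<omega>) \<le> ennreal (4 * B)"
          using elim(1) idx[OF that] pos by (intro hs2_diff_le_four) auto
      qed
      show "ptr (Q j \<omega>) \<le> ennreal (4 * B * c\<^sup>2)"
        unfolding Q_alt P_alt using pos jdx[OF j] by (intro ptr_half_opsq_half_opsq_le D) auto
    qed
  qed

  \<comment> \<open>Traces as bounded scalar variables, and their means\<close>
  define Z where "Z i \<omega> = enn2real (ptr (P i \<omega>))" for i \<omega>
  define Z' where "Z' j \<omega> = enn2real (ptr (Q j \<omega>))" for j \<omega>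
  have rvP: "P i \<in> M \<rightarrow>\<^sub>M opM" if "i \<in> {1..m}" for i using P(1)[OF that] by (rule rop_measurable)
  have rvQ: "Q j \<in> M \<rightarrow>\<^sub>M opM" if "j \<in> {1..q}" for j using indQ that by (auto simp: indep_vars_def)
  have Z_range: "AE \<omega> in M. 0 \<le> Z i \<omega> \<and> Z i \<omega> \<le> 2 * B" if "i \<in> {1..m}" for i
    using AEP
  proof eventually_elim
    case (elim \<omega>)
    then show ?case using that pos enn2real_mono[of "ptr (P i \<omega>)" "ennreal (2 * B)"] by (auto simp: Z_def)
  qed
  have Z'_range: "AE \<omega> in M. 0 \<le> Z' j \<omega> \<and> Z' j \<omega> \<le> 4 * B * c\<^sup>2" if "j \<in> {1..q}" for j
    using AEQ
  proof eventually_elim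
    case (elim \<omega>)
    then show ?case using that pos enn2real_mono[of "ptr (Q j \<omega>)" "ennreal (4 * B * c\<^sup>2)"] by (auto simp: Z'_def)
  qed
  have EZ: "expectation (Z i) = tr ip S" if i: "i \<in> {1..m}" for i
  proof -
    have "AE \<omega> in M. ptr (P i \<omega>) < top"
      using AEP by eventually_elim (use i in \<open>auto intro: le_less_trans[OF _ ennreal_less_top]\<close>)
    then have "expectation (Z i) = enn2real (\<integral>\<^sup>+\<omega>. ptr (P i \<omega>) \<partial>M)"
      unfolding Z_def using rvP[OF i] by (intro expectation_enn2real measurable_ptr)
    also have "(\<integral>\<^sup>+\<omega>. ptr (P i \<omega>) \<partial>M) = ptr S"
      using nn_integral_ptr[OF P(1)[OF i] posP[OF i]] P(2)[OF i] by simp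
    finally show ?thesis by (simp add: tr_posop(1)[OF posS])
  qed
  have EQ: "(\<integral>\<^sup>+\<omega>. ptr (Q j \<omega>) \<partial>M) \<le> ennreal (4 * B * c\<^sup>2)" if "j \<in> {1..q}" for j
  proof -
    have "(\<integral>\<^sup>+\<omega>. ptr (Q j \<omega>) \<partial>M) \<le> (\<integral>\<^sup>+\<omega>. ennreal (4 * B * c\<^sup>2) \<partial>M)"
      using AEQ that by (intro nn_integral_mono_AE) (auto elim!: eventually_mono)
    then show ?thesis by (simp add: emeasure_space_1)
  qed
  \<comment> \<open>The variance proxies of the single summands. A priori they may differ with
    \<open>i\<close> and be infinite.\<close>
  define I where "I i = (\<integral>\<^sup>+\<omega>. hs2 (P i \<omega> - S) \<partial>M)" for i
  define v where "v i = enn2real (I i)" for i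
  have IQ: "(\<integral>\<^sup>+\<omega>. ptr (Q j \<omega>) \<partial>M) = ennreal (1/2) * (I (2 * j - 1) + I (2 * j))" if j: "j \<in> {1..q}" for j
  proof -
    note j' = jdx[OF j]
    have "(\<integral>\<^sup>+\<omega>. ptr (Q j \<omega>) \<partial>M) = (\<integral>\<^sup>+\<omega>. ennreal (1/2) * hs2 (P (2 * j - 1) \<omega> - P (2 * j) \<omega>) \<partial>M)"
      unfolding Q_alt using j' by (intro nn_integral_cong half_opsq(4) selfadj_diff saP)
    also have "\<dots> = ennreal (1/2) * (\<integral>\<^sup>+\<omega>. hs2 (P (2 * j - 1) \<omega> - P (2 * j) \<omega>) \<partial>M)"
      using rvP[OF j'(1)] rvP[OF j'(2)] by (intro nn_integral_cmult measurable_hs2 measurable_opM_diff)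
    also have "(\<integral>\<^sup>+\<omega>. hs2 (P (2 * j - 1) \<omega> - P (2 * j) \<omega>) \<partial>M) = I (2 * j - 1) + I (2 * j)"
      unfolding I_def
      by (intro indep_var_hs2_diff[OF indep_var_pair[OF indP j] P(1) P(1)] P(2) j')
    finally show ?thesis .
  qed
  \<comment> \<open>Each proxy occurs in the mean of the bounded variable tr X'' of its pair; the
    pair containing i has index (i + 1) div 2.\<close>
  have I_fin: "I i < top" if i: "i \<in> {1..m}" for i
  proof -
    define j where "j = (i + 1) div 2"
    have j: "j \<in> {1..q}" using i by (auto simp: j_def nm(2))
    have "i = 2 * j - 1 \<or> i = 2 * j" unfolding j_def by presburger
    moreover have "ennreal (1/2) * (I (2 * j - 1) + I (2 * j)) < top"
      unfolding IQ[OF j, symmetric] by (rule le_less_trans[OF EQ[OF j] ennreal_less_top])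
    then have "I (2 * j - 1) + I (2 * j) < top"
      by (auto simp: ennreal_mult_less_top simp del: ennreal_half)
    ultimately show ?thesis by auto
  qed
  have v: "I i = ennreal (v i)" if "i \<in> {1..m}" for i using I_fin[OF that] by (simp add: v_def)
  have v0: "0 \<le> v i" for i by (simp add: v_def)
  have EZ': "expectation (Z' j) = (v (2 * j - 1) + v (2 * j)) / 2" if j: "j \<in> {1..q}" for j
  proof -
    have "AE \<omega> in M. ptr (Q j \<omega>) < top"
      using AEQ by eventually_elim (use j in \<open>auto intro: le_less_trans[OF _ ennreal_less_top]\<close>)
    then have "expectation (Z' j) = enn2real (\<integral>\<^sup>+\<omega>. ptr (Q j \<omega>) \<partial>M)"
      unfolding Z'_def using rvQ[OF j] by (intro expectation_enn2real measurable_ptr)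
    also have "(\<integral>\<^sup>+\<omega>. ptr (Q j \<omega>) \<partial>M) = ennreal ((v (2 * j - 1) + v (2 * j)) / 2)"
      unfolding IQ[OF j] v[OF jdx(1)[OF j]] v[OF jdx(2)[OF j]]
      using v0 by (simp add: ennreal_mult'[symmetric] ennreal_plus[symmetric] del: ennreal_half ennreal_plus)
    finally show ?thesis using v0 by simp
  qed
  define T where "T = (\<Sum>i=1..m. v i)"
  have T0: "0 \<le> T" by (simp add: T_def v0 sum_nonneg)
  \<comment> \<open>Only the average of the proxies enters the operator inequality, and averaging
    within pairs first does not change it, so unequal proxies do no harm.\<close>
  have mean_Z': "(\<Sum>j=1..q. expectation (Z' j)) / q = T / m"
  proof -
    have "(\<Sum>j=1..q. expectation (Z' j)) = (\<Sum>j=1..q. v (2 * j - 1) + v (2 * j)) / 2"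
      by (simp add: EZ' sum_divide_distrib)
    then have "(\<Sum>j=1..q. expectation (Z' j)) = T / 2"
      unfolding sum_pairs nm(2)[symmetric] T_def[symmetric] .
    then show ?thesis by (simp only: nm(2) of_nat_mult)
  qed
  have mean_Z: "(\<Sum>i=1..m. expectation (Z i)) / m = tr ip S" using m by (simp add: EZ)

  \<comment> \<open>The exceptional events and their probabilities\<close>
  define s2 where "s2 = ln (2 / \<delta>\<^sub>2)"
  define s3 where "s3 = ln (2 / (\<delta>\<^sub>3 / 2))"
  have s: "0 < s2" "0 < s3" and es: "2 * exp (- s2) = \<delta>\<^sub>2" "2 * exp (- s3) = \<delta>\<^sub>3 / 2"
    using \<delta>\<^sub>2 \<delta>\<^sub>3 by (auto simp: s2_def s3_def exp_minus)
  define dev where "dev \<omega> = sample_sd m (\<lambda>i. Z i \<omega>) * sqrt (2 * s2 / m) + 7 * (2 * B) * s2 / (3 * (real m - 1))" for \<omega>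
  define dev' where "dev' \<omega> = sample_sd q (\<lambda>i. Z' i \<omega>) * sqrt (2 * s3 / q) + 7 * (4 * B * c\<^sup>2) * s3 / (3 * (real q - 1))" for \<omega>
  \<comment> \<open>On A1 or A2 the trace of S is under- or overestimated, on A3 the average proxy
    is underestimated, on A4 the mean of the X' is far from S. Each claim spends
    \<open>\<delta>\<^sub>2\<close> on A1 or A2, and \<open>\<delta>\<^sub>3 / 2\<close> on each of
    A3 and A4.\<close>
  define A1 where "A1 = {\<omega> \<in> space M. dev \<omega> \<le> tr ip S - (\<Sum>i=1..m. Z i \<omega>) / m}"
  define A2 where "A2 = {\<omega> \<in> space M. dev \<omega> \<le> (\<Sum>i=1..m. Z i \<omega>) / m - tr ip S}"
  define A3 where "A3 = {\<omega> \<in> space M. dev' \<omega> \<le> T / m - (\<Sum>i=1..q. Z' i \<omega>) / q}"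
  define A4 where "A4 = {\<omega> \<in> space M. sqrt (2 * T * s3) + 2 * c\<^sup>2 * s3 / 3 < norm (\<Sum>i=1..m. P i \<omega> - S)}"
  have indZ: "indep_vars (\<lambda>_. borel) Z {1..m}"
    unfolding Z_def nm(2) by (rule indep_vars_ptr[OF indP])
  have indZ': "indep_vars (\<lambda>_. borel) Z' {1..q}"
    unfolding Z'_def by (rule indep_vars_ptr[OF indQ])
  have PA1: "prob A1 \<le> \<delta>\<^sub>2"
    using empirical_bernstein_lower[OF m s(1) indZ, of "2 * B"] Z_range pos
    unfolding A1_def dev_def mean_Z es by simp
  have PA2: "prob A2 \<le> \<delta>\<^sub>2"
    using empirical_bernstein_upper[OF m s(1) indZ, of "2 * B"] Z_range pos
    unfolding A2_def dev_def mean_Z es by simp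
  have PA3: "prob A3 \<le> \<delta>\<^sub>3 / 2"
    using empirical_bernstein_lower[OF q s(2) indZ', of "4 * B * c\<^sup>2"] Z'_range pos
    unfolding A3_def dev'_def mean_Z' es by simp
  have cS: "(\<lambda>A. A - S) \<in> opM \<rightarrow>\<^sub>M opM"
    by (rule measurable_opMI) (simp add: minus_blinfun.rep_eq measurable_opM_eval)
  have PA4: "prob A4 \<le> \<delta>\<^sub>3 / 2"
    unfolding A4_def es(2)[symmetric] T_def
  proof (rule operator_bernstein)
    show "indep_vars (\<lambda>_. opM) (\<lambda>i \<omega>. P i \<omega> - S) {1..m}"
      using indep_vars_compose2[OF indP cS] by (simp add: nm(2))
    fix i assume i: "i \<in> {1..m}"
    show "selfadj (P i \<omega> - S)" if "\<omega> \<in> space M" for \<omega> by (intro selfadj_diff saP i that S)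
    \<comment> \<open>X' lies between 0 and 2 c^2 and S between 0 and c^2, so the difference has its
      quadratic form in [- c^2, 2 c^2]. The range 2 c^2 gives the linear term of
      \<open>Gamma_dev\<close>.\<close>
    show "AE \<omega> in M. norm (P i \<omega> - S) \<le> 2 * c\<^sup>2"
    proof -
      have "AE \<omega> in M. norm (P i \<omega>) \<le> 2 * c\<^sup>2" using P(1)[OF i] by (simp add: rop_def)
      then show ?thesis using AE_space
      proof eventually_elim
        case (elim \<omega>)
        show ?case
        proof (rule norm_le_quadratic_form)
          show "selfadj (P i \<omega> - S)" by (intro selfadj_diff saP i elim S)
          fix x
          have "P i \<omega> x \<bullet> x \<le> norm (P i \<omega> x) * norm x" by (rule norm_cauchy_schwarz)
          also have "\<dots> \<le> (2 * c\<^sup>2 * norm x) * norm x"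
            using norm_blinfun[of "P i \<omega>" x] mult_right_mono[OF elim(1), of "norm x"]
            by (intro mult_right_mono) auto
          finally have "P i \<omega> x \<bullet> x \<le> 2 * c\<^sup>2 * (norm x)\<^sup>2" by (simp add: power2_eq_square)
          moreover have "0 \<le> P i \<omega> x \<bullet> x" using posP[OF i elim(2)] by (simp add: posop_def)
          moreover have "0 \<le> c\<^sup>2 * (norm x)\<^sup>2" by simp
          ultimately show "\<bar>(P i \<omega> - S) x \<bullet> x\<bar> \<le> 2 * c\<^sup>2 * (norm x)\<^sup>2"
            using S(2,3)[of x] by (simp add: minus_blinfun.rep_eq inner_diff_left)
        qed simp
      qed
    qed
    show "expectation (\<lambda>\<omega>. (P i \<omega> - S) h \<bullet> g) = 0" for h g
      using rop_integrable[OF P(1)[OF i], of h] expect_inner[OF P(1)[OF i], of h g] P(2)[OF i]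
      by (simp add: minus_blinfun.rep_eq inner_diff_left prob_space)
    show "(\<integral>\<^sup>+\<omega>. (\<Sum>k. ennreal ((norm ((P i \<omega> - S) (bseq k)))\<^sup>2)) \<partial>M) \<le> ennreal (v i)"
      using v[OF i] by (simp add: I_def hs2_def)
  qed (use pos s v0 in auto)
  have rvZ: "i \<in> {1..m} \<Longrightarrow> Z i \<in> borel_measurable M" for i using indZ by (auto simp: indep_vars_def)
  have rvZ': "i \<in> {1..q} \<Longrightarrow> Z' i \<in> borel_measurable M" for i using indZ' by (auto simp: indep_vars_def)
  have msd: "(\<lambda>\<omega>. sample_sd k (\<lambda>i. f i \<omega>)) \<in> borel_measurable M"
    if f: "\<And>i. i \<in> {1..k} \<Longrightarrow> f i \<in> borel_measurable M" for k and f :: "nat \<Rightarrow> 'w \<Rightarrow> real"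
  proof -
    have [measurable]: "(\<lambda>\<omega>. \<Sum>j=1..k. \<Sum>i\<in>{1..<j}. (f i \<omega> - f j \<omega>)\<^sup>2) \<in> borel_measurable M"
      by (intro borel_measurable_sum borel_measurable_power borel_measurable_diff f) auto
    show ?thesis unfolding sample_sd_def sample_var_def by measurable
  qed
  have mdev: "dev \<in> borel_measurable M" unfolding dev_def using msd[of m Z] rvZ by measurable
  have mdev': "dev' \<in> borel_measurable M" unfolding dev'_def using msd[of q Z'] rvZ' by measurable
  have sets: "A1 \<in> events" "A2 \<in> events" "A3 \<in> events" "A4 \<in> events"
  proof -
    note mdev [measurable] mdev' [measurable] rvZ [measurable] rvZ' [measurable]
    show "A1 \<in> events" "A2 \<in> events" "A3 \<in> events" unfolding A1_def A2_def A3_def by measurable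
    have "(\<lambda>\<omega>. norm (\<Sum>i=1..m. P i \<omega> - S)) \<in> borel_measurable M"
      by (intro measurable_opM_norm measurable_opM_sum measurable_compose[OF rvP cS])
    then show "A4 \<in> events" unfolding A4_def by measurable
  qed

  \<comment> \<open>The effective rank of V as that of S\<close>
  have ptrS: "ptr S < top"
  proof -
    have "1 \<in> {1..m}" using m by simp
    then have "ptr S = (\<integral>\<^sup>+\<omega>. ptr (P 1 \<omega>) \<partial>M)" using nn_integral_ptr[OF P(1) posP] P(2) by metis
    also have "\<dots> \<le> (\<integral>\<^sup>+\<omega>. ennreal (2 * B) \<partial>M)"
      using AEP \<open>1 \<in> {1..m}\<close> by (intro nn_integral_mono_AE) (auto elim!: eventually_mono)
    also have "\<dots> < top" by (simp add: emeasure_space_1)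
    finally show ?thesis .
  qed
  have trS: "0 \<le> tr ip S" by (simp add: tr_posop(1)[OF posS])
  have nS: "0 < norm S" using nonzero by simp
  have ratio: "tr ip V / norm V = tr ip S / norm S"
  proof -
    have "V = real n *\<^sub>R S" using variance by (simp add: V sum_constant_scaleR)
    \<comment> \<open>A sum over a singleton, so that \<open>tr_scaleR_sum_posop\<close> gives
      homogeneity of \<open>tr\<close>.\<close>
    moreover have "tr ip (real n *\<^sub>R (\<Sum>i\<in>{0::nat}. S)) = real n * (\<Sum>i\<in>{0::nat}. tr ip S)"
      by (rule tr_scaleR_sum_posop) (use posS ptrS in auto)
    ultimately show ?thesis using m nm by simp
  qed

  \<comment> \<open>One realisation of the sample, not the operators written X' in the
    overview.\<close>
  define X' where "X' \<omega> = (\<lambda>i. X i \<omega>)" for \<omega>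
  define G where "G \<omega> = Gamma_dev c n (\<delta>\<^sub>3 / 2) (tau_u' ip B c n (X' \<omega>) (\<delta>\<^sub>3 / 2))" for \<omega>
  have good: "AE \<omega> in M. \<omega> \<in> space M \<and>
      tau_u ip B n (X' \<omega>) \<delta>\<^sub>2 = (\<Sum>i=1..m. Z i \<omega>) / m + dev \<omega> \<and>
      tau_l ip B n (X' \<omega>) \<delta>\<^sub>2 = (\<Sum>i=1..m. Z i \<omega>) / m - dev \<omega> \<and>
      (\<omega> \<notin> A3 \<longrightarrow> \<omega> \<notin> A4 \<longrightarrow> \<bar>norm (Sigma_n n (X' \<omega>)) - norm S\<bar> \<le> G \<omega>)"
    using AEP AEQ AE_space
  proof eventually_elim
    case (elim \<omega>)
    have Zt: "tr ip (pairsq (X' \<omega>) i) = Z i \<omega>" if "i \<in> {1..m}" for i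
      using tr_posop(1)[OF posP[OF that elim(3)]] by (simp add: Z_def P_def X'_def)
    have Zt': "tr ip (pairsq (pairsq (X' \<omega>)) j) = Z' j \<omega>" if "j \<in> {1..q}" for j
      using tr_posop(1)[OF posQ[OF that elim(3)]] by (simp add: Z'_def Q_def P_def X'_def)
    have sv: "sample_sd k f = sample_sd k g" if "\<And>i. i \<in> {1..k} \<Longrightarrow> f i = g i" for k f g
      unfolding sample_sd_def sample_var_def using that by (intro arg_cong[of _ _ sqrt] arg_cong2[of _ _ _ _ "(*)"] sum.cong refl) auto
    have trn: "tr ip (Sigma_n n (X' \<omega>)) = (\<Sum>i=1..m. Z i \<omega>) / m"
    proof -
      have "tr ip ((1 / real m) *\<^sub>R (\<Sum>i=1..m. P i \<omega>)) = 1 / real m * (\<Sum>i=1..m. tr ip (P i \<omega>))"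
        by (rule tr_scaleR_sum_posop) (use posP elim in \<open>auto intro: le_less_trans[OF _ ennreal_less_top]\<close>)
      then show ?thesis using Zt
        by (simp add: Sigma_n_def rn m_def[symmetric] P_def X'_def)
    qed
    have trn': "tr ip (Sigma_n' n (X' \<omega>)) = (\<Sum>i=1..q. Z' i \<omega>) / q"
    proof -
      have "tr ip ((1 / real q) *\<^sub>R (\<Sum>i=1..q. Q i \<omega>)) = 1 / real q * (\<Sum>i=1..q. tr ip (Q i \<omega>))"
        by (rule tr_scaleR_sum_posop) (use posQ elim in \<open>auto intro: le_less_trans[OF _ ennreal_less_top]\<close>)
      then show ?thesis using Zt'
        by (simp add: Sigma_n'_def rn q_def[symmetric] Q_def P_def X'_def)
    qed
    have dev: "sample_sd m (\<lambda>i. tr ip (pairsq (X' \<omega>) i)) = sample_sd m (\<lambda>i. Z i \<omega>)"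
      "sample_sd q (\<lambda>i. tr ip (pairsq (pairsq (X' \<omega>)) i)) = sample_sd q (\<lambda>i. Z' i \<omega>)"
      by (intro sv Zt, assumption) (intro sv Zt', assumption)
    have 1: "tau_u ip B n (X' \<omega>) \<delta>\<^sub>2 = (\<Sum>i=1..m. Z i \<omega>) / m + dev \<omega>"
      "tau_l ip B n (X' \<omega>) \<delta>\<^sub>2 = (\<Sum>i=1..m. Z i \<omega>) / m - dev \<omega>"
      unfolding tau_u_def tau_l_def m_def[symmetric] dev trn rn dev_def s2_def by simp_all
    have tu': "tau_u' ip B c n (X' \<omega>) (\<delta>\<^sub>3 / 2) = (\<Sum>i=1..q. Z' i \<omega>) / q + dev' \<omega>"
      unfolding tau_u'_def q_def[symmetric] dev trn' rn dev'_def s3_def by simp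
    have "\<bar>norm (Sigma_n n (X' \<omega>)) - norm S\<bar> \<le> G \<omega>" if "\<omega> \<notin> A3" "\<omega> \<notin> A4"
    proof -
      \<comment> \<open>Off A3 the empirical quantity bounds the unknown average proxy, and the
        Bernstein deviation is monotone in it.\<close>
      have tau: "T / m \<le> tau_u' ip B c n (X' \<omega>) (\<delta>\<^sub>3 / 2)"
        using that(1) elim(3) unfolding tu' A3_def by simp
      have eq: "Sigma_n n (X' \<omega>) - S = (1 / real m) *\<^sub>R (\<Sum>i=1..m. P i \<omega> - S)"
        using m by (simp add: Sigma_n_def rn m_def[symmetric] P_def X'_def sum_subtractf scaleR_right_diff_distrib sum_constant_scaleR)
      have "\<bar>norm (Sigma_n n (X' \<omega>)) - norm S\<bar> \<le> norm (Sigma_n n (X' \<omega>) - S)" by (rule norm_triangle_ineq3)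
      also have "\<dots> = (1 / real m) * norm (\<Sum>i=1..m. P i \<omega> - S)" unfolding eq by simp
      also have "\<dots> \<le> (1 / real m) * (sqrt (2 * T * s3) + 2 * c\<^sup>2 * s3 / 3)"
        using that(2) elim(3) unfolding A4_def by (intro mult_left_mono) auto
      also have "\<dots> = sqrt (2 * (T / m) / m * s3) + 2 * c\<^sup>2 / (3 * real m) * s3"
      proof -
        have "sqrt (2 * (T / m) / m * s3) = sqrt (2 * T * s3 / (real m)\<^sup>2)" by (simp add: power2_eq_square)
        also have "\<dots> = sqrt (2 * T * s3) / m" by (simp add: real_sqrt_divide)
        finally show ?thesis by (simp add: distrib_left)
      qed
      also have "\<dots> \<le> sqrt (2 * tau_u' ip B c n (X' \<omega>) (\<delta>\<^sub>3 / 2) / m * s3) + 2 * c\<^sup>2 / (3 * real m) * s3"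
        using tau s by (intro add_right_mono real_sqrt_le_mono mult_right_mono divide_right_mono mult_left_mono) auto
      also have "\<dots> = G \<omega>" unfolding G_def Gamma_dev_def rn s3_def ..
      finally show ?thesis .
    qed
    with 1 elim show ?case by blast
  qed

  \<comment> \<open>Both claims outside the exceptional events\<close>
  let ?E1 = "{\<omega> \<in> space M. ereal (tr ip V / norm V) \<ge>
             (if sigma2_l ip B c n (\<lambda>i. X i \<omega>) \<delta>\<^sub>3 = 0 then \<infinity>
              else ereal (tau_u ip B n (\<lambda>i. X i \<omega>) \<delta>\<^sub>2 / sigma2_l ip B c n (\<lambda>i. X i \<omega>) \<delta>\<^sub>3))}"
  let ?E2 = "{\<omega> \<in> space M. tr ip V / norm V \<le>
             tau_l ip B n (\<lambda>i. X i \<omega>) \<delta>\<^sub>2 / sigma2_u ip B c n (\<lambda>i. X i \<omega>) \<delta>\<^sub>3}"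
  have "measure M ?E1
        \<le> \<delta>\<^sub>2 + (\<delta>\<^sub>3 / 2 + \<delta>\<^sub>3 / 2)"
  proof (rule prob_le_if_subset_null_Un[OF sets(1,3,4) _ PA1 PA3 PA4])
    show "AE \<omega> in M. \<omega> \<in> ?E1
        \<longrightarrow> \<omega> \<in> A1 \<or> \<omega> \<in> A3 \<or> \<omega> \<in> A4"
      using good
    proof eventually_elim
      case (elim \<omega>)
      define sl where "sl = sigma2_l ip B c n (X' \<omega>) \<delta>\<^sub>3"
      define tu where "tu = tau_u ip B n (X' \<omega>) \<delta>\<^sub>2"
      have "\<omega> \<in> A1 \<or> \<omega> \<in> A3 \<or> \<omega> \<in> A4"
        if *: "ereal (tr ip S / norm S) \<ge> (if sl = 0 then \<infinity> else ereal (tu / sl))"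
      proof (rule ccontr)
        assume no: "\<not> (\<omega> \<in> A1 \<or> \<omega> \<in> A3 \<or> \<omega> \<in> A4)"
        have sl: "sl = max 0 (norm (Sigma_n n (X' \<omega>)) - G \<omega>)"
          by (simp add: sl_def sigma2_l_def sigma2_l_at_def G_def)
        \<comment> \<open>For sl = 0 the threshold is infinite, and a finite ratio cannot reach
          it.\<close>
        have "sl \<noteq> 0" using * by auto
        then have sl0: "0 < sl" and "sl \<le> norm S" using sl elim no by auto
        have "tr ip S < tu" using no elim by (auto simp: A1_def tu_def)
        have "tu / sl \<le> tr ip S / norm S" using * \<open>sl \<noteq> 0\<close> by simp
        also have "\<dots> \<le> tr ip S / sl" using sl0 \<open>sl \<le> norm S\<close> trS nS by (intro divide_left_mono mult_pos_pos) auto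
        also have "\<dots> < tu / sl" using sl0 \<open>tr ip S < tu\<close> by (intro divide_strict_right_mono)
        finally show False by simp
      qed
      then show ?case unfolding ratio sl_def tu_def X'_def by simp
    qed
  qed
  moreover have "measure M ?E2
        \<le> \<delta>\<^sub>2 + (\<delta>\<^sub>3 / 2 + \<delta>\<^sub>3 / 2)"
  proof (rule prob_le_if_subset_null_Un[OF sets(2,3,4) _ PA2 PA3 PA4])
    show "AE \<omega> in M. \<omega> \<in> ?E2
        \<longrightarrow> \<omega> \<in> A2 \<or> \<omega> \<in> A3 \<or> \<omega> \<in> A4"
      using good
    proof eventually_elim
      case (elim \<omega>)
      define su where "su = sigma2_u ip B c n (X' \<omega>) \<delta>\<^sub>3"
      define tl where "tl = tau_l ip B n (X' \<omega>) \<delta>\<^sub>2"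
      have "\<omega> \<in> A2 \<or> \<omega> \<in> A3 \<or> \<omega> \<in> A4" if *: "tr ip S / norm S \<le> tl / su"
      proof (rule ccontr)
        assume no: "\<not> (\<omega> \<in> A2 \<or> \<omega> \<in> A3 \<or> \<omega> \<in> A4)"
        have su: "su = norm (Sigma_n n (X' \<omega>)) + G \<omega>"
          by (simp add: su_def sigma2_u_def sigma2_u_at_def G_def)
        have "norm S \<le> su" using su elim no by auto
        have "tl < tr ip S" using no elim by (auto simp: A2_def tl_def)
        \<comment> \<open>Only tr S, which is nonnegative, changes its denominator, since
          \<open>tl\<close> may be negative; \<open>su\<close> is positive because it is at least
          \<parallel>S\<parallel>.\<close>
        have "tr ip S / su \<le> tr ip S / norm S"
          using \<open>norm S \<le> su\<close> nS trS by (intro divide_left_mono mult_pos_pos) linarith+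
        also have "\<dots> \<le> tl / su" by (rule *)
        also have "\<dots> < tr ip S / su"
          using \<open>tl < tr ip S\<close> \<open>norm S \<le> su\<close> nS by (intro divide_strict_right_mono) linarith+
        finally show False by simp
      qed
      then show ?case unfolding ratio su_def tl_def X'_def by simp
    qed
  qed
  ultimately show ?thesis by simp
qed

end
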